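(* Let $X\subset\mathbb P^n$ be a smooth, irreducible, totally real projective curve, let $\mathrm P=\mathrm P_{X,2}$ be the convex cone of quadratic forms on $X$ that are nonnegative on $X(\mathbb R)$, and let $\mathcal F\setminus\{\{0\}\}$ be the poset of positive-dimensional faces of $\mathrm P$, ordered by inclusion. Let $\Phi$ be the map sending a positive-dimensional face $\mathrm F$ to its face divisor $\operatorname{div}(\mathrm F)$, let $\operatorname{Im}\Phi$ be its image (the set of face divisors), ordered by the usual coefficientwise order $\le$ on divisors, and let $\Psi$ be the map sending $D\in\operatorname{Im}\Phi$ to the associated face $\mathrm F_D$. Then $\Phi$ and $\Psi$ form a (order-reversing) Galois connection between $(\mathcal F\setminus\{\{0\}\},\subset)$ and $(\operatorname{Im}\Phi,\le)$, meaning that for all $\mathrm F\in\mathcal F\setminus\{\{0\}\}$ and all $D\in\operatorname{Im}\Phi$: $$\operatorname{div}(\mathrm F)\le D\iff \mathrm F\supseteq \mathrm F_D .$$ Moreover, $(\Psi\circ\Phi)(\mathrm F)=\mathrm F_{\operatorname{div}(\mathrm F)}=\mathrm F$ for all $\mathrm F\in\mathcal F\setminus\{\{0\}\}$.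
   Context: A real projective curve $X\subset\mathbb P^n=\mathbb P^n(\mathbb C)$ is a curve invariant under coordinatewise complex conjugation; $X(\mathbb R)$ is its set of real points, and $X$ is totally real if $X(\mathbb R)$ is Zariski dense in $X$. $R_2=\mathbb R[X]_2=\mathbb R[x_0,\dots,x_n]_2/\mathcal I(X)_2$ is the space of real quadratic forms on $X$, and $\mathrm P_{X,2}=\{q\in R_2: q(A)\ge 0\ \forall A\in X(\mathbb R)\}$ (the sign of a form of even degree at a real projective point is well defined). For $0\ne q\in R_2$, $\operatorname{div} q$ is its divisor of zeros on $X$ (with multiplicities). For a divisor $D=\sum_{A\in X}a_AA$, $D_{\mathbb R}=\sum_{A\in X(\mathbb R)}a_AA$. A divisor is totally real if its support lies in $X(\mathbb R)$. By convention $\operatorname{div}0\ge E$ for every divisor $E$. A face of a convex cone $\mathrm C$ is a convex cone $\mathrm F\subset\mathrm C$ such that $a,b\in\mathrm C$, $a+b\in\mathrm F$ imply $a,b\in\mathrm F$. The relative interior of a face is its interior in its linear span. Face divisor: for a face $\mathrm F\neq\{0\}$ of $\mathrm P$, $\operatorname{div}(\mathrm F)$ is the unique totally real effective divisor such that $(\operatorname{div} q)_{\mathbb R}=2\operatorname{div}(\mathrm F)$ for all $q$ in the relative interior of $\mathrm F$ (it exists and is unique). Face associated to a totally real effective divisor $D$: $\mathrm F_D=\{q\in\mathrm P:\operatorname{div} q\ge 2D\}$, which is a face of $\mathrm P$. *)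

theory Defs
  imports
    "HOL-Analysis.Analysis"
    "HOL-Library.Poly_Mapping"
    "HOL-Library.Function_Algebras"
    "HOL-Library.Extended_Nat"
begin

section \<open>Polynomials in finitely many variables\<close>

text \<open>The index type \<^typ>\<open>'n\<close> enumerates the homogeneous coordinates, so \<open>CARD('n) = n + 1\<close>
  for \<open>\<P>\<^sup>n\<close>.\<close>

type_synonym 'n mpoly = "('n \<Rightarrow>\<^sub>0 nat) \<Rightarrow>\<^sub>0 complex"

definition eval_mpoly :: "('n::finite) mpoly \<Rightarrow> complex ^ 'n \<Rightarrow> complex" where
  "eval_mpoly p a =
    (\<Sum>m\<in>Poly_Mapping.keys p. Poly_Mapping.lookup p m * (\<Prod>i\<in>UNIV. (a $ i) ^ Poly_Mapping.lookup m i))"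

definition homogeneous :: "nat \<Rightarrow> ('n::finite) mpoly \<Rightarrow> bool" where
  "homogeneous d p \<longleftrightarrow> (\<forall>m\<in>Poly_Mapping.keys p. (\<Sum>i\<in>UNIV. Poly_Mapping.lookup m i) = d)"

definition real_mpoly :: "('n::finite) mpoly \<Rightarrow> bool" where
  "real_mpoly p \<longleftrightarrow> (\<forall>m. Poly_Mapping.lookup p m \<in> \<real>)"

definition ideal_mult :: "'a::comm_ring_1 set \<Rightarrow> 'a set \<Rightarrow> 'a set" where
  "ideal_mult I J = {\<Sum>i<k. f i * g i |(k::nat) f g. \<forall>i<k. f i \<in> I \<and> g i \<in> J}"

primrec ideal_power :: "'a::comm_ring_1 set \<Rightarrow> nat \<Rightarrow> 'a set" where
  "ideal_power I 0 = UNIV"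
| "ideal_power I (Suc k) = ideal_mult I (ideal_power I k)"


section \<open>Complex projective space and the Zariski topology\<close>

typedef (overloaded) 'n proj = "{L :: (complex ^ 'n::finite) set. \<exists>a. a \<noteq> 0 \<and> L = vec.span {a}}"
  morphisms line Abs_proj
proof -
  have "(axis undefined 1 :: complex ^ 'n) \<noteq> 0"
    by (simp add: axis_eq_0_iff)
  then show ?thesis by blast
qed

setup_lifting type_definition_proj

definition conj_vec :: "complex ^ 'n::finite \<Rightarrow> complex ^ 'n" where
  "conj_vec a = (\<chi> i. cnj (a $ i))"

lift_definition conj_pt :: "'n::finite proj \<Rightarrow> 'n proj" is "\<lambda>L. conj_vec ` L"
proof -
  fix L :: "(complex ^ 'n) set"
  assume "\<exists>a. a \<noteq> 0 \<and> L = vec.span {a}"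
  then obtain a where a: "a \<noteq> 0" "L = vec.span {a}" by blast
  have scale: "conj_vec (c *s a) = cnj c *s conj_vec a" for c
    by (simp add: conj_vec_def vec_eq_iff)
  have "conj_vec ` L = (\<lambda>c. cnj c *s conj_vec a) ` UNIV"
    by (auto simp: a vec.span_singleton image_image scale)
  also have "\<dots> = (\<lambda>c. c *s conj_vec a) ` (cnj ` UNIV)"
    by (simp only: image_image)
  also have "cnj ` UNIV = UNIV"
    by (metis complex_cnj_cnj surjI)
  finally have "conj_vec ` L = vec.span {conj_vec a}"
    by (simp add: vec.span_singleton)
  moreover have "conj_vec a \<noteq> 0"
    using a by (auto simp: conj_vec_def vec_eq_iff)
  ultimately show "\<exists>a. a \<noteq> 0 \<and> conj_vec ` L = vec.span {a}" by blast
qed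

definition vanishes_at :: "('n::finite) mpoly \<Rightarrow> 'n proj \<Rightarrow> bool" where
  "vanishes_at p A \<longleftrightarrow> (\<forall>a\<in>line A. eval_mpoly p a = 0)"

definition zariski_closed :: "('n::finite) proj set \<Rightarrow> bool" where
  "zariski_closed V \<longleftrightarrow>
    (\<exists>S. (\<forall>p\<in>S. \<exists>d. homogeneous d p) \<and> V = {A. \<forall>p\<in>S. vanishes_at p A})"

definition zariski_closure :: "('n::finite) proj set \<Rightarrow> 'n proj set" where
  "zariski_closure Y = \<Inter>{V. zariski_closed V \<and> Y \<subseteq> V}"

definition zariski_irreducible :: "('n::finite) proj set \<Rightarrow> bool" where
  "zariski_irreducible Y \<longleftrightarrow> Y \<noteq> {} \<and>
    (\<forall>V W. zariski_closed V \<and> zariski_closed W \<and> Y \<subseteq> V \<union> W \<longrightarrow> Y \<subseteq> V \<or> Y \<subseteq> W)"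

text \<open>Krull dimension of a closed set: supremum of the lengths of chains of irreducible closed
  subsets.\<close>

definition zariski_dim :: "('n::finite) proj set \<Rightarrow> enat" where
  "zariski_dim Y = Sup {enat k |k. \<exists>Z :: nat \<Rightarrow> 'n proj set.
      (\<forall>i\<le>k. zariski_closed (Z i) \<and> zariski_irreducible (Z i) \<and> Z i \<subseteq> Y) \<and>
      (\<forall>i<k. Z i \<subset> Z (Suc i))}"

text \<open>The homogeneous ideal \<open>\<I>(Y)\<close>, as the set of all polynomials vanishing on the affine cone.\<close>

definition vanishing_ideal :: "('n::finite) proj set \<Rightarrow> 'n mpoly set" where
  "vanishing_ideal Y = {p. \<forall>A\<in>Y. vanishes_at p A}"

definition affine_cone :: "('n::finite) proj set \<Rightarrow> (complex ^ 'n) set" where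
  "affine_cone Y = (\<Union>A\<in>Y. line A)"


section \<open>Real projective curves\<close>

definition projective_curve :: "('n::finite) proj set \<Rightarrow> bool" where
  "projective_curve X \<longleftrightarrow> zariski_closed X \<and> zariski_dim X = 1"

definition real_projective_curve :: "('n::finite) proj set \<Rightarrow> bool" where
  "real_projective_curve X \<longleftrightarrow> projective_curve X \<and> conj_pt ` X = X"

text \<open>Zariski tangent space at \<open>a\<close> of the affine cone over \<open>Y\<close>: the common kernel of the
  differentials at \<open>a\<close> of all elements of \<open>\<I>(Y)\<close>.\<close>

definition cone_tangent_space :: "('n::finite) proj set \<Rightarrow> complex ^ 'n \<Rightarrow> (complex ^ 'n) set" where
  "cone_tangent_space Y a =
    {v. \<forall>p\<in>vanishing_ideal Y. deriv (\<lambda>t. eval_mpoly p (a + t *s v)) 0 = 0}"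

text \<open>Jacobian criterion. The tangent space of the cone at \<open>a \<noteq> 0\<close> contains the line through \<open>a\<close>,
  and its quotient by that line is the tangent space of \<open>X\<close> up to a twist; hence dimension \<open>1 + 1\<close>.\<close>

definition smooth_curve :: "('n::finite) proj set \<Rightarrow> bool" where
  "smooth_curve X \<longleftrightarrow> (\<forall>A\<in>X. \<forall>a\<in>line A - {0}. vec.dim (cone_tangent_space X a) = 2)"

definition real_points :: "('n::finite) proj set \<Rightarrow> 'n proj set" where
  "real_points X = {A\<in>X. conj_pt A = A}"

definition totally_real_curve :: "('n::finite) proj set \<Rightarrow> bool" where
  "totally_real_curve X \<longleftrightarrow> X \<subseteq> zariski_closure (real_points X)"


section \<open>The space of real quadratic forms on a curve\<close>

instantiation "fun" :: (type, real_vector) real_vector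
begin

definition scaleR_fun :: "real \<Rightarrow> ('a \<Rightarrow> 'b) \<Rightarrow> 'a \<Rightarrow> 'b" where
  "scaleR_fun c f = (\<lambda>x. c *\<^sub>R f x)"

instance
  by standard (simp_all add: scaleR_fun_def fun_eq_iff scaleR_add_right scaleR_add_left)

end

definition real_quadratic_form :: "('n::finite) mpoly \<Rightarrow> bool" where
  "real_quadratic_form f \<longleftrightarrow> homogeneous 2 f \<and> real_mpoly f"

text \<open>The class of \<open>f\<close> modulo \<open>\<I>(X)\<close> is encoded as the restriction of \<open>f\<close> to the affine cone over
  \<open>X\<close>, extended by \<open>0\<close>; the lemma \<open>restrict_form_eq_iff\<close> below says that the fibres of
  \<open>restrict_form X\<close> are exactly the classes modulo \<open>\<I>(X)\<close>. Thus \<open>R2 X\<close> is the quotient space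
  \<open>\<real>[x]\<^sub>2 / \<I>(X)\<^sub>2\<close>, realised inside the real vector space of all functions.\<close>

definition restrict_form :: "('n::finite) proj set \<Rightarrow> 'n mpoly \<Rightarrow> complex ^ 'n \<Rightarrow> complex" where
  "restrict_form X f = (\<lambda>a. if a \<in> affine_cone X then eval_mpoly f a else 0)"

definition R2 :: "('n::finite) proj set \<Rightarrow> (complex ^ 'n \<Rightarrow> complex) set" where
  "R2 X = restrict_form X ` {f. real_quadratic_form f}"

lemma eval_mpoly_superset:
  assumes "finite M" "Poly_Mapping.keys p \<subseteq> M"
  shows "eval_mpoly p a =
    (\<Sum>m\<in>M. Poly_Mapping.lookup p m * (\<Prod>i\<in>UNIV. (a $ i) ^ Poly_Mapping.lookup m i))"
  unfolding eval_mpoly_def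
  using assms by (intro sum.mono_neutral_left) (auto simp: in_keys_iff)

lemma eval_mpoly_add: "eval_mpoly (p + q) a = eval_mpoly p a + eval_mpoly q a"
proof -
  let ?M = "Poly_Mapping.keys p \<union> Poly_Mapping.keys q"
  have "Poly_Mapping.keys (p + q) \<subseteq> ?M" by (rule Poly_Mapping.keys_add)
  then show ?thesis
    by (simp add: eval_mpoly_superset[of ?M] lookup_add distrib_right sum.distrib)
qed

lemma eval_mpoly_diff: "eval_mpoly (p - q) a = eval_mpoly p a - eval_mpoly q a"
  using eval_mpoly_add[of "p - q" q a] by simp

lemma eval_mpoly_scale:
  "eval_mpoly (Poly_Mapping.map ((*) c) p) a = c * eval_mpoly p a"
proof -
  have "Poly_Mapping.keys (Poly_Mapping.map ((*) c) p) \<subseteq> Poly_Mapping.keys p"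
    by (auto simp: in_keys_iff map.rep_eq when_def)
  then have "eval_mpoly (Poly_Mapping.map ((*) c) p) a =
    (\<Sum>m\<in>Poly_Mapping.keys p. Poly_Mapping.lookup (Poly_Mapping.map ((*) c) p) m *
      (\<Prod>i\<in>UNIV. (a $ i) ^ Poly_Mapping.lookup m i))"
    by (intro eval_mpoly_superset) auto
  also have "\<dots> = c * eval_mpoly p a"
    by (auto simp: eval_mpoly_def map.rep_eq sum_distrib_left in_keys_iff when_def mult.assoc
        intro!: sum.cong)
  finally show ?thesis .
qed

lemma restrict_form_eq_iff:
  "restrict_form X f = restrict_form X g \<longleftrightarrow> f - g \<in> vanishing_ideal X"
  by (auto simp: restrict_form_def fun_eq_iff affine_cone_def vanishing_ideal_def
      vanishes_at_def eval_mpoly_diff)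

lemma subspace_R2: "subspace (R2 X)"
proof (rule subspaceI)
  have "real_quadratic_form (0 :: 'a mpoly)"
    by (simp add: real_quadratic_form_def homogeneous_def real_mpoly_def)
  moreover have "restrict_form X 0 = 0"
    by (simp add: restrict_form_def eval_mpoly_def fun_eq_iff)
  ultimately show "0 \<in> R2 X" unfolding R2_def by force
next
  fix p q assume "p \<in> R2 X" "q \<in> R2 X"
  then obtain f g where fg: "real_quadratic_form f" "p = restrict_form X f"
    "real_quadratic_form g" "q = restrict_form X g" unfolding R2_def by blast
  have "real_quadratic_form (f + g)"
    using fg(1,3) Poly_Mapping.keys_add[of f g]
    by (fastforce simp: real_quadratic_form_def homogeneous_def real_mpoly_def lookup_add)
  moreover have "restrict_form X (f + g) = p + q"
    by (auto simp: fg restrict_form_def fun_eq_iff eval_mpoly_add)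
  ultimately show "p + q \<in> R2 X" unfolding R2_def by force
next
  fix c :: real and p assume "p \<in> R2 X"
  then obtain f where f: "real_quadratic_form f" "p = restrict_form X f"
    unfolding R2_def by blast
  let ?g = "Poly_Mapping.map ((*) (of_real c)) f"
  have "real_quadratic_form ?g"
    using f(1) by (auto simp: real_quadratic_form_def homogeneous_def real_mpoly_def
        in_keys_iff map.rep_eq when_def)
  moreover have "restrict_form X ?g = c *\<^sub>R p"
    unfolding f(2) by (simp add: restrict_form_def fun_eq_iff eval_mpoly_scale scaleR_fun_def
        scaleR_conv_of_real)
  ultimately show "c *\<^sub>R p \<in> R2 X" unfolding R2_def by force
qed

text \<open>The sign of \<open>q\<close> at a real point is read off at its real homogeneous coordinate vectors, where
  \<open>q\<close> takes real values.\<close>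

definition P2 :: "('n::finite) proj set \<Rightarrow> (complex ^ 'n \<Rightarrow> complex) set" where
  "P2 X = {q\<in>R2 X. \<forall>A\<in>real_points X. \<forall>a\<in>line A. (\<forall>i. a $ i \<in> \<real>) \<longrightarrow> 0 \<le> Re (q a)}"


section \<open>Divisors\<close>

text \<open>On functions, \<open>\<le>\<close> is the pointwise order, so it is the coefficientwise order of divisors.\<close>

type_synonym 'n divisor = "'n proj \<Rightarrow> int"

definition is_divisor :: "('n::finite) proj set \<Rightarrow> 'n divisor \<Rightarrow> bool" where
  "is_divisor X D \<longleftrightarrow> finite {A. D A \<noteq> 0} \<and> {A. D A \<noteq> 0} \<subseteq> X"

definition totally_real_effective :: "('n::finite) proj set \<Rightarrow> 'n divisor \<Rightarrow> bool" where
  "totally_real_effective X D \<longleftrightarrow>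
    is_divisor X D \<and> {A. D A \<noteq> 0} \<subseteq> real_points X \<and> (\<forall>A. 0 \<le> D A)"

definition divisor_real_part :: "('n::finite) proj set \<Rightarrow> 'n divisor \<Rightarrow> 'n divisor" where
  "divisor_real_part X D = (\<lambda>A. if A \<in> real_points X then D A else 0)"

text \<open>Let \<open>\<m>\<close> be the maximal ideal of the local ring \<open>\<O>\<close> of \<open>X\<close> at \<open>A\<close>, that is, of the degree-zero
  part of the localisation of \<open>\<complex>[x]/\<I>(X)\<close> at the homogeneous elements not vanishing at \<open>A\<close>.
  The germ \<open>f / l\<^sup>2\<close>, with \<open>l\<close> a linear form not vanishing at \<open>A\<close>, lies in \<open>\<m>\<^sup>k\<close> iff
  \<open>s f \<in> \<I>(A)\<^sup>k + \<I>(X)\<close> for some homogeneous \<open>s\<close> with \<open>s(A) \<noteq> 0\<close>. This only depends on the class of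
  \<open>f\<close> modulo \<open>\<I>(X)\<close>.\<close>

definition vanishes_to_order ::
  "('n::finite) proj set \<Rightarrow> 'n proj \<Rightarrow> nat \<Rightarrow> (complex ^ 'n \<Rightarrow> complex) \<Rightarrow> bool" where
  "vanishes_to_order X A k q \<longleftrightarrow>
    (\<exists>f. real_quadratic_form f \<and> q = restrict_form X f \<and>
      (\<exists>s d. homogeneous d s \<and> \<not> vanishes_at s A \<and>
        (\<exists>g\<in>ideal_power (vanishing_ideal {A}) k. \<exists>h\<in>vanishing_ideal X. s * f = g + h)))"

definition order_at :: "('n::finite) proj set \<Rightarrow> 'n proj \<Rightarrow> (complex ^ 'n \<Rightarrow> complex) \<Rightarrow> nat" where
  "order_at X A q = (GREATEST k. vanishes_to_order X A k q)"

text \<open>Meaningful for \<open>0 \<noteq> q \<in> R2 X\<close> only; \<open>div_ge\<close> implements the convention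
  \<open>div 0 \<ge> E\<close> for every \<open>E\<close>.\<close>

definition divisor_of :: "('n::finite) proj set \<Rightarrow> (complex ^ 'n \<Rightarrow> complex) \<Rightarrow> 'n divisor" where
  "divisor_of X q = (\<lambda>A. if A \<in> X then int (order_at X A q) else 0)"

definition div_ge ::
  "('n::finite) proj set \<Rightarrow> (complex ^ 'n \<Rightarrow> complex) \<Rightarrow> 'n divisor \<Rightarrow> bool" where
  "div_ge X q E \<longleftrightarrow> q = 0 \<or> E \<le> divisor_of X q"


section \<open>Faces and face divisors\<close>

text \<open>\<^const>\<open>convex_cone\<close> includes nonemptiness, so every face contains \<open>0\<close>. The library's
  \<open>face_of\<close> is not restricted to cones.\<close>

definition cone_face :: "'a::real_vector set \<Rightarrow> 'a set \<Rightarrow> bool" where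
  "cone_face F C \<longleftrightarrow> convex_cone F \<and> F \<subseteq> C \<and>
    (\<forall>a\<in>C. \<forall>b\<in>C. a + b \<in> F \<longrightarrow> a \<in> F \<and> b \<in> F)"

definition nonzero_faces :: "('n::finite) proj set \<Rightarrow> (complex ^ 'n \<Rightarrow> complex) set set" where
  "nonzero_faces X = {F. cone_face F (P2 X)} - {{0}}"

text \<open>The topology on functions is that of pointwise convergence. It is Hausdorff and compatible with
  the linear structure, so on the span of a subset of the finite-dimensional space \<open>R2 X\<close> it is the
  usual topology.\<close>

definition cone_rel_interior ::
  "('a \<Rightarrow> complex) set \<Rightarrow> ('a \<Rightarrow> complex) set" where
  "cone_rel_interior F = (top_of_set (span F)) interior_of F"

definition face_divisor :: "('n::finite) proj set \<Rightarrow> (complex ^ 'n \<Rightarrow> complex) set \<Rightarrow> 'n divisor" where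
  "face_divisor X F = (THE D. totally_real_effective X D \<and>
    (\<forall>q\<in>cone_rel_interior F. divisor_real_part X (divisor_of X q) = (\<lambda>A. 2 * D A)))"

definition divisor_face :: "('n::finite) proj set \<Rightarrow> 'n divisor \<Rightarrow> (complex ^ 'n \<Rightarrow> complex) set" where
  "divisor_face X D = {q\<in>P2 X. div_ge X q (\<lambda>A. 2 * D A)}"

end

theory Submission
  imports Defs "HOL-Complex_Analysis.Complex_Analysis"
begin

no_notation fps_nth (infixl "$" 75)

text \<open>
  Let \<open>a\<close> be a real vector on the line \<open>A \<in> X(\<real>)\<close>. Smoothness provides real homogeneous
  equations of \<open>X\<close> whose differentials cut out the tangent space at \<open>a\<close>, and the inverse function
  theorem turns their zero set near \<open>a\<close> into a real analytic branch \<open>\<gamma>\<close>. Nakayama's lemma, in the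
  form of Cramer's rule, shows that a linear form vanishing to first order on \<open>\<gamma>\<close> generates the
  maximal ideal of the local ring. Since \<open>X\<close> is irreducible of dimension one, \<open>\<gamma>\<close> lies in \<open>X\<close>, and a
  form vanishing on \<open>\<gamma>\<close> vanishes on \<open>X\<close>; no Noetherian argument is needed, because the Zariski
  closure of \<open>\<gamma>\<close> is irreducible. Hence the order of a quadratic form at \<open>A\<close> is the order of its
  pullback along \<open>\<gamma>\<close>.

  For nonnegative forms, comparing orders at all real points is the same as comparing values up to a
  constant, since \<open>X(\<real>)\<close> is compact. If \<open>q\<close> is in the relative interior of a face \<open>F\<close>, then
  \<open>w \<in> F\<close> iff \<open>q - \<epsilon> w\<close> is nonnegative for some \<open>\<epsilon> > 0\<close>, iff the order of \<open>w\<close> is at least that of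
  \<open>q\<close> at every real point. So \<open>F\<close> is determined by its face divisor.
\<close>

section \<open>Homogeneous polynomial functions\<close>

text \<open>The obstacle is \<open>zeros\<close>: it is cut out by equations chosen for their
  gradients at \<open>a\<close>, and a priori it may be larger than the cone of \<open>X\<close>,
  even near \<open>a\<close>. Division by the uniformizer \<open>cdot b\<close> is therefore proved
  on \<open>zeros\<close> and used twice. First, suppose an equation \<open>f\<close> of
  \<open>X\<close> had finite order \<open>m\<close> along \<gamma>. Division would leave a form
  \<open>G\<close> with \<open>G a \<noteq> 0\<close> and \<open>cdot b x ^ m * G x = 0\<close> on
  the cone of \<open>X\<close>; irreducibility forbids this, since neither factor vanishes
  identically. This puts \<gamma> into \<open>X\<close>. Second, the same division turns the order
  of a form along \<gamma> into membership in a power of the maximal ideal.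

  All local algebra stays homogeneous: a unit of the local ring appears as a form \<open>S\<close>
  with \<open>S a = 1\<close>, and degrees are matched by powers of \<open>cdot a\<close>, which
  equals 1 at \<open>a\<close>.

  Nonnegativity enters the orders twice. It makes them even at real points, so that half of the real
  divisor is integral, and it makes orders monotone: if \<open>q - c w\<close> is nonnegative with
  \<open>c > 0\<close>, then \<open>q\<close> vanishes to no higher order than
  \<open>w\<close>.\<close>

inductive hpoly :: "nat \<Rightarrow> (complex ^ 'n::finite \<Rightarrow> complex) \<Rightarrow> bool" where
  hpoly_const: "hpoly 0 (\<lambda>x. c)"
| hpoly_coord: "hpoly 1 (\<lambda>x. x $ i)"
| hpoly_add: "hpoly d f \<Longrightarrow> hpoly d g \<Longrightarrow> hpoly d (\<lambda>x. f x + g x)"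
| hpoly_mult: "hpoly d f \<Longrightarrow> hpoly e g \<Longrightarrow> hpoly (d + e) (\<lambda>x. f x * g x)"

lemma hpoly_mult': "hpoly d f \<Longrightarrow> hpoly e g \<Longrightarrow> d + e = k \<Longrightarrow> hpoly k (\<lambda>x. f x * g x)"
  using hpoly_mult by blast

lemma hpoly_cmult: "hpoly d f \<Longrightarrow> hpoly d (\<lambda>x. c * f x)"
  by (rule hpoly_mult'[OF hpoly_const]) auto

lemma hpoly_power: "hpoly d f \<Longrightarrow> hpoly (k * d) (\<lambda>x. f x ^ k)"
  by (induction k) (auto intro: hpoly_const hpoly_mult)

lemma hpoly_zero: "hpoly d (\<lambda>x. 0)"
proof -
  \<comment> \<open>\<open>hpoly_const\<close> yields degree 0 only; the power of a coordinate
    supplies the degree \<open>d\<close>.\<close>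
  have "hpoly d (\<lambda>x. 0 * (x $ undefined) ^ d)"
    using hpoly_cmult[OF hpoly_power[OF hpoly_coord]] by (metis mult.right_neutral)
  then show ?thesis by simp
qed

lemma hpoly_sum: "(\<And>i. i \<in> I \<Longrightarrow> hpoly d (f i)) \<Longrightarrow> hpoly d (\<lambda>x. \<Sum>i\<in>I. f i x)"
  by (induction I rule: infinite_finite_induct) (auto intro: hpoly_zero hpoly_add)

lemma hpoly_prod:
  "finite I \<Longrightarrow> (\<And>i. i \<in> I \<Longrightarrow> hpoly (d i) (f i)) \<Longrightarrow> hpoly (\<Sum>i\<in>I. d i) (\<lambda>x. \<Prod>i\<in>I. f i x)"
  by (induction I rule: finite_induct) (auto intro: hpoly_const hpoly_mult)

lemma hpoly_diff: "hpoly d f \<Longrightarrow> hpoly d g \<Longrightarrow> hpoly d (\<lambda>x. f x - g x)"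
  using hpoly_add[OF _ hpoly_cmult[of d g "-1"]] by simp

lemma hpoly_linear: "hpoly 1 (\<lambda>x. \<Sum>i\<in>UNIV. c i * x $ i)"
  by (intro hpoly_sum hpoly_cmult hpoly_coord)

lemma hpoly_scale: "hpoly d f \<Longrightarrow> f (c *s x) = c ^ d * f x"
  by (induction rule: hpoly.induct) (auto simp: algebra_simps power_add)

text \<open>This is \<open>f\<close> with conjugated coefficients; averaging it with
  \<open>f\<close> produces real equations later.\<close>

lemma hpoly_cnj: "hpoly d f \<Longrightarrow> hpoly d (\<lambda>x. cnj (f (conj_vec x)))"
proof (induction rule: hpoly.induct)
  case (hpoly_coord i)
  then show ?case by (simp add: conj_vec_def hpoly.hpoly_coord[simplified])
qed (auto intro: hpoly.intros)

lemma hpoly_continuous: "hpoly d f \<Longrightarrow> continuous_on S f"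
  by (induction rule: hpoly.induct) (auto intro!: continuous_intros)

text \<open>The partial derivatives are kept as continuous functions because the inverse function
  theorem for \<open>chart\<close> asks for a continuous derivative.\<close>

lemma hpoly_has_derivative:
  "hpoly d f \<Longrightarrow> \<exists>c. (\<forall>i. continuous_on UNIV (c i)) \<and>
     (\<forall>x. (f has_derivative (\<lambda>v. \<Sum>i\<in>UNIV. c i x * v $ i)) (at x))"
proof (induction rule: hpoly.induct)
  case (hpoly_const c)
  show ?case by (rule exI[of _ "\<lambda>i x. 0"]) simp
next
  case (hpoly_coord j)
  have "(\<lambda>v. \<Sum>i\<in>UNIV. (if i = j then 1 else 0) * v $ i) = (\<lambda>v::complex^'a. v $ j)"
    by (simp add: if_distrib[of "\<lambda>x. x * _"] cong: if_cong)
  then show ?case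
    using bounded_linear.has_derivative[OF bounded_linear_vec_nth has_derivative_ident]
    by (intro exI[of _ "\<lambda>i x. if i = j then 1 else 0"]) auto
next
  case (hpoly_add d f g)
  then obtain c e where *: "\<forall>i. continuous_on UNIV (c i)" "\<forall>i. continuous_on UNIV (e i)"
    "\<forall>x. (f has_derivative (\<lambda>v. \<Sum>i\<in>UNIV. c i x * v $ i)) (at x)"
    "\<forall>x. (g has_derivative (\<lambda>v. \<Sum>i\<in>UNIV. e i x * v $ i)) (at x)" by blast
  have "((\<lambda>x. f x + g x) has_derivative (\<lambda>v. \<Sum>i\<in>UNIV. (c i x + e i x) * v $ i)) (at x)" for x
    by (rule has_derivative_eq_rhs[OF has_derivative_add[OF *(3)[rule_format] *(4)[rule_format]]])
       (simp add: distrib_right sum.distrib)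
  moreover have "continuous_on UNIV (\<lambda>x. c i x + e i x)" for i
    using * by (intro continuous_on_add) auto
  ultimately show ?case by (intro exI[of _ "\<lambda>i x. c i x + e i x"]) blast
next
  case (hpoly_mult d f k g)
  then obtain c e where *: "\<forall>i. continuous_on UNIV (c i)" "\<forall>i. continuous_on UNIV (e i)"
    "\<forall>x. (f has_derivative (\<lambda>v. \<Sum>i\<in>UNIV. c i x * v $ i)) (at x)"
    "\<forall>x. (g has_derivative (\<lambda>v. \<Sum>i\<in>UNIV. e i x * v $ i)) (at x)" by blast
  have "((\<lambda>x. f x * g x) has_derivative (\<lambda>v. \<Sum>i\<in>UNIV. (f x * e i x + c i x * g x) * v $ i)) (at x)" for x
    by (rule has_derivative_eq_rhs[OF has_derivative_mult[OF *(3)[rule_format] *(4)[rule_format]]])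
       (auto simp: fun_eq_iff sum_distrib_left sum_distrib_right sum.distrib[symmetric] algebra_simps
          simp del: sum.distrib intro!: sum.cong)
  moreover have "continuous_on UNIV (\<lambda>x. f x * e i x + c i x * g x)" for i
    using * hpoly_mult.hyps[THEN hpoly_continuous] by (intro continuous_on_add continuous_on_mult) auto
  ultimately show ?case by (intro exI[of _ "\<lambda>i x. f x * e i x + c i x * g x"]) blast
qed

section \<open>Polynomials and the functions they define\<close>

lemma eval_mpoly_single:
  "eval_mpoly (Poly_Mapping.single m c) a = c * (\<Prod>i\<in>UNIV. (a $ i) ^ Poly_Mapping.lookup m i)"
  by (subst eval_mpoly_superset[of "{m}"]) auto

lemma eval_mpoly_zero [simp]: "eval_mpoly 0 a = 0"
  by (simp add: eval_mpoly_def)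

lemma eval_mpoly_sum: "eval_mpoly (\<Sum>i\<in>I. f i) a = (\<Sum>i\<in>I. eval_mpoly (f i) a)"
  by (induction I rule: infinite_finite_induct) (auto simp: eval_mpoly_add)

lemma mpoly_sum_single:
  "p = (\<Sum>m\<in>Poly_Mapping.keys p. Poly_Mapping.single m (Poly_Mapping.lookup p m))"
  by (rule poly_mapping_eqI)
     (auto simp: lookup_sum lookup_single when_def in_keys_iff)

lemma eval_mpoly_mult: "eval_mpoly (p * q) a = eval_mpoly p a * eval_mpoly q a"
proof -
  let ?s = "\<lambda>p m. Poly_Mapping.single m (Poly_Mapping.lookup p m)"
  have "p * q = (\<Sum>m\<in>Poly_Mapping.keys p. \<Sum>n\<in>Poly_Mapping.keys q. ?s p m * ?s q n)"
    by (subst mpoly_sum_single[of p], subst mpoly_sum_single[of q]) (simp add: sum_product)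
  then have "eval_mpoly (p * q) a =
     (\<Sum>m\<in>Poly_Mapping.keys p. \<Sum>n\<in>Poly_Mapping.keys q. eval_mpoly (?s p m) a * eval_mpoly (?s q n) a)"
    by (simp add: eval_mpoly_sum mult_single eval_mpoly_single lookup_add power_add prod.distrib ac_simps)
  also have "\<dots> = eval_mpoly p a * eval_mpoly q a"
    by (simp only: sum_product [symmetric] eval_mpoly_single) (simp only: eval_mpoly_def)
  finally show ?thesis .
qed

lemma homogeneous_single:
  "(\<Sum>i\<in>UNIV. Poly_Mapping.lookup m i) = d \<Longrightarrow> homogeneous d (Poly_Mapping.single m c)"
  by (simp add: homogeneous_def)

lemma homogeneous_add: "homogeneous d p \<Longrightarrow> homogeneous d q \<Longrightarrow> homogeneous d (p + q)"
  using Poly_Mapping.keys_add[of p q] unfolding homogeneous_def by blast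

lemma homogeneous_mult: "homogeneous d p \<Longrightarrow> homogeneous e q \<Longrightarrow> homogeneous (d + e) (p * q)"
  using keys_mult[of p q] unfolding homogeneous_def by (auto simp: lookup_add sum.distrib dest!: subsetD)

lemma hpoly_imp_mpoly: "hpoly d f \<Longrightarrow> \<exists>p. homogeneous d p \<and> eval_mpoly p = f"
proof (induction rule: hpoly.induct)
  case (hpoly_const c)
  show ?case
    by (rule exI[of _ "Poly_Mapping.single 0 c"]) (auto simp: homogeneous_single eval_mpoly_single)
next
  case (hpoly_coord i)
  show ?case
    by (rule exI[of _ "Poly_Mapping.single (Poly_Mapping.single i 1) 1"])
       (auto simp: eval_mpoly_single lookup_single when_def fun_eq_iff
          if_distrib[of "\<lambda>n. _ ^ n"] intro!: homogeneous_single cong: if_cong)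
next
  case (hpoly_add d f g)
  then show ?case by (metis (no_types, lifting) ext eval_mpoly_add homogeneous_add)
next
  case (hpoly_mult d f e g)
  then show ?case by (metis (no_types, lifting) ext eval_mpoly_mult homogeneous_mult)
qed

lemma hpoly_monomial:
  "hpoly (\<Sum>i\<in>UNIV. Poly_Mapping.lookup m i) (\<lambda>x. c * (\<Prod>i\<in>UNIV. (x $ i) ^ Poly_Mapping.lookup m i))"
proof (rule hpoly_cmult, rule hpoly_prod)
  show "hpoly (Poly_Mapping.lookup m i) (\<lambda>x. x $ i ^ Poly_Mapping.lookup m i)" for i
    using hpoly_power[OF hpoly_coord] by (metis mult.right_neutral)
qed simp

lemma homogeneous_imp_hpoly: "homogeneous d p \<Longrightarrow> hpoly d (eval_mpoly p)"
  unfolding eval_mpoly_def[abs_def] homogeneous_def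
proof (rule hpoly_sum)
  fix m assume "\<forall>m\<in>Poly_Mapping.keys p. (\<Sum>i\<in>UNIV. Poly_Mapping.lookup m i) = d"
    and "m \<in> Poly_Mapping.keys p"
  then show "hpoly d (\<lambda>x. Poly_Mapping.lookup p m * (\<Prod>i\<in>UNIV. (x $ i) ^ Poly_Mapping.lookup m i))"
    using hpoly_monomial[of m] by simp
qed

lemma hpoly_iff: "hpoly d f \<longleftrightarrow> (\<exists>p. homogeneous d p \<and> eval_mpoly p = f)"
  using hpoly_imp_mpoly homogeneous_imp_hpoly by blast

text \<open>\<open>vanishing_ideal\<close> contains inhomogeneous polynomials as well; grouping
  monomials by total degree reduces them to \<open>hpoly\<close>.\<close>

lemma eval_mpoly_homogeneous_components:
  "\<exists>N f. (\<forall>d. hpoly d (f d)) \<and> (\<forall>x. eval_mpoly p x = (\<Sum>d\<le>N. f d x))"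
proof -
  let ?deg = "\<lambda>m. \<Sum>i\<in>UNIV. Poly_Mapping.lookup m i"
  let ?mon = "\<lambda>m x. Poly_Mapping.lookup p m * (\<Prod>i\<in>UNIV. (x $ i) ^ Poly_Mapping.lookup m i)"
  let ?K = "Poly_Mapping.keys p"
  define f where "f d = (\<lambda>x. \<Sum>m\<in>{m\<in>?K. ?deg m = d}. ?mon m x)" for d
  define N where "N = Max (insert 0 (?deg ` ?K))"
  have "hpoly d (f d)" for d
    unfolding f_def by (rule hpoly_sum) (use hpoly_monomial in blast)
  moreover have "?deg ` ?K \<subseteq> {..N}" by (auto simp: N_def)
  then have "eval_mpoly p x = (\<Sum>d\<le>N. f d x)" for x
    unfolding f_def eval_mpoly_def by (intro sum.group[symmetric]) auto
  ultimately show ?thesis by blast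
qed

section \<open>Projective sets and their cones\<close>

definition proj_pt :: "complex ^ 'n::finite \<Rightarrow> 'n proj" where
  "proj_pt a = Abs_proj (vec.span {a})"

lemma line_proj_pt: "a \<noteq> 0 \<Longrightarrow> line (proj_pt a) = range (\<lambda>c. c *s a)"
  unfolding proj_pt_def by (subst Abs_proj_inverse) (auto simp: vec.span_singleton)

lemma line_eq: assumes "a \<in> line A" "a \<noteq> 0" shows "line A = range (\<lambda>c. c *s a)"
proof -
  from line[of A] obtain b where b: "b \<noteq> 0" "line A = range (\<lambda>c. c *s b)"
    by (auto simp: vec.span_singleton)
  with assms obtain c where c: "a = c *s b" by auto
  with assms have "c \<noteq> 0" by auto
  have "d *s b = (d / c) *s a" for d using \<open>c \<noteq> 0\<close> by (simp add: c)
  moreover have "d *s a = (d * c) *s b" for d by (simp add: c)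
  ultimately show ?thesis unfolding b(2) by (intro equalityI image_subsetI) (metis rangeI)+
qed

lemma obtain_line: obtains a where "a \<in> line A" "a \<noteq> 0"
proof -
  from line[of A] obtain b where b: "b \<noteq> 0" "line A = vec.span {b}" by auto
  then have "b \<in> line A" by (simp add: vec.span_base)
  with b that show thesis by blast
qed

lemma zero_in_line [simp]: "0 \<in> line A"
proof -
  obtain a where "a \<in> line A" "a \<noteq> 0" by (rule obtain_line)
  then show ?thesis using line_eq[of a A] by (auto intro!: image_eqI[of _ _ 0])
qed

lemma proj_pt_eq: "a \<in> line A \<Longrightarrow> a \<noteq> 0 \<Longrightarrow> proj_pt a = A"
  by (metis line_eq line_inject line_proj_pt)

lemma in_line_proj_pt: "a \<noteq> 0 \<Longrightarrow> a \<in> line (proj_pt a)"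
  by (auto simp: line_proj_pt intro!: image_eqI[of _ _ 1])

lemma hpoly_zero_on_line:
  assumes "hpoly d f" "a \<in> line A" "a \<noteq> 0" "f a = 0" "b \<in> line A"
  shows "f b = 0"
  using assms line_eq[OF assms(2,3)] by (auto simp: hpoly_scale)

lemma zariski_closed_iff:
  "zariski_closed V \<longleftrightarrow> (\<exists>S. (\<forall>f\<in>S. \<exists>d. hpoly d f) \<and> V = {A. \<forall>f\<in>S. \<forall>a\<in>line A. f a = 0})"
proof
  assume "zariski_closed V"
  then obtain S where "\<forall>p\<in>S. \<exists>d. homogeneous d p" "V = {A. \<forall>p\<in>S. vanishes_at p A}"
    by (auto simp: zariski_closed_def)
  then show "\<exists>S. (\<forall>f\<in>S. \<exists>d. hpoly d f) \<and> V = {A. \<forall>f\<in>S. \<forall>a\<in>line A. f a = 0}"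
    by (intro exI[of _ "eval_mpoly ` S"]) (auto simp: vanishes_at_def dest: homogeneous_imp_hpoly)
next
  assume "\<exists>S. (\<forall>f\<in>S. \<exists>d. hpoly d f) \<and> V = {A. \<forall>f\<in>S. \<forall>a\<in>line A. f a = 0}"
  then obtain S where S: "\<forall>f\<in>S. \<exists>d. hpoly d f" "V = {A. \<forall>f\<in>S. \<forall>a\<in>line A. f a = 0}" by blast
  let ?T = "{p. (\<exists>d. homogeneous d p) \<and> eval_mpoly p \<in> S}"
  have "V = {A. \<forall>p\<in>?T. vanishes_at p A}"
  proof (intro set_eqI iffI)
    fix A assume "A \<in> {A. \<forall>p\<in>?T. vanishes_at p A}"
    then have *: "vanishes_at p A" if "homogeneous d p" "eval_mpoly p \<in> S" for p d using that by blast
    have "f a = 0" if fa: "f \<in> S" "a \<in> line A" for f a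
    proof -
      obtain d p where "homogeneous d p" "eval_mpoly p = f" using S(1) fa(1) by (metis hpoly_iff)
      then show ?thesis using * fa by (auto simp: vanishes_at_def)
    qed
    then show "A \<in> V" using S(2) by blast
  qed (auto simp: S(2) vanishes_at_def)
  then show "zariski_closed V" unfolding zariski_closed_def by (intro exI[of _ ?T]) auto
qed

lemma zariski_closed_zeros:
  "hpoly d f \<Longrightarrow> zariski_closed {A. \<forall>a\<in>line A. f a = 0}"
  unfolding zariski_closed_iff by (intro exI[of _ "{f}"]) auto

lemma zariski_closed_singleton: "zariski_closed {A}"
proof -
  obtain a where a: "a \<in> line A" "a \<noteq> 0" by (rule obtain_line)
  then obtain k where k: "a $ k \<noteq> 0" by (auto simp: vec_eq_iff)
  \<comment> \<open>The 2 by 2 minors of the pair \<open>a\<close>, \<open>x\<close> through the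
    pivot coordinate \<open>k\<close>; they force \<open>x\<close> to be a multiple of
    \<open>a\<close>.\<close>
  let ?f = "\<lambda>i x. a $ k * x $ i - a $ i * x $ k"
  have "hpoly 1 (?f i)" for i by (intro hpoly_diff hpoly_cmult hpoly_coord)
  moreover have "{A} = {B. \<forall>f\<in>range ?f. \<forall>b\<in>line B. f b = 0}"
  proof (intro set_eqI iffI)
    fix B assume "B \<in> {B. \<forall>f\<in>range ?f. \<forall>b\<in>line B. f b = 0}"
    then have B: "?f i b = 0" if "b \<in> line B" for i b using that by auto
    obtain b where b: "b \<in> line B" "b \<noteq> 0" by (rule obtain_line)
    have "b = (b $ k / a $ k) *s a"
      using B[OF b(1)] k by (simp add: vec_eq_iff field_simps)
    then have "b \<in> line A" using line_eq[OF a] by blast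
    then show "B \<in> {A}" using b proj_pt_eq by blast
  qed (use line_eq[OF a] in auto)
  ultimately show ?thesis unfolding zariski_closed_iff by (intro exI[of _ "range ?f"]) blast
qed

lemma zariski_irreducible_singleton: "zariski_irreducible {A}"
  by (auto simp: zariski_irreducible_def)

text \<open>Irreducible sets are nonempty, so a chain inside one point has no strict step.\<close>

lemma curve_not_singleton:
  assumes "zariski_dim X = 1" "X \<subseteq> {A}" shows False
proof -
  have "k = 0" if "\<forall>i\<le>k. zariski_closed (Z i) \<and> zariski_irreducible (Z i) \<and> Z i \<subseteq> X"
    "\<forall>i<k. Z i \<subset> Z (Suc i)" for k :: nat and Z :: "nat \<Rightarrow> 'a proj set"
  proof (rule ccontr)
    assume "k \<noteq> 0"
    then have "0 < k" "1 \<le> k" by auto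
    then have "Z 0 \<subset> Z 1" "Z 1 \<subseteq> X" "Z 0 \<noteq> {}"
      using that by (force simp: zariski_irreducible_def)+
    then show False using assms(2) by blast
  qed
  then have "zariski_dim X \<le> enat 0" unfolding zariski_dim_def by (intro Sup_least) force
  then show False using assms(1) by (simp add: zero_enat_def[symmetric])
qed

text \<open>Otherwise \<open>{A}\<close>, \<open>Z\<close>, \<open>X\<close> would be a chain of
  length 2.\<close>

lemma curve_no_chain:
  assumes "zariski_dim X = 1" "zariski_closed X" "zariski_irreducible X"
    "zariski_closed Z" "zariski_irreducible Z" "Z \<subset> X" "A \<in> Z"
  shows "Z = {A}"
proof (rule ccontr)
  assume "Z \<noteq> {A}"
  let ?Z = "\<lambda>i::nat. if i = 0 then {A} else if i = 1 then Z else X"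
  have "enat 2 \<le> zariski_dim X"
    unfolding zariski_dim_def
  proof (rule Sup_upper, clarify, intro exI[of _ 2] exI[of _ ?Z] conjI allI impI)
    fix i :: nat assume "i < 2"
    then have "i = 0 \<or> i = 1" by auto
    then show "?Z i \<subset> ?Z (Suc i)" using assms \<open>Z \<noteq> {A}\<close> by auto
  qed (use assms zariski_closed_singleton zariski_irreducible_singleton in auto)
  then show False using assms(1) by (simp add: one_enat_def)
qed

lemma in_cone_iff: "x \<noteq> 0 \<Longrightarrow> x \<in> affine_cone X \<longleftrightarrow> proj_pt x \<in> X"
  unfolding affine_cone_def by (auto simp: proj_pt_eq intro: in_line_proj_pt)

lemma cone_line: "a \<in> line A \<Longrightarrow> A \<in> X \<Longrightarrow> a \<in> affine_cone X"
  by (auto simp: affine_cone_def)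

lemma cone_scale: assumes "x \<in> affine_cone X" shows "c *s x \<in> affine_cone X"
proof (cases "x = 0")
  case False
  from assms obtain A where A: "A \<in> X" "x \<in> line A" by (auto simp: affine_cone_def)
  then have "c *s x \<in> line A" using line_eq[OF A(2) False] by blast
  then show ?thesis using A by (auto simp: affine_cone_def)
qed (use assms in simp)

text \<open>Nonemptiness of \<open>X\<close> puts the origin into its cone; forms of positive degree
  vanish there even when they have no common projective zero.\<close>

lemma affine_cone_zeros:
  assumes "zariski_closed X" "X \<noteq> {}"
  obtains S where "\<forall>f\<in>S. \<exists>d. hpoly d f" "affine_cone X = {x. \<forall>f\<in>S. f x = 0}"
proof -
  from assms(1) obtain S where S: "\<forall>f\<in>S. \<exists>d. hpoly d f" "X = {A. \<forall>f\<in>S. \<forall>a\<in>line A. f a = 0}"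
    unfolding zariski_closed_iff by blast
  have "x \<in> affine_cone X" if x: "\<forall>f\<in>S. f x = 0" for x
  proof (cases "x = 0")
    case True
    then show ?thesis using assms(2) by (auto simp: affine_cone_def)
  next
    case False
    then have "f a = 0" if "f \<in> S" "a \<in> line (proj_pt x)" for f a
      using that hpoly_zero_on_line[OF _ in_line_proj_pt[OF False]] S(1) x by blast
    then have "proj_pt x \<in> X" using S(2) by blast
    then show ?thesis using False by (simp add: in_cone_iff)
  qed
  moreover have "f x = 0" if "x \<in> affine_cone X" "f \<in> S" for f x
    using that S(2) by (auto simp: affine_cone_def)
  ultimately have "affine_cone X = {x. \<forall>f\<in>S. f x = 0}" by blast
  then show thesis using that S(1) by blast
qed

lemma closed_affine_cone:
  assumes "zariski_closed X" "X \<noteq> {}" shows "closed (affine_cone X)"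
proof -
  obtain S where S: "\<forall>f\<in>S. \<exists>d. hpoly d f" "affine_cone X = {x. \<forall>f\<in>S. f x = 0}"
    by (rule affine_cone_zeros[OF assms])
  have "closed {x. f x = 0}" if f: "f \<in> S" for f
  proof -
    obtain d where "hpoly d f" using S(1) f by blast
    then show ?thesis by (rule closed_Collect_eq[OF hpoly_continuous continuous_on_const])
  qed
  then have "closed (\<Inter>f\<in>S. {x. f x = 0})" by blast
  moreover have "(\<Inter>f\<in>S. {x. f x = 0}) = affine_cone X" using S(2) by auto
  ultimately show ?thesis by simp
qed

text \<open>The zero loci of the two factors are closed and cover \<open>X\<close>, so one of them
  contains \<open>X\<close>.\<close>

lemma irreducible_hpoly_mult:
  assumes "zariski_irreducible X" "hpoly d f" "hpoly e g"
    and fg: "\<And>x. x \<in> affine_cone X \<Longrightarrow> f x * g x = 0"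
  shows "(\<forall>x\<in>affine_cone X. f x = 0) \<or> (\<forall>x\<in>affine_cone X. g x = 0)"
proof -
  let ?V = "\<lambda>f. {A. \<forall>a\<in>line A. f a = 0}"
  have "X \<subseteq> ?V f \<union> ?V g"
  proof
    fix A assume A: "A \<in> X"
    obtain a where a: "a \<in> line A" "a \<noteq> 0" by (rule obtain_line)
    then have "f a = 0 \<or> g a = 0" using fg[OF cone_line[OF a(1) A]] by auto
    then show "A \<in> ?V f \<union> ?V g" using hpoly_zero_on_line[OF _ a] assms(2,3) by blast
  qed
  then have "X \<subseteq> ?V f \<or> X \<subseteq> ?V g"
    using assms(1) zariski_closed_zeros[OF assms(2)] zariski_closed_zeros[OF assms(3)]
    unfolding zariski_irreducible_def by blast
  then show ?thesis by (auto simp: affine_cone_def)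
qed

lemma vanishing_ideal_iff: "p \<in> vanishing_ideal X \<longleftrightarrow> (\<forall>x\<in>affine_cone X. eval_mpoly p x = 0)"
  by (auto simp: vanishing_ideal_def vanishes_at_def affine_cone_def)

text \<open>Scaling a cone point by \<open>c\<close> gives a polynomial in \<open>c\<close> that is
  identically zero; its coefficients are the values of the components.\<close>

lemma vanishing_ideal_components:
  assumes "\<And>d. hpoly d (f d)" "\<And>x. eval_mpoly p x = (\<Sum>d\<le>N. f d x)"
    "p \<in> vanishing_ideal X" "d \<le> N" "x \<in> affine_cone X"
  shows "f d x = 0"
proof -
  have "(\<Sum>d\<le>N. f d x * c ^ d) = 0" for c
    using assms(3) cone_scale[OF assms(5), of c] assms(2)[of "c *s x"]
    by (simp add: vanishing_ideal_iff hpoly_scale[OF assms(1)] mult.commute)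
  then show ?thesis using polyfun_eq_0[of "\<lambda>d. f d x" N] assms(4) by blast
qed

section \<open>Complex conjugation and real vectors\<close>

lemma conj_vec_nth [simp]: "conj_vec a $ i = cnj (a $ i)"
  by (simp add: conj_vec_def)

lemma conj_vec_conj_vec [simp]: "conj_vec (conj_vec a) = a"
  by (simp add: vec_eq_iff)

lemma conj_vec_eq_0 [simp]: "conj_vec a = 0 \<longleftrightarrow> a = 0"
  by (simp add: vec_eq_iff)

lemma conj_vec_add: "conj_vec (a + b) = conj_vec a + conj_vec b"
  by (simp add: vec_eq_iff)

lemma conj_vec_scale: "conj_vec (c *s a) = cnj c *s conj_vec a"
  by (simp add: vec_eq_iff)

lemma conj_vec_real_iff: "conj_vec a = a \<longleftrightarrow> (\<forall>i. a $ i \<in> \<real>)"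
  by (simp add: vec_eq_iff Reals_cnj_iff)

lemma line_conj_pt: "line (conj_pt A) = conj_vec ` line A"
  by (simp add: conj_pt.rep_eq)

lemma conj_vec_cone: "conj_pt ` X = X \<Longrightarrow> x \<in> affine_cone X \<Longrightarrow> conj_vec x \<in> affine_cone X"
  by (auto simp: affine_cone_def) (metis imageI line_conj_pt)

lemma real_pt_iff: "a \<in> line A \<Longrightarrow> a \<noteq> 0 \<Longrightarrow> conj_vec a = a \<Longrightarrow> conj_pt A = A"
  by (metis conj_vec_eq_0 imageI line_conj_pt proj_pt_eq)

text \<open>A conjugation-stable subspace \<open>P\<close> contains the doubled real and imaginary
  parts of its vectors. If both parts of \<open>a\<close> lay in the subspace \<open>Q\<close>, so
  would \<open>a\<close>.\<close>

lemma real_vec_of_conj_invariant: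
  fixes P :: "complex ^ 'n \<Rightarrow> bool"
  assumes "P a" "conj_vec a \<noteq> 0"
    and smult: "\<And>c x. P x \<Longrightarrow> P (c *s x)" and conj: "\<And>x. P x \<Longrightarrow> P (conj_vec x)"
    and add: "\<And>x y. P x \<Longrightarrow> P y \<Longrightarrow> P (x + y)"
    and "\<not> Q a" and Qsmult: "\<And>c x. Q x \<Longrightarrow> Q (c *s x)" and Qadd: "\<And>x y. Q x \<Longrightarrow> Q y \<Longrightarrow> Q (x + y)"
  obtains b where "P b" "\<not> Q b" "conj_vec b = b"
proof -
  let ?u = "a + conj_vec a" and ?v = "\<i> *s a + conj_vec (\<i> *s a)"
  have "a = (1/2) *s ?u + (1/(2*\<i>)) *s ?v"
    by (simp add: vec_eq_iff field_simps)
  then have "\<not> Q ?u \<or> \<not> Q ?v" using assms(6) Qsmult Qadd by metis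
  moreover have "P ?u" "P ?v" using assms(1) smult conj add by metis+
  moreover have "conj_vec ?u = ?u" "conj_vec ?v = ?v" by (simp_all add: vec_eq_iff)
  ultimately show thesis using that by blast
qed

lemma obtain_real_vec:
  assumes "conj_pt A = A"
  obtains a where "a \<in> line A" "a \<noteq> 0" "conj_vec a = a"
proof -
  obtain a where a: "a \<in> line A" "a \<noteq> 0" by (rule obtain_line)
  have line: "line A = range (\<lambda>c. c *s a)" by (rule line_eq[OF a])
  have scale: "c *s x \<in> line A" if "x \<in> line A" for c x using that by (auto simp: line)
  have add: "x + y \<in> line A" if xy: "x \<in> line A" "y \<in> line A" for x y
  proof -
    from xy obtain c d where "x = c *s a" "y = d *s a" by (auto simp: line)
    then have "x + y = (c + d) *s a" by (simp add: vector_sadd_rdistrib)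
    then show ?thesis unfolding line by blast
  qed
  have conj: "conj_vec x \<in> line A" if "x \<in> line A" for x
    using that assms line_conj_pt[of A] by auto
  show thesis
    by (rule real_vec_of_conj_invariant[where P = "\<lambda>x. x \<in> line A" and Q = "\<lambda>x. x = 0" and a = a])
       (use a scale add conj that in auto)
qed

section \<open>Local equations at a real point\<close>

text \<open>Bilinear rather than hermitian, so that pairing with a fixed vector is a linear form. On
  real vectors it is the Euclidean inner product, hence positive there, while a nonzero complex
  vector may be isotropic.\<close>

definition cdot :: "complex ^ 'n::finite \<Rightarrow> complex ^ 'n \<Rightarrow> complex" where
  "cdot c v = (\<Sum>i\<in>UNIV. c $ i * v $ i)"

lemma cdot_add_right: "cdot c (v + w) = cdot c v + cdot c w"
  by (simp add: cdot_def distrib_left sum.distrib)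

lemma cdot_scale_right: "cdot c (k *s v) = k * cdot c v"
  by (simp add: cdot_def sum_distrib_left mult.left_commute)

lemma cdot_commute: "cdot c v = cdot v c"
  by (simp add: cdot_def mult.commute)

lemma cdot_add_left: "cdot (v + w) c = cdot v c + cdot w c"
  by (simp add: cdot_commute[of _ c] cdot_add_right)

lemma cdot_scale_left: "cdot (k *s v) c = k * cdot v c"
  by (simp add: cdot_commute[of _ c] cdot_scale_right)

lemma cdot_diff_right: "cdot c (v - w) = cdot c v - cdot c w"
  by (simp add: cdot_def right_diff_distrib sum_subtractf)

lemma cdot_diff_left: "cdot (v - w) c = cdot v c - cdot w c"
  by (simp add: cdot_commute[of _ c] cdot_diff_right)

lemma cdot_zero [simp]: "cdot c 0 = 0" "cdot 0 c = 0"
  by (simp_all add: cdot_def)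

lemma cdot_axis [simp]: "cdot (axis i 1) v = v $ i"
  by (simp add: cdot_def axis_def if_distrib[of "\<lambda>x. x * _"] cong: if_cong)

lemma cdot_conj: "cdot (conj_vec c) (conj_vec v) = cnj (cdot c v)"
  by (simp add: cdot_def)

lemma hpoly_cdot: "hpoly 1 (cdot c)"
  unfolding cdot_def[abs_def] by (rule hpoly_linear)

lemma hpoly_pow_cdot: "hpoly k (\<lambda>x. cdot c x ^ k)"
  using hpoly_power[OF hpoly_cdot] by (metis mult.right_neutral)

lemma cdot_self_real:
  assumes "conj_vec v = v" "v \<noteq> 0"
  obtains r where "r > 0" "cdot v v = of_real r"
proof
  have v: "v $ i = of_real (Re (v $ i))" for i
    using assms(1) by (metis conj_vec_real_iff of_real_Re)
  have "cdot v v = (\<Sum>i\<in>UNIV. of_real (Re (v $ i)) * of_real (Re (v $ i)))"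
    unfolding cdot_def using v by metis
  then show "cdot v v = of_real (\<Sum>i\<in>UNIV. (Re (v $ i))\<^sup>2)"
    by (simp add: power2_eq_square)
  obtain i where "v $ i \<noteq> 0" using assms(2) by (auto simp: vec_eq_iff)
  then have "Re (v $ i) \<noteq> 0" using v[of i] by auto
  then show "(\<Sum>i\<in>UNIV. (Re (v $ i))\<^sup>2) > 0" by (intro sum_pos2[of _ i]) auto
qed

lemma obtain_real_unit:
  assumes "conj_vec v = v" "v \<noteq> 0"
  obtains k where "k \<noteq> 0" "conj_vec (k *s v) = k *s v" "cdot (k *s v) (k *s v) = 1"
proof -
  obtain r where r: "r > 0" "cdot v v = of_real r" by (rule cdot_self_real[OF assms])
  let ?k = "of_real (1 / sqrt r) :: complex"
  have "cdot (?k *s v) (?k *s v) = of_real ((1 / sqrt r) * ((1 / sqrt r) * r))"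
    by (simp only: cdot_scale_left cdot_scale_right r(2) of_real_mult)
  also have "(1 / sqrt r) * ((1 / sqrt r) * r) = 1"
    using r(1) by (simp add: field_simps)
  finally show thesis
    using r(1) assms(1) by (intro that[of ?k]) (auto simp: conj_vec_scale)
qed

section \<open>Gradients, conormal space and tangent plane\<close>

definition has_grad :: "(complex ^ 'n::finite \<Rightarrow> complex) \<Rightarrow> complex ^ 'n \<Rightarrow> complex ^ 'n \<Rightarrow> bool" where
  "has_grad f c a \<longleftrightarrow> (\<forall>v. ((\<lambda>t. f (a + t *s v)) has_field_derivative cdot c v) (at 0))"

lemma has_grad_add: "has_grad f c a \<Longrightarrow> has_grad g e a \<Longrightarrow> has_grad (\<lambda>x. f x + g x) (c + e) a"
  by (auto simp: has_grad_def cdot_add_left intro!: DERIV_add)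

lemma has_grad_mult:
  assumes "has_grad f c a" "has_grad g e a"
  shows "has_grad (\<lambda>x. f x * g x) (f a *s e + g a *s c) a"
  unfolding has_grad_def
proof
  fix v
  show "((\<lambda>t. f (a + t *s v) * g (a + t *s v)) has_field_derivative
      cdot (f a *s e + g a *s c) v) (at 0)"
    using DERIV_mult[OF assms(1)[unfolded has_grad_def, rule_format, of v]
        assms(2)[unfolded has_grad_def, rule_format, of v]]
    by (simp add: cdot_add_left cdot_scale_left algebra_simps)
qed

lemma has_grad_const: "has_grad (\<lambda>x. k) 0 a"
  by (simp add: has_grad_def)

lemma has_grad_cmult: "has_grad f c a \<Longrightarrow> has_grad (\<lambda>x. k * f x) (k *s c) a"
  using has_grad_mult[OF has_grad_const] by fastforce

lemma has_grad_sum: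
  "finite I \<Longrightarrow> (\<And>i. i \<in> I \<Longrightarrow> has_grad (f i) (c i) a) \<Longrightarrow> has_grad (\<lambda>x. \<Sum>i\<in>I. f i x) (\<Sum>i\<in>I. c i) a"
  by (induction I rule: finite_induct) (auto intro: has_grad_const has_grad_add)

lemma has_grad_coord: "has_grad (\<lambda>x. x $ i) (axis i 1) a"
  by (auto simp: has_grad_def intro!: derivative_eq_intros)

lemma has_grad_cdot: "has_grad (cdot c) c a"
  unfolding has_grad_def by (auto simp: cdot_add_right cdot_scale_right intro!: derivative_eq_intros)

lemma has_grad_unique: "has_grad f c a \<Longrightarrow> has_grad f e a \<Longrightarrow> c = e"
  unfolding has_grad_def vec_eq_iff by (metis DERIV_unique cdot_axis cdot_commute)

lemma has_grad_cnj:
  assumes "has_grad f c a" "conj_vec a = a"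
  shows "has_grad (\<lambda>x. cnj (f (conj_vec x))) (conj_vec c) a"
  unfolding has_grad_def
proof
  fix v
  have "((cnj \<circ> (\<lambda>t. f (a + t *s conj_vec v)) \<circ> cnj) has_field_derivative
      cnj (cdot c (conj_vec v))) (at (cnj 0))"
    using assms(1) by (subst has_field_derivative_cnj_cnj) (auto simp: has_grad_def)
  then show "((\<lambda>t. cnj (f (conj_vec (a + t *s v)))) has_field_derivative cdot (conj_vec c) v) (at 0)"
    using cdot_conj[of c "conj_vec v"] by (simp add: o_def conj_vec_add conj_vec_scale assms(2))
qed

lemma hpoly_has_grad: "hpoly d f \<Longrightarrow> \<exists>c. has_grad f c a"
proof (induction rule: hpoly.induct)
  case (hpoly_const c)
  show ?case using has_grad_const by blast
next
  case (hpoly_coord i)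
  show ?case using has_grad_coord by blast
qed (use has_grad_add has_grad_mult in blast)+

definition conormal :: "('n::finite) proj set \<Rightarrow> complex ^ 'n \<Rightarrow> (complex ^ 'n) set" where
  "conormal X a = {c. \<exists>d f. hpoly d f \<and> (\<forall>x\<in>affine_cone X. f x = 0) \<and> has_grad f c a}"

text \<open>Homogeneous equations suffice: the components of an element of the vanishing ideal
  vanish on the cone too, and the differential of the element is the sum of theirs.\<close>

lemma cone_tangent_space_iff:
  "v \<in> cone_tangent_space X a \<longleftrightarrow> (\<forall>c\<in>conormal X a. cdot c v = 0)"
proof
  assume v: "v \<in> cone_tangent_space X a"
  show "\<forall>c\<in>conormal X a. cdot c v = 0"
  proof
    fix c assume "c \<in> conormal X a"
    then obtain d f where f: "hpoly d f" "\<forall>x\<in>affine_cone X. f x = 0" "has_grad f c a"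
      by (auto simp: conormal_def)
    then obtain p where p: "eval_mpoly p = f" by (metis hpoly_iff)
    then have "p \<in> vanishing_ideal X" using f(2) by (simp add: vanishing_ideal_iff)
    then have "deriv (\<lambda>t. f (a + t *s v)) 0 = 0"
      using v p by (auto simp: cone_tangent_space_def)
    then show "cdot c v = 0" using f(3) DERIV_imp_deriv unfolding has_grad_def by metis
  qed
next
  assume v: "\<forall>c\<in>conormal X a. cdot c v = 0"
  have "deriv (\<lambda>t. eval_mpoly p (a + t *s v)) 0 = 0" if p: "p \<in> vanishing_ideal X" for p
  proof -
    obtain N f where f: "\<And>d. hpoly d (f d)" "\<And>x. eval_mpoly p x = (\<Sum>d\<le>N. f d x)"
      using eval_mpoly_homogeneous_components[of p] by blast
    have "\<forall>d. \<exists>c. has_grad (f d) c a" using hpoly_has_grad[OF f(1)] by blast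
    then obtain c where c: "\<And>d. has_grad (f d) (c d) a" by metis
    have "c d \<in> conormal X a" if "d \<le> N" for d
      using f(1) vanishing_ideal_components[OF f p that] c unfolding conormal_def by blast
    then have "cdot (c d) v = 0" if "d \<le> N" for d using v that by blast
    moreover have "((\<lambda>t. eval_mpoly p (a + t *s v)) has_field_derivative (\<Sum>d\<le>N. cdot (c d) v)) (at 0)"
      unfolding f(2) using c by (intro DERIV_sum) (auto simp: has_grad_def)
    ultimately show ?thesis by (simp add: DERIV_imp_deriv)
  qed
  then show "v \<in> cone_tangent_space X a" by (simp add: cone_tangent_space_def)
qed

text \<open>Two equations may differ in degree. Multiplying each by a power of a linear form with
  value 1 at \<open>a\<close> equalises the degrees and leaves the gradients unchanged, because the
  equations vanish at \<open>a\<close>.\<close>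

lemma conormal_subspace:
  assumes "a \<in> affine_cone X" "cdot k a = 1"
  shows "vec.subspace (conormal X a)"
proof (rule vec.subspaceI)
  show "0 \<in> conormal X a"
    unfolding conormal_def using hpoly_zero has_grad_const by blast
next
  fix c assume "c \<in> conormal X a"
  then obtain d f where f: "hpoly d f" "\<forall>x\<in>affine_cone X. f x = 0" "has_grad f c a"
    by (auto simp: conormal_def)
  then show "r *s c \<in> conormal X a" for r
    unfolding conormal_def
    by (intro CollectI exI[of _ d] exI[of _ "\<lambda>x. r * f x"]) (auto intro: hpoly_cmult has_grad_cmult)
next
  fix c e assume "c \<in> conormal X a" "e \<in> conormal X a"
  then obtain d f d' g where fg: "hpoly d f" "\<forall>x\<in>affine_cone X. f x = 0" "has_grad f c a"
    "hpoly d' g" "\<forall>x\<in>affine_cone X. g x = 0" "has_grad g e a"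
    by (auto simp: conormal_def)
  have shift: "has_grad (\<lambda>x. cdot k x ^ n * h x) u a" if "has_grad h u a" "h a = 0" for n h u
  proof -
    obtain w where "has_grad (\<lambda>x. cdot k x ^ n) w a" using hpoly_has_grad[OF hpoly_pow_cdot] by blast
    from has_grad_mult[OF this that(1)] show ?thesis using that(2) assms(2) by simp
  qed
  have "hpoly (d' + d) (\<lambda>x. cdot k x ^ d' * f x + cdot k x ^ d * g x)"
    using hpoly_mult[OF hpoly_pow_cdot fg(1), of d'] hpoly_mult[OF hpoly_pow_cdot fg(4), of d]
    by (intro hpoly_add) (auto simp: add.commute)
  moreover have "has_grad (\<lambda>x. cdot k x ^ d' * f x + cdot k x ^ d * g x) (c + e) a"
    using fg assms(1) by (intro has_grad_add shift) auto
  ultimately show "c + e \<in> conormal X a"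
    unfolding conormal_def using fg(2,5) by (intro CollectI exI[of _ "d' + d"] exI) auto
qed

lemma separating_vector:
  fixes c :: "complex ^ 'n::finite"
  assumes "vec.subspace W" "c \<notin> W"
  obtains v where "\<And>w. w \<in> W \<Longrightarrow> cdot w v = 0" "cdot c v \<noteq> 0"
proof -
  obtain B where B: "B \<subseteq> W" "vec.independent B" "W \<subseteq> vec.span B"
    using vec.maximal_independent_subset by blast
  then have WB: "W = vec.span B" using assms(1) by (metis vec.span_minimal subset_antisym)
  then have ins: "vec.independent (insert c B)"
    using assms(2) B(2) by (intro vec.independent_insertI) auto
  obtain g :: "complex ^ 'n \<Rightarrow> complex ^ 'n" where g: "Vector_Spaces.linear (*s) (*s) g"
    "\<forall>x\<in>insert c B. g x = (if x = c then 1 else 0)"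
    using vec.linear_independent_extend[OF ins, of "\<lambda>x. if x = c then 1 else 0"] by blast
  interpret g: Vector_Spaces.linear "(*s)" "(*s)" g by (rule g(1))
  \<comment> \<open>Any one coordinate of the linear map \<open>g\<close> is a functional that kills
    \<open>W\<close> and is 1 on \<open>c\<close>; \<open>undefined\<close> merely picks an index,
    and \<open>v\<close> is the coefficient vector of that functional.\<close>
  define v where "v = (\<chi> i. g (axis i 1) $ undefined)"
  have gv: "g x $ undefined = cdot x v" for x
    unfolding linear_componentwise[OF g(1), of x] by (simp add: cdot_def v_def)
  have "c \<notin> B" using assms(2) B(1) by blast
  then have "g w = 0" if "w \<in> B" for w using g(2) that by auto
  then have "g w = 0" if "w \<in> W" for w
    using g.eq_0_on_span[of B w] that WB by blast
  moreover have "g c = 1" using g(2) by simp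
  ultimately show thesis using that[of v] gv by (metis one_neq_zero one_index zero_index)
qed

text \<open>A vector outside the subspace \<open>conormal X a\<close> would be separated from it by
  a tangent vector.\<close>

lemma conormal_double_annihilator:
  assumes "a \<in> affine_cone X" "cdot k a = 1"
    and "\<And>v. v \<in> cone_tangent_space X a \<Longrightarrow> cdot c v = 0"
  shows "c \<in> conormal X a"
  by (rule ccontr, rule separating_vector[OF conormal_subspace[OF assms(1,2)]])
     (use assms(3) cone_tangent_space_iff in blast)+

text \<open>The cone contains the whole line through \<open>a\<close>, so every equation is
  constantly zero in that direction.\<close>

lemma cone_in_tangent_space:
  assumes "a \<in> affine_cone X" shows "a \<in> cone_tangent_space X a"
  unfolding cone_tangent_space_iff
proof
  fix c assume "c \<in> conormal X a"
  then obtain d f where f: "hpoly d f" "\<forall>x\<in>affine_cone X. f x = 0" "has_grad f c a"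
    by (auto simp: conormal_def)
  have "a + t *s a = (1 + t) *s a" for t by (simp add: vector_sadd_rdistrib)
  then have "f (a + t *s a) = 0" for t using f(2) cone_scale[OF assms] by metis
  then have "((\<lambda>t. 0) has_field_derivative cdot c a) (at 0)"
    using f(3)[unfolded has_grad_def, rule_format, of a] by presburger
  then show "cdot c a = 0" using DERIV_unique DERIV_const by blast
qed

lemma conj_vec_conormal:
  assumes "conj_pt ` X = X" "conj_vec a = a" "c \<in> conormal X a"
  shows "conj_vec c \<in> conormal X a"
proof -
  from assms(3) obtain d f where f: "hpoly d f" "\<forall>x\<in>affine_cone X. f x = 0" "has_grad f c a"
    by (auto simp: conormal_def)
  show ?thesis unfolding conormal_def
    using hpoly_cnj[OF f(1)] has_grad_cnj[OF f(3) assms(2)] f(2) conj_vec_cone[OF assms(1)]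
    by (intro CollectI exI[of _ d] exI[of _ "\<lambda>x. cnj (f (conj_vec x))"]) auto
qed

lemma conj_vec_tangent:
  assumes "conj_pt ` X = X" "conj_vec a = a" "v \<in> cone_tangent_space X a"
  shows "conj_vec v \<in> cone_tangent_space X a"
  unfolding cone_tangent_space_iff
proof
  fix c assume "c \<in> conormal X a"
  then have "cdot (conj_vec c) v = 0"
    using conj_vec_conormal[OF assms(1,2)] assms(3) cone_tangent_space_iff by blast
  then show "cdot c (conj_vec v) = 0" using cdot_conj[of "conj_vec c" v] by simp
qed

text \<open>The tangent plane is stable under conjugation, so it has a real vector independent of
  \<open>a\<close>. Gram-Schmidt works with the bilinear pairing because the vectors are real.
  Orthonormality makes \<open>cdot a\<close> and \<open>cdot b\<close> coordinates on the
  plane.\<close>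

lemma obtain_tangent_frame:
  assumes "conj_pt ` X = X" "A \<in> X" "conj_pt A = A" "smooth_curve X"
  obtains a b where "a \<in> line A" "conj_vec a = a" "conj_vec b = b"
    "cdot a a = 1" "cdot b b = 1" "cdot a b = 0"
    "\<And>v. v \<in> cone_tangent_space X a \<Longrightarrow> \<exists>c d. v = c *s a + d *s b"
proof -
  obtain a' where a': "a' \<in> line A" "a' \<noteq> 0" "conj_vec a' = a'"
    by (rule obtain_real_vec[OF assms(3)])
  obtain k where k: "k \<noteq> 0" "conj_vec (k *s a') = k *s a'" "cdot (k *s a') (k *s a') = 1"
    by (rule obtain_real_unit[OF a'(3,2)])
  define a where "a = k *s a'"
  have a: "a \<in> line A" "a \<noteq> 0" "conj_vec a = a" "cdot a a = 1"
    using k a' line_eq[OF a'(1,2)] by (auto simp: a_def)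
  let ?T = "cone_tangent_space X a"
  have aT: "a \<in> ?T" by (rule cone_in_tangent_space[OF cone_line[OF a(1) assms(2)]])
  have dimT: "vec.dim ?T = 2" using assms(2,4) a by (auto simp: smooth_curve_def)
  have Tadd: "x + y \<in> ?T" if "x \<in> ?T" "y \<in> ?T" for x y
    using that by (auto simp: cone_tangent_space_iff cdot_add_right)
  have Tscale: "c *s x \<in> ?T" if "x \<in> ?T" for c x
    using that by (auto simp: cone_tangent_space_iff cdot_scale_right)
  have "\<not> ?T \<subseteq> vec.span {a}"
  proof
    assume "?T \<subseteq> vec.span {a}"
    from vec.dim_le_card[OF this] show False using dimT by simp
  qed
  then obtain u where u: "u \<in> ?T" "u \<notin> vec.span {a}" by blast
  obtain b' where b': "b' \<in> ?T" "b' \<notin> vec.span {a}" "conj_vec b' = b'"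
  proof (rule real_vec_of_conj_invariant[where P = "\<lambda>x. x \<in> ?T" and Q = "\<lambda>x. x \<in> vec.span {a}" and a = u])
    show "conj_vec u \<noteq> 0" using u(2) vec.span_zero by auto
    show "conj_vec x \<in> ?T" if "x \<in> ?T" for x
      using conj_vec_tangent[OF assms(1) a(3) that] .
  qed (use u Tadd Tscale vec.span_add vec.span_scale in auto)
  define b1 where "b1 = b' - cdot a b' *s a"
  have "b1 \<noteq> 0"
  proof
    assume "b1 = 0"
    then have "b' = cdot a b' *s a" by (simp add: b1_def)
    then show False using b'(2) by (metis insertI1 vec.span_base vec.span_scale)
  qed
  have "cnj (cdot a b') = cdot a b'" using cdot_conj[of a b'] a(3) b'(3) by simp
  then have b1conj: "conj_vec b1 = b1"
    using a(3) b'(3) by (simp add: b1_def vec_eq_iff)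
  obtain l where l: "l \<noteq> 0" "conj_vec (l *s b1) = l *s b1" "cdot (l *s b1) (l *s b1) = 1"
    by (rule obtain_real_unit[OF b1conj \<open>b1 \<noteq> 0\<close>])
  define b where "b = l *s b1"
  have ab: "cdot a b = 0"
    by (simp add: b_def b1_def cdot_scale_right cdot_diff_right a(4))
  have bb: "cdot b b = 1" using l by (simp add: b_def)
  have bT: "b \<in> ?T"
  proof -
    have "b1 = b' + (- cdot a b') *s a" by (simp add: b1_def vec_eq_iff)
    then show ?thesis unfolding b_def using Tadd Tscale b'(1) aT by metis
  qed
  have "b \<notin> vec.span {a}"
    using ab bb a(4) by (auto simp: vec.span_singleton cdot_scale_right)
  have "a \<noteq> b" using ab bb by auto
  have "vec.independent {a}" using a(2) by (simp add: vec.dependent_single)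
  have "vec.independent {b, a}"
    by (rule vec.independent_insertI) fact+
  moreover have "card {b, a} = 2" using \<open>a \<noteq> b\<close> by simp
  ultimately have "?T \<subseteq> vec.span {b, a}"
    using aT bT dimT by (intro vec.card_ge_dim_independent) auto
  then have "\<exists>c d. v = c *s a + d *s b" if "v \<in> ?T" for v
  proof -
    from that \<open>?T \<subseteq> _\<close> have "v \<in> vec.span {b, a}" by blast
    then obtain k where "v - k *s b \<in> vec.span {a}" by (auto simp: vec.span_insert)
    then obtain c where "v - k *s b = c *s a" by (auto simp: vec.span_singleton)
    then have "v = c *s a + k *s b" by (simp add: algebra_simps)
    then show ?thesis by blast
  qed
  then show thesis using that a ab bb l(2) by (metis b_def)
qed

section \<open>First-order expansion of forms\<close>

lemma hpoly_compose:
  "hpoly d f \<Longrightarrow> (\<And>i. hpoly m (g i)) \<Longrightarrow> hpoly (d * m) (\<lambda>x. f (\<chi> i. g i x))"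
proof (induction rule: hpoly.induct)
  case (hpoly_mult d f e g)
  then show ?case by (auto simp: distrib_right intro: hpoly.hpoly_mult)
qed (auto intro: hpoly.intros)

lemma cdot_sum_left: "cdot (\<Sum>i\<in>I. f i) v = (\<Sum>i\<in>I. cdot (f i) v)"
  by (induction I rule: infinite_finite_induct) (simp_all add: cdot_add_left)

lemma hpoly_det:
  fixes M :: "complex ^ 'm::finite \<Rightarrow> complex ^ 'n::finite ^ 'n"
  assumes "\<And>i j. hpoly e (\<lambda>x. M x $ i $ j)"
  shows "hpoly (CARD('n) * e) (\<lambda>x. det (M x))"
proof -
  have "hpoly (\<Sum>i\<in>(UNIV::'n set). e) (\<lambda>x. \<Prod>i\<in>UNIV. M x $ i $ p i)" for p
    by (rule hpoly_prod) (use assms in auto)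
  then show ?thesis unfolding det_def by (intro hpoly_sum hpoly_cmult) simp
qed

lemma det_scale_column:
  fixes M :: "'a::comm_ring_1 ^ 'n ^ 'n"
  shows "det (\<chi> i j. if j = k then t * c i else M $ i $ j)
       = t * det (\<chi> i j. if j = k then c i else M $ i $ j)"
proof -
  have tr: "(\<chi> i j. if j = k then c i else M $ i $ j)
      = transpose (\<chi> j. if j = k then (\<chi> i. c i) else (\<chi> i. M $ i $ j))" for c
    by (simp add: transpose_def vec_eq_iff)
  have "(\<chi> i. t * c i) = t *s (\<chi> i. c i)" by (simp add: vec_eq_iff)
  then show ?thesis unfolding tr det_transpose by (simp only: det_row_mul)
qed

text \<open>First-order expansion along the hyperplane \<open>k \<bullet> x = 0\<close> around the line through \<open>a\<close>,
  homogenised by one extra factor \<open>k \<bullet> x\<close>.\<close>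

lemma hpoly_expand:
  "hpoly d f \<Longrightarrow> \<exists>R. (\<forall>j. hpoly d (R j)) \<and>
    (\<forall>x. cdot k x * f x = cdot k x ^ Suc d * f a + (\<Sum>j\<in>UNIV. (x - cdot k x *s a) $ j * R j x))"
proof (induction rule: hpoly.induct)
  case (hpoly_const c)
  show ?case by (rule exI[of _ "\<lambda>j x. 0"]) (auto intro: hpoly.hpoly_const)
next
  case (hpoly_coord i)
  have "(\<Sum>j\<in>UNIV. (x - cdot k x *s a) $ j * (if j = i then cdot k x else 0))
      = (x - cdot k x *s a) $ i * cdot k x" for x
    by (simp add: if_distrib[of "\<lambda>y. _ * y"] cong: if_cong)
  moreover have "hpoly 1 (\<lambda>x. if j = i then cdot k x else 0)" for j
    by (cases "j = i") (simp_all only: if_True if_False simp_thms hpoly_zero hpoly_cdot)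
  ultimately show ?case
    by (intro exI[of _ "\<lambda>j x. if j = i then cdot k x else 0"])
       (auto simp: algebra_simps power2_eq_square simp del: One_nat_def)
next
  case (hpoly_add d f g)
  then obtain R S where "\<forall>j. hpoly d (R j)" "\<forall>j. hpoly d (S j)"
    "\<forall>x. cdot k x * f x = cdot k x ^ Suc d * f a + (\<Sum>j\<in>UNIV. (x - cdot k x *s a) $ j * R j x)"
    "\<forall>x. cdot k x * g x = cdot k x ^ Suc d * g a + (\<Sum>j\<in>UNIV. (x - cdot k x *s a) $ j * S j x)"
    by blast
  then show ?case
    by (intro exI[of _ "\<lambda>j x. R j x + S j x"])
       (auto intro: hpoly.hpoly_add simp: distrib_left sum.distrib simp del: power_Suc)
next
  case (hpoly_mult d f e g)
  let ?l = "cdot k" and ?w = "\<lambda>x j. (x - cdot k x *s a) $ j"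
  obtain R S where RS: "\<forall>j. hpoly d (R j)" "\<forall>j. hpoly e (S j)"
    "\<And>x. ?l x * f x = ?l x ^ Suc d * f a + (\<Sum>j\<in>UNIV. ?w x j * R j x)"
    "\<And>x. ?l x * g x = ?l x ^ Suc e * g a + (\<Sum>j\<in>UNIV. ?w x j * S j x)"
    using hpoly_mult.IH by blast
  \<comment> \<open>Expand \<open>f\<close> first; one factor \<open>cdot k x\<close> of its leading
    term is then spent on expanding \<open>g\<close>.\<close>
  let ?Q = "\<lambda>j x. f a * (?l x ^ d * S j x) + R j x * g x"
  have "hpoly (d + e) (?Q j)" for j
    using hpoly_power[OF hpoly_cdot, of d k] RS(1,2) hpoly_mult.hyps
    by (intro hpoly_add hpoly_cmult hpoly.hpoly_mult) auto
  moreover have "?l x * (f x * g x) = ?l x ^ Suc (d + e) * (f a * g a) + (\<Sum>j\<in>UNIV. ?w x j * ?Q j x)" for x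
  proof -
    have "?l x * (f x * g x) = (?l x * f x) * g x" by simp
    also have "\<dots> = f a * ?l x ^ d * (?l x * g x) + (\<Sum>j\<in>UNIV. ?w x j * R j x) * g x"
      unfolding RS(3) by (simp add: algebra_simps)
    also have "\<dots> = ?l x ^ Suc (d + e) * (f a * g a)
        + (f a * ?l x ^ d * (\<Sum>j\<in>UNIV. ?w x j * S j x) + (\<Sum>j\<in>UNIV. ?w x j * R j x) * g x)"
      unfolding RS(4) by (simp add: algebra_simps power_add)
    also have "f a * ?l x ^ d * (\<Sum>j\<in>UNIV. ?w x j * S j x) + (\<Sum>j\<in>UNIV. ?w x j * R j x) * g x
        = (\<Sum>j\<in>UNIV. ?w x j * ?Q j x)"
      by (simp only: sum_distrib_left sum_distrib_right sum.distrib[symmetric])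
         (intro sum.cong refl, simp add: algebra_simps)
    finally show ?thesis .
  qed
  ultimately show ?case by (intro exI[of _ ?Q]) blast
qed

text \<open>Differentiate the expansion at \<open>a\<close>: the factors
  \<open>(x - cdot k x *s a) $ j\<close> vanish there, so of \<open>R j\<close> only the value
  \<open>R j a\<close> survives.\<close>

lemma hpoly_expand_grad:
  assumes "has_grad f c a" "f a = 0" "cdot k a = 1" "\<And>j. hpoly d (R j)"
    and eq: "\<And>x. cdot k x * f x = cdot k x ^ Suc d * f a + (\<Sum>j\<in>UNIV. (x - cdot k x *s a) $ j * R j x)"
  shows "cdot c v = (\<Sum>j\<in>UNIV. (v - cdot k v *s a) $ j * R j a)"
proof -
  let ?W = "\<lambda>j. axis j 1 - a $ j *s k"
  have W: "cdot (?W j) x = (x - cdot k x *s a) $ j" for j x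
    by (simp add: cdot_diff_left cdot_scale_left)
  have "has_grad (\<lambda>x. cdot k x * f x) c a"
    using has_grad_mult[OF has_grad_cdot assms(1), of k] assms(2,3) by simp
  then have "has_grad (\<lambda>x. \<Sum>j\<in>UNIV. cdot (?W j) x * R j x) c a"
    unfolding eq W using assms(2) by simp
  moreover have "has_grad (\<lambda>x. \<Sum>j\<in>UNIV. cdot (?W j) x * R j x) (\<Sum>j\<in>UNIV. R j a *s ?W j) a"
  proof (rule has_grad_sum)
    fix j
    obtain r where "has_grad (R j) r a" using hpoly_has_grad[OF assms(4)] by blast
    moreover have "cdot (?W j) a = 0" by (simp add: W assms(3))
    ultimately show "has_grad (\<lambda>x. cdot (?W j) x * R j x) (R j a *s ?W j) a"
      using has_grad_mult[OF has_grad_cdot[of "?W j"]] by fastforce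
  qed simp
  ultimately have "c = (\<Sum>j\<in>UNIV. R j a *s ?W j)" by (rule has_grad_unique)
  moreover have "cdot (\<Sum>j\<in>UNIV. R j a *s ?W j) v = (\<Sum>j\<in>UNIV. R j a * cdot (?W j) v)"
    by (simp only: cdot_sum_left cdot_scale_left)
  ultimately show ?thesis by (simp add: W mult.commute)
qed

text \<open>Taylor expansion around \<open>u x *s a\<close> with a remainder divisible by
  \<open>t\<close>. The extra linear form \<open>l\<close> balances \<open>t\<close>, so that
  \<open>G\<close> has degree \<open>d * Suc N\<close> without subtracting 1, which would fail for
  \<open>d = 0\<close>.\<close>

lemma hpoly_divide:
  assumes t: "hpoly 1 t" and l: "hpoly 1 l" and u: "hpoly (Suc N) u" and v: "\<And>i. hpoly N (v i)"
  shows "hpoly d f \<Longrightarrow> \<exists>G. hpoly (d * Suc N) G \<and>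
    (\<forall>x. l x * f (\<chi> i. u x * a $ i + t x * v i x) = l x * u x ^ d * f a + t x * G x)"
proof (induction rule: hpoly.induct)
  case (hpoly_const c)
  show ?case by (rule exI[of _ "\<lambda>x. 0"]) (auto intro: hpoly.hpoly_const)
next
  case (hpoly_coord i)
  show ?case using hpoly_mult[OF l v[of i]]
    by (intro exI[of _ "\<lambda>x. l x * v i x"]) (auto simp: algebra_simps)
next
  case (hpoly_add d f g)
  let ?z = "\<lambda>x. \<chi> i. u x * a $ i + t x * v i x"
  obtain G H where "hpoly (d * Suc N) G" "hpoly (d * Suc N) H"
    "\<forall>x. l x * f (?z x) = l x * u x ^ d * f a + t x * G x"
    "\<forall>x. l x * g (?z x) = l x * u x ^ d * g a + t x * H x" using hpoly_add.IH by blast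
  then show ?case
    by (intro exI[of _ "\<lambda>x. G x + H x"]) (auto intro: hpoly.hpoly_add simp: distrib_left)
next
  case (hpoly_mult d f e g)
  let ?z = "\<lambda>x. \<chi> i. u x * a $ i + t x * v i x"
  obtain G H where GH: "hpoly (d * Suc N) G" "hpoly (e * Suc N) H"
    "\<And>x. l x * f (?z x) = l x * u x ^ d * f a + t x * G x"
    "\<And>x. l x * g (?z x) = l x * u x ^ e * g a + t x * H x" using hpoly_mult.IH by blast
  let ?K = "\<lambda>x. f a * (u x ^ d * H x) + G x * g (?z x)"
  have gz: "hpoly (e * Suc N) (\<lambda>x. g (?z x))"
    using hpoly_mult'[OF t v] hpoly_cmult[OF u, of "a $ _"]
    by (intro hpoly_compose hpoly_mult.hyps hpoly_add) (auto simp: mult.commute)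
  have "hpoly (d * Suc N + e * Suc N) ?K"
    by (intro hpoly_add hpoly_cmult hpoly.hpoly_mult GH(1,2) gz hpoly_power u)
  moreover have "l x * (f (?z x) * g (?z x)) = l x * u x ^ (d + e) * (f a * g a) + t x * ?K x" for x
  proof -
    have "l x * (f (?z x) * g (?z x)) = (l x * f (?z x)) * g (?z x)" by simp
    also have "\<dots> = u x ^ d * f a * (l x * g (?z x)) + t x * G x * g (?z x)"
      unfolding GH(3) by (simp add: algebra_simps)
    also have "\<dots> = l x * u x ^ (d + e) * (f a * g a) + t x * ?K x"
      unfolding GH(4) by (simp add: algebra_simps power_add)
    finally show ?thesis .
  qed
  ultimately show ?case by (intro exI[of _ ?K]) (simp only: distrib_right, blast)
qed

section \<open>Adapted coordinates and real local equations\<close>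

locale curve_frame =
  fixes X :: "'n::finite proj set" and A :: "'n proj" and a b :: "complex ^ 'n"
  assumes closed: "zariski_closed X" and dim: "zariski_dim X = 1"
    and irreducible: "zariski_irreducible X" and conj_X: "conj_pt ` X = X"
    and A_in: "A \<in> X" and a_line: "a \<in> line A"
    and conj_a: "conj_vec a = a" and conj_b: "conj_vec b = b"
    and aa: "cdot a a = 1" and bb: "cdot b b = 1" and ab: "cdot a b = 0"
    and tangent: "\<And>v. v \<in> cone_tangent_space X a \<Longrightarrow> \<exists>c d. v = c *s a + d *s b"
begin

text \<open>Projection whose kernel is the plane spanned by \<open>a\<close> and \<open>b\<close>;
  its coordinates are the directions transverse to the curve.\<close>

definition "xi x = x - cdot a x *s a - cdot b x *s b"

lemma ba: "cdot b a = 0"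
  using ab by (simp add: cdot_commute)

lemma a_nz: "a \<noteq> 0"
  using aa by auto

lemma a_cone: "a \<in> affine_cone X"
  using A_in a_line by (rule cone_line[rotated])

lemma xi_a: "xi a = 0" and xi_b: "xi b = 0"
  by (simp_all add: xi_def aa bb ab ba)

lemma xi_nth: "xi x $ i = x $ i - cdot a x * a $ i - cdot b x * b $ i"
  by (simp add: xi_def)

lemma cdot_a_xi [simp]: "cdot a (xi x) = 0" and cdot_b_xi [simp]: "cdot b (xi x) = 0"
  by (simp_all add: xi_def cdot_diff_right cdot_scale_right aa bb ab ba)

lemma xi_xi [simp]: "xi (xi x) = xi x"
  by (simp add: xi_def[of "xi x"])

lemma xi_add: "xi (x + y) = xi x + xi y"
  by (simp add: xi_def cdot_add_right vec_eq_iff algebra_simps)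

lemma xi_scale: "xi (c *s x) = c *s xi x"
  by (simp add: xi_def cdot_scale_right vec_eq_iff algebra_simps)

text \<open>\<open>xi\<close> is self-adjoint for \<open>cdot\<close>.\<close>

lemma cdot_xi_axis: "cdot (xi (axis i 1)) x = xi x $ i"
proof -
  have "xi (axis i 1) = axis i 1 - a $ i *s a - b $ i *s b"
    by (simp add: xi_def cdot_commute[of _ "axis i 1"])
  then show ?thesis by (simp add: cdot_diff_left cdot_scale_left xi_nth mult.commute)
qed

lemma xi_sum_coeffs: "(\<Sum>j\<in>UNIV. v $ j *s xi (axis j 1)) = xi v"
proof -
  have "(\<Sum>j\<in>UNIV. v $ j *s xi (axis j 1)) $ i = xi v $ i" for i
  proof -
    have "(axis j 1 :: complex ^ 'n) $ i = axis i 1 $ j" for j by (simp add: axis_def)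
    then have "xi (axis j 1) $ i = xi (axis i 1) $ j" for j
      by (simp add: xi_nth cdot_commute[of _ "axis _ 1"] mult.commute)
    then show ?thesis
      using cdot_xi_axis[of i v] by (simp add: cdot_def mult.commute)
  qed
  then show ?thesis by (simp add: vec_eq_iff)
qed

text \<open>Smoothness enters here: a covector that kills \<open>a\<close> and \<open>b\<close>
  kills the whole tangent space, hence is the differential of an equation of
  \<open>X\<close>.\<close>

lemma xi_conormal: "xi (axis i 1) \<in> conormal X a"
proof (rule conormal_double_annihilator[OF a_cone aa])
  fix v assume "v \<in> cone_tangent_space X a"
  then obtain c d where "v = c *s a + d *s b" using tangent by blast
  then show "cdot (xi (axis i 1)) v = 0"
    by (simp add: cdot_xi_axis xi_add xi_scale xi_a xi_b)
qed

text \<open>There is one equation per coordinate, so that \<open>chart\<close> maps the space to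
  itself. The prescribed gradients give it derivative 1 at \<open>a\<close>, the two orthogonality
  conditions keep \<open>cdot a\<close> and \<open>cdot b\<close> unchanged under it, and
  compatibility with conjugation makes the branch real.\<close>

definition local_equations :: "nat \<Rightarrow> ('n \<Rightarrow> complex ^ 'n \<Rightarrow> complex) \<Rightarrow> bool" where
  "local_equations e p \<longleftrightarrow> (\<forall>i. hpoly e (p i)) \<and> (\<forall>i. \<forall>x\<in>affine_cone X. p i x = 0) \<and>
     (\<forall>i. has_grad (p i) (xi (axis i 1)) a) \<and>
     (\<forall>x. cdot a (\<chi> i. p i x) = 0) \<and> (\<forall>x. cdot b (\<chi> i. p i x) = 0) \<and>
     (\<forall>i x. p i (conj_vec x) = cnj (p i x))"

text \<open>Equations with the right gradients are corrected to have a common degree, real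
  coefficients and values in the range of \<open>xi\<close>; each correction preserves the gradients
  at \<open>a\<close>.\<close>

lemma local_equations_exist: "\<exists>e p. local_equations e p"
proof -
  have "\<forall>i. \<exists>d f. hpoly d f \<and> (\<forall>x\<in>affine_cone X. f x = 0) \<and> has_grad f (xi (axis i 1)) a"
    using xi_conormal by (simp add: conormal_def)
  then obtain d f where f: "\<And>i. hpoly (d i) (f i)" "\<And>i x. x \<in> affine_cone X \<Longrightarrow> f i x = 0"
    "\<And>i. has_grad (f i) (xi (axis i 1)) a" by metis
  define e where "e = (\<Sum>i\<in>UNIV. d i)"
  have de: "d i \<le> e" for i unfolding e_def by (rule member_le_sum) auto
  define g where "g i x = cdot a x ^ (e - d i) * f i x" for i x
  have g1: "hpoly e (g i)" for i
    unfolding g_def using de[of i] by (intro hpoly_mult'[OF hpoly_pow_cdot f(1)]) simp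
  have g2: "g i x = 0" if "x \<in> affine_cone X" for i x using f(2)[OF that] by (simp add: g_def)
  have g3: "has_grad (g i) (xi (axis i 1)) a" for i
  proof -
    obtain w where "has_grad (\<lambda>x. cdot a x ^ (e - d i)) w a" using hpoly_has_grad[OF hpoly_pow_cdot] by blast
    from has_grad_mult[OF this f(3)[of i]] show ?thesis
      using f(2)[OF a_cone] by (simp add: g_def[abs_def] aa)
  qed
  \<comment> \<open>The average with the conjugate form is real; its gradient is unchanged because
    \<open>xi (axis i 1)\<close> is a real vector.\<close>
  define q where "q i x = (1/2) * (g i x + cnj (g i (conj_vec x)))" for i x
  have conj_xi: "conj_vec (xi x) = xi (conj_vec x)" for x
    using cdot_conj[of a x] cdot_conj[of b x] conj_a conj_b
    by (simp add: xi_def vec_eq_iff)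
  have q1: "hpoly e (q i)" for i
    unfolding q_def by (intro hpoly_cmult hpoly_add g1 hpoly_cnj)
  have q2: "q i x = 0" if "x \<in> affine_cone X" for i x
    using g2[OF that] g2[OF conj_vec_cone[OF conj_X that]] by (simp add: q_def)
  have q3: "has_grad (q i) (xi (axis i 1)) a" for i
  proof -
    have "conj_vec (axis i 1) = (axis i 1 :: complex ^ 'n)" by (simp add: vec_eq_iff axis_def)
    then have "conj_vec (xi (axis i 1)) = xi (axis i 1)" by (simp only: conj_xi)
    then have "(1/2) *s (xi (axis i 1) + conj_vec (xi (axis i 1))) = xi (axis i 1)"
      by (simp only: vec_eq_iff vector_smult_component vector_add_component) simp
    then show ?thesis unfolding q_def
      using has_grad_cmult[OF has_grad_add[OF g3[of i] has_grad_cnj[OF g3[of i] conj_a]], of "1/2"]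
      by metis
  qed
  have q4: "q i (conj_vec x) = cnj (q i x)" for i x
    by (simp add: q_def add.commute)
  \<comment> \<open>Projecting the vector of values makes it orthogonal to \<open>a\<close> and
    \<open>b\<close>. The gradients survive because \<open>xi\<close> is idempotent.\<close>
  define p where "p i x = xi (\<chi> i. q i x) $ i" for i x
  have p_vec: "(\<chi> i. p i x) = xi (\<chi> i. q i x)" for x by (simp add: p_def vec_eq_iff)
  have p_sum: "p i = (\<lambda>x. \<Sum>j\<in>UNIV. xi (axis i 1) $ j * q j x)" for i
    using cdot_xi_axis[of i "\<chi> i. q i _"] by (simp add: p_def fun_eq_iff cdot_def)
  have "hpoly e (p i)" for i
    unfolding p_sum by (intro hpoly_sum hpoly_cmult q1)
  moreover have "p i x = 0" if "x \<in> affine_cone X" for i x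
    using q2[OF that] by (simp add: p_sum)
  moreover have "has_grad (p i) (xi (axis i 1)) a" for i
  proof -
    have "has_grad (p i) (\<Sum>j\<in>UNIV. xi (axis i 1) $ j *s xi (axis j 1)) a"
      unfolding p_sum by (intro has_grad_sum has_grad_cmult q3) simp
    then show ?thesis by (simp add: xi_sum_coeffs)
  qed
  moreover have "p i (conj_vec x) = cnj (p i x)" for i x
  proof -
    have "(\<chi> i. q i (conj_vec x)) = conj_vec (\<chi> i. q i x)" by (simp add: q4 vec_eq_iff)
    then show ?thesis by (simp only: p_def conj_xi[symmetric] conj_vec_nth)
  qed
  ultimately show ?thesis unfolding local_equations_def p_vec
    by (intro exI[of _ e] exI[of _ p]) (simp add: p_vec)
qed

end

section \<open>The uniformizer at \<open>A\<close>\<close>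

locale curve_germ = curve_frame +
  fixes e :: nat and p
  assumes equations: "local_equations e p"
begin

lemma hpoly_p: "hpoly e (p i)" and p_cone: "x \<in> affine_cone X \<Longrightarrow> p i x = 0"
  and p_grad: "has_grad (p i) (xi (axis i 1)) a"
  and p_a: "cdot a (\<chi> i. p i x) = 0" and p_b: "cdot b (\<chi> i. p i x) = 0"
  and p_conj: "p i (conj_vec x) = cnj (p i x)"
  using equations by (simp_all add: local_equations_def)

definition "zeros = {x. \<forall>i. p i x = 0}"

lemma cone_zeros: "affine_cone X \<subseteq> zeros"
  using p_cone by (auto simp: zeros_def)

text \<open>Nakayama's lemma, by Cramer's rule. The relation is needed on the zero set of the local
  equations, since the branch constructed below is not known to lie in \<open>X\<close> at first.\<close>

lemma transverse_relation:
  "\<exists>N s c. hpoly N s \<and> s a = 1 \<and> (\<forall>k. hpoly N (c k)) \<and>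
     (\<forall>x\<in>zeros. \<forall>k. s x * xi x $ k = cdot b x * c k x)"
proof -
  have "\<forall>i. \<exists>R. (\<forall>j. hpoly e (R j)) \<and>
    (\<forall>x. cdot a x * p i x = cdot a x ^ Suc e * p i a + (\<Sum>j\<in>UNIV. (x - cdot a x *s a) $ j * R j x))"
    using hpoly_expand[OF hpoly_p] by blast
  then obtain R where R: "\<And>i j. hpoly e (R i j)"
    "\<And>i x. cdot a x * p i x = cdot a x ^ Suc e * p i a + (\<Sum>j\<in>UNIV. (x - cdot a x *s a) $ j * R i j x)"
    by metis
  have pa: "p i a = 0" for i by (rule p_cone[OF a_cone])
  have grad: "xi v $ i = (\<Sum>j\<in>UNIV. (v - cdot a v *s a) $ j * R i j a)" for i v
    unfolding cdot_xi_axis[symmetric]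
    by (rule hpoly_expand_grad[OF p_grad pa aa R])
  \<comment> \<open>By \<open>grad\<close>, the matrix of the \<open>R i j a\<close> fixes every
    vector \<open>xi x\<close>. The correction term therefore does not change
    \<open>M x *v xi x\<close>, while it makes \<open>M a\<close> the identity; the power of
    \<open>cdot a x\<close> keeps the entries homogeneous.\<close>
  define M :: "complex ^ 'a \<Rightarrow> complex ^ 'a ^ 'a" where
    "M x = (\<chi> i j. R i j x + ((if i = j then 1 else 0) - R i j a) * cdot a x ^ e)" for x
  define c where "c i x = - (\<Sum>j\<in>UNIV. b $ j * R i j x)" for i x
  define C :: "'a \<Rightarrow> complex ^ 'a \<Rightarrow> complex ^ 'a ^ 'a" where
    "C k x = (\<chi> i j. if j = k then c i x else M x $ i $ j)" for k x
  have hM: "hpoly e (\<lambda>x. M x $ i $ j)" for i j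
    unfolding M_def vec_lambda_beta by (intro hpoly_add R hpoly_cmult hpoly_pow_cdot)
  have hc: "hpoly e (c i)" for i
    unfolding c_def using hpoly_diff[OF hpoly_zero hpoly_sum[OF hpoly_cmult[OF R(1)]]] by simp
  have hC: "hpoly e (\<lambda>x. C k x $ i $ j)" for i j k
    unfolding C_def using hc[of i] hM[of i j] by (cases "j = k") auto
  have "M a = mat 1" by (simp add: M_def aa mat_def vec_eq_iff)
  then have "det (M a) = 1" by simp
  moreover have "det (M x) * xi x $ k = cdot b x * det (C k x)" if x: "x \<in> zeros" for x k
  proof -
    have Mxi: "(M x *v xi x) $ i = cdot b x * c i x" for i
    proof -
      have "0 = (\<Sum>j\<in>UNIV. (x - cdot a x *s a) $ j * R i j x)"
        using R(2)[of x i] x by (simp add: pa zeros_def)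
      also have "x - cdot a x *s a = cdot b x *s b + xi x" by (simp add: xi_def)
      finally have 1: "(\<Sum>j\<in>UNIV. R i j x * xi x $ j) = cdot b x * c i x"
        by (simp add: c_def sum_distrib_left sum_distrib_right sum.distrib distrib_right distrib_left
            sum_negf eq_neg_iff_add_eq_0 add.commute mult.assoc mult.commute mult.left_commute)
      have "xi x $ i = (\<Sum>j\<in>UNIV. xi x $ j * R i j a)" using grad[of "xi x" i] by simp
      moreover have "xi x $ i = (\<Sum>j\<in>UNIV. (if i = j then 1 else 0) * xi x $ j)"
        by (simp add: if_distrib[of "\<lambda>y. y * _"] cong: if_cong)
      ultimately have 2: "(\<Sum>j\<in>UNIV. ((if i = j then 1 else 0) - R i j a) * xi x $ j) = 0"
        by (simp only: left_diff_distrib sum_subtractf) (simp only: mult.commute diff_self)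
      have "(M x *v xi x) $ i = (\<Sum>j\<in>UNIV. R i j x * xi x $ j)
          + cdot a x ^ e * (\<Sum>j\<in>UNIV. ((if i = j then 1 else 0) - R i j a) * xi x $ j)"
        unfolding M_def matrix_vector_mult_def
        by (simp only: vec_lambda_beta sum_distrib_left sum.distrib[symmetric])
           (intro sum.cong refl, simp add: algebra_simps)
      then show ?thesis using 1 2 by simp
    qed
    have "xi x $ k * det (M x) = det (\<chi> i j. if j = k then cdot b x * c i x else M x $ i $ j)"
      unfolding cramer_lemma[symmetric] Mxi ..
    then show ?thesis unfolding det_scale_column C_def by (simp add: mult.commute)
  qed
  ultimately show ?thesis using hpoly_det[OF hM] hpoly_det[OF hC]
    by (intro exI[of _ "CARD('a) * e"] exI[of _ "\<lambda>x. det (M x)"] exI[of _ "\<lambda>k x. det (C k x)"]) blast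
qed

text \<open>Hence the maximal ideal of the local ring at \<open>A\<close> is generated by \<open>b \<bullet> x\<close>.\<close>

lemma uniformizer_divides:
  assumes f: "hpoly d f" "f a = 0"
  shows "\<exists>M m S G. hpoly M S \<and> S a = 1 \<and> hpoly m G \<and> (\<forall>x\<in>zeros. S x * f x = cdot b x * G x)"
proof -
  obtain N s c where s: "hpoly N s" "s a = 1" "\<And>k. hpoly N (c k)"
    "\<And>x k. x \<in> zeros \<Longrightarrow> s x * xi x $ k = cdot b x * c k x"
    using transverse_relation by blast
  \<comment> \<open>Chosen so that on \<open>zeros\<close> the vector \<open>s x *s x\<close> equals
    \<open>(s x * cdot a x) *s a\<close> plus \<open>cdot b x\<close> times the vector of the
    \<open>v k x\<close>, the argument that \<open>hpoly_divide\<close> expects.\<close>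
  define v where "v k x = b $ k * s x + c k x" for k x
  have hv: "hpoly N (v k)" for k unfolding v_def by (intro hpoly_add hpoly_cmult s)
  have hu: "hpoly (Suc N) (\<lambda>x. s x * cdot a x)"
    by (rule hpoly_mult'[OF s(1) hpoly_cdot]) simp
  obtain G where G: "hpoly (d * Suc N) G"
    "\<And>x. cdot a x * f (\<chi> i. s x * cdot a x * a $ i + cdot b x * v i x)
        = cdot a x * (s x * cdot a x) ^ d * f a + cdot b x * G x"
    using hpoly_divide[where a = a and v = v, OF hpoly_cdot[of b] hpoly_cdot[of a] hu hv f(1)] by blast
  have "cdot a x * s x ^ d * f x = cdot b x * G x" if x: "x \<in> zeros" for x
  proof -
    have "(\<chi> i. s x * cdot a x * a $ i + cdot b x * v i x) = s x *s x"
      using s(4)[OF x] by (simp add: vec_eq_iff v_def xi_nth algebra_simps)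
    then show ?thesis using G(2)[of x] by (simp add: f(2) hpoly_scale[OF f(1)] mult.assoc)
  qed
  moreover have "hpoly (1 + d * N) (\<lambda>x. cdot a x * s x ^ d)"
    by (intro hpoly_mult hpoly_cdot hpoly_power s)
  ultimately show ?thesis using G(1) aa s(2)
    by (intro exI[of _ "1 + d * N"] exI[of _ "d * Suc N"] exI[of _ "\<lambda>x. cdot a x * s x ^ d"] exI[of _ G]) auto
qed

text \<open>If \<open>cdot b\<close> vanished on the cone, the transverse relation would leave only
  \<open>A\<close> where \<open>s\<close> is nonzero. As \<open>s a = 1\<close>, irreducibility
  would shrink \<open>X\<close> to one point.\<close>

lemma uniformizer_nonzero: "\<exists>x\<in>affine_cone X. cdot b x \<noteq> 0"
proof (rule ccontr)
  assume *: "\<not> ?thesis"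
  obtain N s c where s: "hpoly N s" "s a = 1"
    "\<And>x k. x \<in> zeros \<Longrightarrow> s x * xi x $ k = cdot b x * c k x"
    using transverse_relation by blast
  have cases: "s x = 0 \<or> x \<in> line A" if x: "x \<in> affine_cone X" for x
  proof -
    have "s x * xi x $ k = 0" for k using s(3)[of x k] x cone_zeros * by auto
    then have "s x = 0 \<or> xi x = 0" by (auto simp: vec_eq_iff)
    moreover have "x = cdot a x *s a" if "xi x = 0" using that * x by (simp add: xi_def)
    ultimately show ?thesis using line_eq[OF a_line a_nz] by blast
  qed
  let ?V = "{B. \<forall>x\<in>line B. s x = 0}"
  have "X \<subseteq> ?V \<union> {A}"
  proof
    fix B assume B: "B \<in> X"
    obtain x where x: "x \<in> line B" "x \<noteq> 0" by (rule obtain_line)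
    then have "s x = 0 \<or> x \<in> line A" using cases cone_line B by blast
    then show "B \<in> ?V \<union> {A}"
      using hpoly_zero_on_line[OF s(1) x] proj_pt_eq x by blast
  qed
  then have "X \<subseteq> ?V \<or> X \<subseteq> {A}"
    using irreducible zariski_closed_zeros[OF s(1)] zariski_closed_singleton
    unfolding zariski_irreducible_def by blast
  moreover have "\<not> X \<subseteq> ?V" using A_in a_line s(2) by fastforce
  ultimately show False using curve_not_singleton[OF dim] by blast
qed

end

section \<open>The analytic branch through a real point\<close>

lemma has_derivative_vec:
  fixes f :: "'n::finite \<Rightarrow> 'a::euclidean_space \<Rightarrow> complex"
  assumes "\<And>i. (f i has_derivative (\<lambda>v. f' v $ i)) (at x)"
  shows "((\<lambda>x. \<chi> i. f i x) has_derivative f') (at x)"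
proof -
  have "((\<lambda>x. (\<chi> i. f i x) \<bullet> u) has_derivative (\<lambda>v. f' v \<bullet> u)) (at x)" if "u \<in> Basis" for u
  proof -
    from \<open>u \<in> Basis\<close> obtain i w where u: "u = axis i w" by (auto simp: Basis_vec_def)
    have "((\<lambda>x. f i x \<bullet> w) has_derivative (\<lambda>v. (f' v $ i) \<bullet> w)) (at x)"
      by (rule has_derivative_inner_left[OF assms])
    then show ?thesis by (simp add: u inner_axis)
  qed
  then show ?thesis using has_derivative_componentwise_within by blast
qed

lemma norm_conj_vec: "norm (conj_vec x) = norm x"
  by (simp add: norm_vec_def L2_set_def)

lemma conj_vec_diff: "conj_vec (x - y) = conj_vec x - conj_vec y"
  by (simp add: vec_eq_iff)

lemma has_derivative_imp_has_grad:
  assumes "(f has_derivative (\<lambda>v. \<Sum>i\<in>UNIV. c i * v $ i)) (at a)"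
  shows "has_grad f (\<chi> i. c i) a"
  unfolding has_grad_def
proof
  fix v :: "complex ^ 'a"
  have 1: "((\<lambda>t. \<chi> i. a $ i + t * v $ i) has_derivative (\<lambda>h. \<chi> i. h * v $ i)) (at 0)"
    by (intro has_derivative_vec) (auto intro!: derivative_eq_intros)
  have "((\<lambda>t. f (\<chi> i. a $ i + t * v $ i)) has_derivative (\<lambda>h. \<Sum>i\<in>UNIV. c i * (\<chi> i. h * v $ i) $ i)) (at 0)"
    by (rule has_derivative_compose[OF 1]) (use assms in simp)
  moreover have "(\<lambda>h. \<Sum>i\<in>UNIV. c i * (\<chi> i. h * v $ i) $ i) = (*) (cdot (\<chi> i. c i) v)"
    by (simp add: fun_eq_iff cdot_def sum_distrib_left sum_distrib_right mult.assoc mult.left_commute mult.commute)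
  moreover have "(\<chi> i. a $ i + t * v $ i) = a + t *s v" for t by (simp add: vec_eq_iff)
  ultimately show "((\<lambda>t. f (a + t *s v)) has_field_derivative cdot (\<chi> i. c i) v) (at 0)"
    by (simp add: has_field_derivative_def)
qed

context curve_germ
begin

text \<open>This map straightens \<open>zeros\<close>: a vector lies in \<open>zeros\<close> exactly
  if its image lies in the plane spanned by \<open>a\<close> and \<open>b\<close>.\<close>

definition "chart x = cdot a x *s a + cdot b x *s b + (\<chi> i. p i x)"

lemma chart_derivative:
  "\<exists>D :: complex ^ 'a \<Rightarrow> complex ^ 'a ^ 'a. (\<forall>x. (chart has_derivative (*v) (D x)) (at x)) \<and>
     (\<forall>i j. continuous_on UNIV (\<lambda>x. D x $ i $ j)) \<and> D a = mat 1"
proof -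
  define f where "f i x = a $ i * cdot a x + b $ i * cdot b x + p i x" for i x
  have "\<exists>c. (\<forall>j. continuous_on UNIV (c j)) \<and>
     (\<forall>x. (f i has_derivative (\<lambda>v. \<Sum>j\<in>UNIV. c j x * v $ j)) (at x))" for i
  proof -
    have "hpoly 1 (\<lambda>x. a $ i * cdot a x + b $ i * cdot b x)"
      by (intro hpoly_add hpoly_cmult hpoly_cdot)
    from hpoly_has_derivative[OF this] hpoly_has_derivative[OF hpoly_p[of i]]
    obtain c d where *: "\<forall>j. continuous_on UNIV (c j)" "\<forall>j. continuous_on UNIV (d j)"
      "\<And>x. ((\<lambda>x. a $ i * cdot a x + b $ i * cdot b x) has_derivative (\<lambda>v. \<Sum>j\<in>UNIV. c j x * v $ j)) (at x)"
      "\<And>x. (p i has_derivative (\<lambda>v. \<Sum>j\<in>UNIV. d j x * v $ j)) (at x)" by blast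
    have "(f i has_derivative (\<lambda>v. \<Sum>j\<in>UNIV. (c j x + d j x) * v $ j)) (at x)" for x
      unfolding f_def[abs_def]
      by (rule has_derivative_eq_rhs[OF has_derivative_add[OF *(3,4)]])
         (simp add: distrib_right sum.distrib)
    moreover have "continuous_on UNIV (\<lambda>x. c j x + d j x)" for j
      using * by (intro continuous_on_add) auto
    ultimately show ?thesis by (intro exI[of _ "\<lambda>j x. c j x + d j x"]) blast
  qed
  then have "\<forall>i. \<exists>c. (\<forall>j. continuous_on UNIV (c j)) \<and>
     (\<forall>x. (f i has_derivative (\<lambda>v. \<Sum>j\<in>UNIV. c j x * v $ j)) (at x))" by blast
  then obtain c where c: "\<And>i j. continuous_on UNIV (c i j)"
    "\<And>i x. (f i has_derivative (\<lambda>v. \<Sum>j\<in>UNIV. c i j x * v $ j)) (at x)" by metis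
  define D :: "complex ^ 'a \<Rightarrow> complex ^ 'a ^ 'a" where "D x = (\<chi> i j. c i j x)" for x
  have chart: "chart = (\<lambda>x. \<chi> i. f i x)"
    by (simp add: chart_def f_def vec_eq_iff fun_eq_iff mult.commute)
  have "(chart has_derivative (*v) (D x)) (at x)" for x
    unfolding chart by (rule has_derivative_vec) (simp add: matrix_vector_mult_def D_def c)
  moreover have "continuous_on UNIV (\<lambda>x. D x $ i $ j)" for i j
    using c(1) by (simp add: D_def)
  moreover have "D a = mat 1"
  proof -
    have "has_grad (f i) (a $ i *s a + b $ i *s b + xi (axis i 1)) a" for i
      unfolding f_def[abs_def] by (intro has_grad_add has_grad_cmult has_grad_cdot p_grad)
    moreover have "a $ i *s a + b $ i *s b + xi (axis i 1) = axis i 1" for i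
      by (simp add: xi_def cdot_commute[of _ "axis i 1"])
    ultimately have "(\<chi> j. c i j a) = axis i 1" for i
      using has_grad_unique[OF has_derivative_imp_has_grad[OF c(2)]] by metis
    then have "c i j a = axis i 1 $ j" for i j by (metis vec_lambda_beta)
    then show ?thesis by (simp add: D_def mat_def vec_eq_iff axis_def)
  qed
  ultimately show ?thesis by blast
qed

lemma cdot_chart: "cdot a (chart x) = cdot a x" "cdot b (chart x) = cdot b x"
  by (simp_all add: chart_def cdot_add_right cdot_scale_right aa bb ab ba p_a p_b)

lemma chart_zeros: "x \<in> zeros \<Longrightarrow> chart x = cdot a x *s a + cdot b x *s b"
  by (simp add: chart_def zeros_def vec_eq_iff)

lemma zeros_chart: "chart x = cdot a x *s a + cdot b x *s b \<Longrightarrow> x \<in> zeros"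
  by (simp add: chart_def zeros_def vec_eq_iff)

lemma conj_chart: "chart (conj_vec x) = conj_vec (chart x)"
  using cdot_conj[of a x] cdot_conj[of b x] conj_a conj_b
  by (auto simp: chart_def p_conj vec_eq_iff)

text \<open>The branch is normalised by \<open>cdot a = 1\<close> and parametrised by the
  uniformizer itself, so that dividing a form by \<open>cdot b\<close> is dividing its pullback by
  the parameter. The last clause says that near \<open>a\<close> the normalised zeros all lie on the
  branch.\<close>

definition branch :: "(complex \<Rightarrow> complex ^ 'a) \<Rightarrow> real \<Rightarrow> real \<Rightarrow> bool" where
  "branch \<gamma> r \<delta> \<longleftrightarrow> 0 < r \<and> 0 < \<delta> \<and> \<gamma> 0 = a \<and>
     (\<forall>i. (\<lambda>\<tau>. \<gamma> \<tau> $ i) holomorphic_on ball 0 r) \<and>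
     (\<forall>\<tau>\<in>ball 0 r. \<gamma> \<tau> \<in> zeros \<and> cdot a (\<gamma> \<tau>) = 1 \<and> cdot b (\<gamma> \<tau>) = \<tau>) \<and>
     (\<forall>\<tau>\<in>ball 0 r. \<tau> \<in> \<real> \<longrightarrow> conj_vec (\<gamma> \<tau>) = \<gamma> \<tau>) \<and>
     (\<forall>x\<in>zeros. cdot a x = 1 \<and> dist x a < \<delta> \<longrightarrow> cdot b x \<in> ball 0 r \<and> x = \<gamma> (cdot b x))"

text \<open>The branch is the image of the affine line \<open>a + \<tau> *s b\<close> under the
  local inverse \<open>g\<close> of \<open>chart\<close>.\<close>

lemma branch_exists: "\<exists>\<gamma> r \<delta>. branch \<gamma> r \<delta>"
proof -
  obtain D :: "complex ^ 'a \<Rightarrow> complex ^ 'a ^ 'a" where D: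
    "\<And>x. (chart has_derivative (*v) (D x)) (at x)"
    "\<And>i j. continuous_on UNIV (\<lambda>x. D x $ i $ j)" "D a = mat 1"
    using chart_derivative by blast
  have Dap: "blinfun_apply (Blinfun ((*v) (D x))) = (*v) (D x)" for x
    by (rule bounded_linear_Blinfun_apply) simp
  have cont: "continuous_on UNIV (\<lambda>x. Blinfun ((*v) (D x)))"
    unfolding matrix_vector_mult_def[abs_def]
  proof (rule continuous_on_blinfun_componentwise)
    fix u :: "complex ^ 'a" assume "u \<in> Basis"
    show "continuous_on UNIV (\<lambda>x. blinfun_apply (Blinfun (\<lambda>v. \<chi> i. \<Sum>j\<in>UNIV. D x $ i $ j * v $ j)) u)"
      unfolding Dap[unfolded matrix_vector_mult_def[abs_def]]
      by (intro continuous_on_vec_lambda continuous_on_sum continuous_on_mult D(2) continuous_on_const)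
  qed
  have inv: "id_blinfun o\<^sub>L Blinfun ((*v) (D a)) = id_blinfun"
    using Dap[of a] by (intro blinfun_eqI) (simp add: D(3))
  obtain U V g g' where U: "open U" "U \<subseteq> UNIV" "a \<in> U" "open V" "chart a \<in> V" "homeomorphism U V chart g"
    "\<And>y. y \<in> V \<Longrightarrow> (g has_derivative (g' y)) (at y)"
    "\<And>y. y \<in> V \<Longrightarrow> g' y = inv (blinfun_apply (Blinfun ((*v) (D (g y)))))"
    "\<And>y. y \<in> V \<Longrightarrow> bij (blinfun_apply (Blinfun ((*v) (D (g y)))))"
    using inverse_function_theorem[OF open_UNIV _ cont UNIV_I inv, of chart] D(1) Dap by metis
  have chart_a: "chart a = a" using chart_zeros[of a] cone_zeros a_cone by (auto simp: aa ba)
  define \<gamma> where "\<gamma> \<tau> = g (a + \<tau> *s b)" for \<tau>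
  have g_chart: "g (chart x) = x" if "x \<in> U" for x using U(6) that by (simp add: homeomorphism_def)
  have chart_g: "chart (g y) = y" "g y \<in> U" if "y \<in> V" for y
    using U(6) that by (auto simp: homeomorphism_def)
  have \<gamma>0: "\<gamma> 0 = a" using g_chart[OF U(3)] chart_a by (simp add: \<gamma>_def)
  have lin: "((\<lambda>\<tau>. a + \<tau> *s b) has_derivative (\<lambda>h. h *s b)) (at \<tau>)" for \<tau>
  proof -
    have "((\<lambda>\<tau>. \<chi> i. a $ i + \<tau> * b $ i) has_derivative (\<lambda>h. h *s b)) (at \<tau>)"
      by (rule has_derivative_vec) (auto intro!: derivative_eq_intros)
    moreover have "(\<lambda>\<tau>. \<chi> i. a $ i + \<tau> * b $ i) = (\<lambda>\<tau>. a + \<tau> *s b)" by (simp add: vec_eq_iff fun_eq_iff)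
    ultimately show ?thesis by simp
  qed
  then have cont_lin: "continuous_on UNIV (\<lambda>\<tau>. a + \<tau> *s b)"
    by (meson continuous_at_imp_continuous_on has_derivative_continuous)
  define W where "W = (\<lambda>\<tau>. a + \<tau> *s b) -` V"
  have W: "open W" "0 \<in> W"
    using open_vimage[OF U(4) cont_lin] U(5) chart_a by (auto simp: W_def)
  have field_der: "((\<lambda>\<tau>. \<gamma> \<tau> $ i) has_field_derivative g' (a + \<tau> *s b) b $ i) (at \<tau>)" if "\<tau> \<in> W" for \<tau> i
  proof -
    let ?y = "a + \<tau> *s b"
    have y: "?y \<in> V" using that by (simp add: W_def)
    have bij: "bij ((*v) (D (g ?y)))" and g': "g' ?y = inv ((*v) (D (g ?y)))"
      using U(8,9)[OF y] by (simp_all add: Dap)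
    \<comment> \<open>The inverse function theorem yields a real derivative only. Being inverse to a
      complex matrix it is complex linear, which makes \<gamma> holomorphic.\<close>
    have "g' ?y (h *s b) = h *s g' ?y b" for h
    proof -
      have "D (g ?y) *v (h *s g' ?y b) = h *s b"
        unfolding g' vector_scalar_commute by (simp only: surj_f_inv_f[OF bij_is_surj[OF bij]])
      then show ?thesis using bij unfolding g' by (metis bij_is_inj inv_f_f)
    qed
    moreover have "((\<lambda>\<tau>. g (a + \<tau> *s b)) has_derivative (\<lambda>h. g' ?y (h *s b))) (at \<tau>)"
      by (rule has_derivative_compose[OF lin U(7)[OF y]])
    then have "((\<lambda>\<tau>. \<gamma> \<tau> $ i) has_derivative (\<lambda>h. g' ?y (h *s b) $ i)) (at \<tau>)"
      unfolding \<gamma>_def by (rule bounded_linear.has_derivative[OF bounded_linear_vec_nth])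
    ultimately show ?thesis
      by (simp add: has_field_derivative_def mult_commute_abs)
  qed
  \<comment> \<open>A ball around the real vector \<open>a\<close> is stable under conjugation,
    which \<open>U\<close> need not be. It keeps both \<open>\<gamma> \<tau>\<close> and its
    conjugate where \<open>chart\<close> is injective.\<close>
  obtain \<rho> where \<rho>: "\<rho> > 0" "ball a \<rho> \<subseteq> U" using U(1,3) open_contains_ball by blast
  have "continuous_on W (\<lambda>\<tau>. \<gamma> \<tau> $ i)" for i
    using field_der DERIV_isCont continuous_at_imp_continuous_on by blast
  then have "continuous_on W (\<lambda>\<tau>. \<chi> i. \<gamma> \<tau> $ i)"
    by (rule continuous_on_vec_lambda)
  then have "continuous_on W \<gamma>" by simp
  then have "open (\<gamma> -` ball a \<rho> \<inter> W)" using W(1) by (simp add: continuous_on_open_vimage)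
  moreover have "0 \<in> \<gamma> -` ball a \<rho> \<inter> W" using W(2) \<gamma>0 \<rho>(1) by simp
  ultimately obtain r where r: "r > 0" "ball 0 r \<subseteq> \<gamma> -` ball a \<rho> \<inter> W"
    using open_contains_ball by blast
  have in_V: "a + \<tau> *s b \<in> V" if "\<tau> \<in> ball 0 r" for \<tau> using r(2) that by (auto simp: W_def)
  have chart_\<gamma>: "chart (\<gamma> \<tau>) = a + \<tau> *s b" if "\<tau> \<in> ball 0 r" for \<tau>
    unfolding \<gamma>_def by (rule chart_g(1)[OF in_V[OF that]])
  have on_curve: "\<gamma> \<tau> \<in> zeros \<and> cdot a (\<gamma> \<tau>) = 1 \<and> cdot b (\<gamma> \<tau>) = \<tau>" if "\<tau> \<in> ball 0 r" for \<tau>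
  proof -
    have "cdot a (\<gamma> \<tau>) = 1" "cdot b (\<gamma> \<tau>) = \<tau>"
      using cdot_chart[of "\<gamma> \<tau>"] chart_\<gamma>[OF that]
      by (simp_all add: cdot_add_right cdot_scale_right aa bb ab ba)
    then show ?thesis using zeros_chart[of "\<gamma> \<tau>"] chart_\<gamma>[OF that] by simp
  qed
  have conj: "conj_vec (\<gamma> \<tau>) = \<gamma> \<tau>" if \<tau>: "\<tau> \<in> ball 0 r" "\<tau> \<in> \<real>" for \<tau>
  proof -
    have "dist a (conj_vec (\<gamma> \<tau>)) = dist a (\<gamma> \<tau>)"
      using norm_conj_vec[of "a - \<gamma> \<tau>"] by (simp add: dist_norm conj_vec_diff conj_a)
    moreover have "dist a (\<gamma> \<tau>) < \<rho>" using r(2) \<tau>(1) by auto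
    ultimately have "conj_vec (\<gamma> \<tau>) \<in> U" "\<gamma> \<tau> \<in> U" using \<rho>(2) by auto
    moreover have "chart (conj_vec (\<gamma> \<tau>)) = chart (\<gamma> \<tau>)"
      using \<tau>(2) by (simp add: conj_chart chart_\<gamma>[OF \<tau>(1)] conj_vec_add conj_vec_scale conj_a conj_b Reals_cnj_iff)
    ultimately show ?thesis using g_chart by metis
  qed
  have "continuous_on UNIV (cdot b)" by (rule hpoly_continuous[OF hpoly_cdot])
  then have "open (cdot b -` ball 0 r \<inter> U)"
    using U(1) open_vimage open_ball by blast
  moreover have "a \<in> cdot b -` ball 0 r \<inter> U" using U(3) r(1) by (simp add: ba)
  ultimately obtain \<delta> where \<delta>: "\<delta> > 0" "ball a \<delta> \<subseteq> cdot b -` ball 0 r \<inter> U"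
    using open_contains_ball by blast
  have "cdot b x \<in> ball 0 r \<and> x = \<gamma> (cdot b x)" if x: "x \<in> zeros" "cdot a x = 1" "dist x a < \<delta>" for x
  proof -
    have "x \<in> ball a \<delta>" using x(3) by (simp add: dist_commute)
    then have "cdot b x \<in> ball 0 r" "x \<in> U" using \<delta>(2) by auto
    moreover have "x = \<gamma> (cdot b x)"
      using g_chart[OF \<open>x \<in> U\<close>] chart_zeros[OF x(1)] x(2) by (simp add: \<gamma>_def)
    ultimately show ?thesis by blast
  qed
  moreover have "(\<lambda>\<tau>. \<gamma> \<tau> $ i) holomorphic_on ball 0 r" for i
    unfolding holomorphic_on_def field_differentiable_def
    using r(2) field_der has_field_derivative_at_within by blast
  ultimately have "branch \<gamma> r \<delta>"
    unfolding branch_def using r(1) \<delta>(1) \<gamma>0 on_curve conj by blast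
  then show ?thesis by blast
qed

end

section \<open>Orders of holomorphic functions and Landau bounds\<close>

lemma holomorphic_zero_or_order:
  fixes h :: "complex \<Rightarrow> complex"
  assumes h: "h holomorphic_on ball 0 r" and "0 < r"
  obtains (zero) "\<And>z. z \<in> ball 0 r \<Longrightarrow> h z = 0"
  | (order) m g \<rho> where "0 < \<rho>" "\<rho> \<le> r" "g holomorphic_on ball 0 \<rho>"
      "\<And>z. z \<in> ball 0 \<rho> \<Longrightarrow> h z = z ^ m * g z" "\<And>z. z \<in> ball 0 \<rho> \<Longrightarrow> g z \<noteq> 0"
proof (cases "h 0 = 0")
  case True
  show thesis
  proof (cases "h constant_on ball 0 r")
    case True
    then show thesis using \<open>h 0 = 0\<close> assms(2) zero by (metis centre_in_ball constant_on_def)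
  next
    case False
    obtain g \<rho> n where "0 < n" "0 < \<rho>" "ball (0::complex) \<rho> \<subseteq> ball 0 r" "g holomorphic_on ball 0 \<rho>"
      "\<And>w. w \<in> ball 0 \<rho> \<Longrightarrow> h w = (w - 0) ^ n * g w" "\<And>w. w \<in> ball 0 \<rho> \<Longrightarrow> g w \<noteq> 0"
      by (rule holomorphic_factor_zero_nonconstant[OF h open_ball connected_ball _ True False])
         (simp add: assms(2), rule that)
    then show thesis using order[of \<rho> g n] by (simp add: ball_subset_ball_iff)
  qed
next
  case False
  have "continuous_on (ball 0 r) h" using h holomorphic_on_imp_continuous_on by blast
  then have "isCont h 0" using assms(2) by (simp add: continuous_on_eq_continuous_at)
  then obtain e where e: "e > 0" "\<forall>y. dist 0 y < e \<longrightarrow> h y \<noteq> 0"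
    using continuous_at_avoid[of 0 h 0] False by auto
  \<comment> \<open>A nonzero value at 0 is the case of order 0, with \<open>g = h\<close>.\<close>
  show thesis
    by (rule order[of "min e r" h 0]) (use e assms h in \<open>auto intro: holomorphic_on_subset\<close>)
qed

lemma at_0_ball: "0 < r \<Longrightarrow> eventually (\<lambda>z. z \<in> ball 0 r) (at (0::complex))"
  by (rule eventually_at_in_open') auto

text \<open>Lets orders be read off from Landau bounds, which behave well under sums, products and
  unit factors. For the hard direction, a bound of higher order would force the limit
  \<open>c\<close> of \<open>u\<close> to be 0.\<close>

lemma monomial_bigo_iff:
  fixes u :: "complex \<Rightarrow> complex"
  assumes u: "(u \<longlongrightarrow> c) (at 0)" "c \<noteq> 0"
    and f: "eventually (\<lambda>z. f z = z ^ m * u z) (at 0)"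
  shows "f \<in> O[at 0](\<lambda>z. z ^ k) \<longleftrightarrow> k \<le> m"
proof
  assume "k \<le> m"
  have "u \<in> O[at 0](\<lambda>z. 1)" 
    using u(1) by (intro bigoI_tendsto[where c = c]) auto
  moreover have "(\<lambda>z::complex. z ^ (m - k)) \<in> O[at 0](\<lambda>z. 1)"
    by (intro bigoI_tendsto[where c = "0 ^ (m - k)"]) (auto intro!: tendsto_intros)
  ultimately have "(\<lambda>z. z ^ k * (z ^ (m - k) * u z)) \<in> O[at 0](\<lambda>z. z ^ k * (1 * 1))"
    by (intro landau_o.big.mult landau_o.big_refl)
  moreover have "eventually (\<lambda>z. f z = z ^ k * (z ^ (m - k) * u z)) (at 0)"
    using f by eventually_elim (simp add: \<open>k \<le> m\<close> mult.assoc[symmetric] power_add[symmetric])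
  ultimately show "f \<in> O[at 0](\<lambda>z. z ^ k)"
    using landau_o.big.in_cong by fastforce
next
  assume "f \<in> O[at 0](\<lambda>z. z ^ k)"
  then obtain C where C: "C > 0" "eventually (\<lambda>z. norm (f z) \<le> C * norm (z ^ k)) (at 0)"
    by (elim landau_o.bigE)
  show "k \<le> m"
  proof (rule ccontr)
    assume "\<not> k \<le> m"
    then have k: "k = m + Suc (k - Suc m)" by simp
    have nz: "eventually (\<lambda>z::complex. z \<noteq> 0) (at 0)" by (simp add: eventually_at_filter)
    have bound: "eventually (\<lambda>z. norm (u z) \<le> C * norm (z ^ Suc (k - Suc m))) (at 0)"
      using C(2) f nz
    proof eventually_elim
      case (elim z)
      then have "norm (z ^ m) * norm (u z) \<le> norm (z ^ m) * (C * norm (z ^ Suc (k - Suc m)))"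
        by (subst (asm) k) (simp add: norm_mult norm_power power_add algebra_simps)
      then show ?case using elim(3) by (simp add: mult_le_cancel_left)
    qed
    have "((\<lambda>z::complex. C * norm (z ^ Suc (k - Suc m))) \<longlongrightarrow> C * norm ((0::complex) ^ Suc (k - Suc m))) (at 0)"
      by (intro tendsto_mult tendsto_const tendsto_norm tendsto_power tendsto_ident_at)
    then have "((\<lambda>z::complex. C * norm (z ^ Suc (k - Suc m))) \<longlongrightarrow> 0) (at 0)" by simp
    from Lim_null_comparison[OF bound this] have "c = 0" using u(1) LIM_unique by blast
    then show False using u(2) by simp
  qed
qed

section \<open>The branch lies in \<open>X\<close> and is Zariski dense in it\<close>

locale curve_branch = curve_germ +
  fixes \<gamma> :: "complex \<Rightarrow> complex ^ 'a" and r \<delta> :: real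
  assumes branch: "branch \<gamma> r \<delta>"
begin

lemma r_pos: "0 < r" and \<delta>_pos: "0 < \<delta>" and \<gamma>_0: "\<gamma> 0 = a"
  and \<gamma>_holo: "(\<lambda>\<tau>. \<gamma> \<tau> $ i) holomorphic_on ball 0 r"
  and \<gamma>_zeros: "\<tau> \<in> ball 0 r \<Longrightarrow> \<gamma> \<tau> \<in> zeros"
  and \<gamma>_a: "\<tau> \<in> ball 0 r \<Longrightarrow> cdot a (\<gamma> \<tau>) = 1" and \<gamma>_b: "\<tau> \<in> ball 0 r \<Longrightarrow> cdot b (\<gamma> \<tau>) = \<tau>"
  and \<gamma>_real: "\<tau> \<in> ball 0 r \<Longrightarrow> \<tau> \<in> \<real> \<Longrightarrow> conj_vec (\<gamma> \<tau>) = \<gamma> \<tau>"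
  and \<gamma>_local: "x \<in> zeros \<Longrightarrow> cdot a x = 1 \<Longrightarrow> dist x a < \<delta> \<Longrightarrow> cdot b x \<in> ball 0 r \<and> x = \<gamma> (cdot b x)"
  using branch by (auto simp: branch_def)

lemma \<gamma>_nz: "\<tau> \<in> ball 0 r \<Longrightarrow> \<gamma> \<tau> \<noteq> 0"
  using \<gamma>_a by fastforce

lemma hpoly_\<gamma>: "hpoly d f \<Longrightarrow> (\<lambda>\<tau>. f (\<gamma> \<tau>)) holomorphic_on ball 0 r"
proof (induction rule: hpoly.induct)
  case (hpoly_const c)
  show ?case by (rule holomorphic_on_const)
next
  case (hpoly_coord i)
  show ?case by (rule \<gamma>_holo)
next
  case (hpoly_add d f g)
  then show ?case by (intro holomorphic_on_add)
next
  case (hpoly_mult d f e g)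
  then show ?case by (intro holomorphic_on_mult)
qed

lemma eventually_ball: "eventually (\<lambda>\<tau>. \<tau> \<in> ball 0 r) (at (0::complex))"
  by (rule at_0_ball[OF r_pos])

lemma tendsto_\<gamma>: assumes "hpoly d f" shows "((\<lambda>\<tau>. f (\<gamma> \<tau>)) \<longlongrightarrow> f a) (at 0)"
proof -
  have "continuous_on (ball 0 r) (\<lambda>\<tau>. f (\<gamma> \<tau>))"
    by (rule holomorphic_on_imp_continuous_on[OF hpoly_\<gamma>[OF assms]])
  then have "isCont (\<lambda>\<tau>. f (\<gamma> \<tau>)) 0" using r_pos by (simp add: continuous_on_eq_continuous_at)
  then show ?thesis by (simp add: isCont_def \<gamma>_0)
qed

text \<open>The local ring behaves like a discrete valuation ring: the uniformizer can be split off
  again as long as the quotient vanishes at \<open>a\<close>. The units \<open>S\<close> of the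
  single steps multiply up.\<close>

lemma hpoly_divide_power:
  assumes f: "hpoly d f" and "(\<lambda>\<tau>. f (\<gamma> \<tau>)) \<in> O[at 0](\<lambda>\<tau>. \<tau> ^ k)"
  shows "\<exists>M m S G. hpoly M S \<and> S a = 1 \<and> hpoly m G \<and> (\<forall>x\<in>zeros. S x * f x = cdot b x ^ k * G x)"
  using assms(2)
proof (induction k)
  case 0
  show ?case using f by (intro exI[of _ 0] exI[of _ d] exI[of _ "\<lambda>x. 1"] exI[of _ f]) (auto intro: hpoly_const)
next
  case (Suc k)
  have "(\<lambda>\<tau>::complex. \<tau> ^ Suc k) \<in> O[at 0](\<lambda>\<tau>. \<tau> ^ k)"
    by (subst monomial_bigo_iff[where u = "\<lambda>_. 1" and c = 1 and m = "Suc k"]) auto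
  then have "(\<lambda>\<tau>. f (\<gamma> \<tau>)) \<in> O[at 0](\<lambda>\<tau>. \<tau> ^ k)"
    using Suc.prems landau_o.big_trans by blast
  then obtain M m S G where SG: "hpoly M S" "S a = 1" "hpoly m G"
    "\<And>x. x \<in> zeros \<Longrightarrow> S x * f x = cdot b x ^ k * G x" using Suc.IH by blast
  \<comment> \<open>Otherwise the product \<open>S * f\<close> would have order exactly
    \<open>k\<close> along the branch, against the bound of order \<open>Suc k\<close>.\<close>
  have "G a = 0"
  proof (rule ccontr)
    assume "G a \<noteq> 0"
    have S1: "(\<lambda>\<tau>. S (\<gamma> \<tau>)) \<in> O[at 0](\<lambda>\<tau>. 1)"
      using tendsto_\<gamma>[OF SG(1)] by (intro bigoI_tendsto[of _ _ "S a"]) auto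
    have "(\<lambda>\<tau>. S (\<gamma> \<tau>) * f (\<gamma> \<tau>)) \<in> O[at 0](\<lambda>\<tau>. \<tau> ^ Suc k)"
      using landau_o.big.mult[OF S1 Suc.prems] by simp
    moreover have "eventually (\<lambda>\<tau>. S (\<gamma> \<tau>) * f (\<gamma> \<tau>) = \<tau> ^ k * G (\<gamma> \<tau>)) (at 0)"
      using eventually_ball by eventually_elim (simp only: SG(4)[OF \<gamma>_zeros] \<gamma>_b)
    ultimately show False
      using monomial_bigo_iff[OF tendsto_\<gamma>[OF SG(3)] \<open>G a \<noteq> 0\<close>, of _ k "Suc k"] by auto
  qed
  then obtain M' m' S' G' where SG': "hpoly M' S'" "S' a = 1" "hpoly m' G'"
    "\<And>x. x \<in> zeros \<Longrightarrow> S' x * G x = cdot b x * G' x" using uniformizer_divides[OF SG(3)] by blast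
  have "S' x * S x * f x = cdot b x ^ Suc k * G' x" if "x \<in> zeros" for x
  proof -
    have "S' x * S x * f x = cdot b x ^ k * (S' x * G x)" using SG(4)[OF that] by simp
    then show ?thesis using SG'(4)[OF that] by simp
  qed
  then show ?case using SG(1,2) SG'(1-3)
    by (intro exI[of _ "M' + M"] exI[of _ m'] exI[of _ "\<lambda>x. S' x * S x"] exI[of _ G'])
       (auto intro: hpoly_mult)
qed

text \<open>An equation \<open>f\<close> of \<open>X\<close> with finite order along the branch
  would, after division, express 0 on the cone as a power of \<open>cdot b\<close> times a form that
  is nonzero at \<open>a\<close>.\<close>

lemma \<gamma>_cone: assumes \<tau>: "\<tau> \<in> ball 0 r" shows "\<gamma> \<tau> \<in> affine_cone X"
proof -
  obtain F where F: "\<forall>f\<in>F. \<exists>d. hpoly d f" "affine_cone X = {x. \<forall>f\<in>F. f x = 0}"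
    using affine_cone_zeros[OF closed] A_in by blast
  have "f (\<gamma> \<tau>) = 0" if f: "f \<in> F" for f
  proof -
    obtain d where d: "hpoly d f" using F(1) f by blast
    have fX: "f x = 0" if "x \<in> affine_cone X" for x using F(2) f that by blast
    show ?thesis
    proof (rule holomorphic_zero_or_order[OF hpoly_\<gamma>[OF d] r_pos])
      assume "\<And>z. z \<in> ball 0 r \<Longrightarrow> f (\<gamma> z) = 0"
      then show ?thesis using \<tau> by blast
    next
      fix m g \<rho> assume g: "0 < \<rho>" "\<rho> \<le> r" "g holomorphic_on ball 0 \<rho>"
        "\<And>z. z \<in> ball 0 \<rho> \<Longrightarrow> f (\<gamma> z) = z ^ m * g z" "\<And>z. z \<in> ball 0 \<rho> \<Longrightarrow> g z \<noteq> 0"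
      have "continuous_on (ball 0 \<rho>) g" using g(3) holomorphic_on_imp_continuous_on by blast
      then have glim: "(g \<longlongrightarrow> g 0) (at 0)" using g(1)
        by (simp add: continuous_on_eq_continuous_at isCont_def)
      have ev: "eventually (\<lambda>z. f (\<gamma> z) = z ^ m * g z) (at 0)"
        using at_0_ball[OF g(1)] by eventually_elim (rule g(4))
      have g0: "g 0 \<noteq> 0" using g(1,5) by simp
      from hpoly_divide_power[OF d, of m] monomial_bigo_iff[OF glim g0 ev, of m]
      obtain M n S G where SG: "hpoly M S" "S a = 1" "hpoly n G"
        "\<And>x. x \<in> zeros \<Longrightarrow> S x * f x = cdot b x ^ m * G x" by blast
      \<comment> \<open>Cancelling the power of the parameter identifies \<open>G a\<close> with the
        limit \<open>S a * g 0\<close>, and \<open>g 0\<close> is nonzero because \<open>m\<close>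
        is the exact order.\<close>
      have "G a \<noteq> 0"
      proof
        assume "G a = 0"
        have "eventually (\<lambda>z. z \<noteq> 0) (at (0::complex))" by (simp add: eventually_at_filter)
        then have "eventually (\<lambda>z. S (\<gamma> z) * g z = G (\<gamma> z)) (at 0)"
          using ev eventually_ball
        proof eventually_elim
          case (elim z)
          then have "z ^ m * (S (\<gamma> z) * g z) = z ^ m * G (\<gamma> z)"
            using SG(4)[OF \<gamma>_zeros[OF elim(3)]] \<gamma>_b[OF elim(3)] by simp
          then show ?case using elim(1) by simp
        qed
        then have "((\<lambda>z. S (\<gamma> z) * g z) \<longlongrightarrow> G a) (at 0)"
          using tendsto_\<gamma>[OF SG(3)] by (simp cong: tendsto_cong)
        moreover have "((\<lambda>z. S (\<gamma> z) * g z) \<longlongrightarrow> S a * g 0) (at 0)"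
          by (intro tendsto_mult tendsto_\<gamma>[OF SG(1)] glim)
        ultimately show False using LIM_unique g0 \<open>G a = 0\<close> SG(2) by force
      qed
      have prod: "cdot b x ^ m * G x = 0" if "x \<in> affine_cone X" for x
        using SG(4)[of x] fX[OF that] cone_zeros that by auto
      have "(\<forall>x\<in>affine_cone X. cdot b x ^ m = 0) \<or> (\<forall>x\<in>affine_cone X. G x = 0)"
        by (rule irreducible_hpoly_mult[OF irreducible hpoly_pow_cdot SG(3) prod])
      then show ?thesis using \<open>G a \<noteq> 0\<close> a_cone uniformizer_nonzero by auto
    qed
  qed
  then show ?thesis using F(2) by blast
qed

text \<open>The closure of the branch is an irreducible subset of \<open>X\<close> with more than one point, so it
  is all of \<open>X\<close>.\<close>

lemma identity_theorem:
  assumes f: "hpoly d f" and f0: "\<And>\<tau>. \<tau> \<in> ball 0 r \<Longrightarrow> f (\<gamma> \<tau>) = 0"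
    and x: "x \<in> affine_cone X"
  shows "f x = 0"
proof -
  \<comment> \<open>\<open>I\<close> collects the forms vanishing on the branch, so \<open>Z\<close>
    is the Zariski closure of the branch.\<close>
  define I where "I = {g. (\<exists>d. hpoly d g) \<and> (\<forall>\<tau>\<in>ball 0 r. g (\<gamma> \<tau>) = 0)}"
  define Z where "Z = {B. \<forall>g\<in>I. \<forall>y\<in>line B. g y = 0}"
  have \<gamma>Z: "proj_pt (\<gamma> \<tau>) \<in> Z" if "\<tau> \<in> ball 0 r" for \<tau>
    using hpoly_zero_on_line[OF _ in_line_proj_pt[OF \<gamma>_nz[OF that]] \<gamma>_nz[OF that]] that
    by (auto simp: Z_def I_def)
  have clZ: "zariski_closed Z"
    unfolding zariski_closed_iff Z_def by (rule exI[of _ I]) (auto simp: I_def)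
  have subI: "g \<in> I" if "hpoly k g" "\<And>\<tau>. \<tau> \<in> ball 0 r \<Longrightarrow> g (\<gamma> \<tau>) = 0" for g k
    using that by (auto simp: I_def)
  have irrZ: "zariski_irreducible Z"
    unfolding zariski_irreducible_def
  proof (intro conjI allI impI)
    show "Z \<noteq> {}" using \<gamma>Z[of 0] r_pos by auto
  next
    fix V W assume VW: "zariski_closed V \<and> zariski_closed W \<and> Z \<subseteq> V \<union> W"
    obtain F where F: "\<forall>g\<in>F. \<exists>d. hpoly d g" "V = {B. \<forall>g\<in>F. \<forall>y\<in>line B. g y = 0}"
      using VW unfolding zariski_closed_iff by blast
    obtain H where H: "\<forall>g\<in>H. \<exists>d. hpoly d g" "W = {B. \<forall>g\<in>H. \<forall>y\<in>line B. g y = 0}"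
      using VW unfolding zariski_closed_iff by blast
    show "Z \<subseteq> V \<or> Z \<subseteq> W"
    proof (rule ccontr)
      assume "\<not> ?thesis"
      then have "\<not> F \<subseteq> I" "\<not> H \<subseteq> I" using F(2) H(2) by (auto simp: Z_def)
      then obtain g h where gh: "g \<in> F" "g \<notin> I" "h \<in> H" "h \<notin> I" by blast
      then obtain k l where kl: "hpoly k g" "hpoly l h" using F(1) H(1) by blast
      have prod: "g (\<gamma> \<tau>) * h (\<gamma> \<tau>) = 0" if "\<tau> \<in> ball 0 r" for \<tau>
        using \<gamma>Z[OF that] VW F(2) H(2) gh in_line_proj_pt[OF \<gamma>_nz[OF that]] by auto
      show False
      proof (rule holomorphic_zero_or_order[OF hpoly_\<gamma>[OF kl(1)] r_pos])
        assume "\<And>z. z \<in> ball 0 r \<Longrightarrow> g (\<gamma> z) = 0"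
        then show False using subI[OF kl(1)] gh by blast
      next
        fix m u \<rho> assume u: "0 < \<rho>" "\<rho> \<le> r"
          "\<And>z. z \<in> ball 0 \<rho> \<Longrightarrow> g (\<gamma> z) = z ^ m * u z" "\<And>z. z \<in> ball 0 \<rho> \<Longrightarrow> u z \<noteq> 0"
        show False
        proof (rule holomorphic_zero_or_order[OF hpoly_\<gamma>[OF kl(2)] r_pos])
          assume "\<And>z. z \<in> ball 0 r \<Longrightarrow> h (\<gamma> z) = 0"
          then show False using subI[OF kl(2)] gh by blast
        next
          fix n v \<sigma> assume v: "0 < \<sigma>" "\<sigma> \<le> r"
            "\<And>z. z \<in> ball 0 \<sigma> \<Longrightarrow> h (\<gamma> z) = z ^ n * v z" "\<And>z. z \<in> ball 0 \<sigma> \<Longrightarrow> v z \<noteq> 0"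
          \<comment> \<open>A nonzero parameter common to both balls: there neither pullback
            vanishes, although their product does.\<close>
          define z where "z = complex_of_real (min \<rho> \<sigma> / 2)"
          have "z \<in> ball 0 \<rho>" "z \<in> ball 0 \<sigma>" "z \<in> ball 0 r" "z \<noteq> 0"
            using u(1,2) v(1,2) by (auto simp: z_def)
          then show False using prod[of z] u(3,4) v(3,4) by simp
        qed
      qed
    qed
  qed
  have ZX: "Z \<subseteq> X"
  proof -
    obtain F where F: "\<forall>g\<in>F. \<exists>d. hpoly d g" "X = {B. \<forall>g\<in>F. \<forall>y\<in>line B. g y = 0}"
      using closed unfolding zariski_closed_iff by blast
    have "g \<in> I" if g: "g \<in> F" for g
    proof -
      obtain k where k: "hpoly k g" using F(1) g by blast
      have "g (\<gamma> \<tau>) = 0" if "\<tau> \<in> ball 0 r" for \<tau>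
      proof -
        have "proj_pt (\<gamma> \<tau>) \<in> X" using \<gamma>_cone[OF that] in_cone_iff[OF \<gamma>_nz[OF that]] by simp
        then show ?thesis using F(2) g in_line_proj_pt[OF \<gamma>_nz[OF that]] by simp
      qed
      then show ?thesis using subI[OF k] by blast
    qed
    then show ?thesis using F(2) by (auto simp: Z_def)
  qed
  have AZ: "A \<in> Z" using \<gamma>Z[of 0] r_pos \<gamma>_0 proj_pt_eq[OF a_line a_nz] by simp
  have ZA: "Z \<noteq> {A}"
  proof
    assume Z: "Z = {A}"
    \<comment> \<open>Any nonzero parameter gives a second point of \<open>Z\<close>, since
      \<open>cdot b\<close> is zero on the line of \<open>A\<close> but equals the parameter on the
      branch.\<close>
    define z where "z = complex_of_real (r / 2)"
    have z: "z \<in> ball 0 r" "z \<noteq> 0" using r_pos by (auto simp: z_def)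
    have "proj_pt (\<gamma> z) = A" using \<gamma>Z[OF z(1)] Z by simp
    then have "\<gamma> z \<in> line A" using in_line_proj_pt[OF \<gamma>_nz[OF z(1)]] by simp
    then obtain c where "\<gamma> z = c *s a" using line_eq[OF a_line a_nz] by blast
    then show False using \<gamma>_b[OF z(1)] z(2) by (simp add: cdot_scale_right ba)
  qed
  have "Z = X"
  proof (rule ccontr)
    assume "Z \<noteq> X"
    with ZX have "Z \<subset> X" by blast
    from curve_no_chain[OF dim closed irreducible clZ irrZ this AZ] show False using ZA by blast
  qed
  moreover have "f \<in> I" using subI[OF f] f0 by blast
  moreover obtain B where "B \<in> X" "x \<in> line B" using x by (auto simp: affine_cone_def)
  ultimately show ?thesis by (auto simp: Z_def)
qed

end

section \<open>Orders of vanishing at real points\<close>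

lemma Re_of_real_mult: "Re (complex_of_real c * z) = c * Re z"
  by simp

lemma R2_hpoly:
  assumes "q \<in> R2 X"
  obtains f where "real_quadratic_form f" "q = restrict_form X f" "hpoly 2 (eval_mpoly f)"
    "\<And>x. x \<in> affine_cone X \<Longrightarrow> q x = eval_mpoly f x"
  using assms that
  by (auto simp: R2_def restrict_form_def real_quadratic_form_def intro: homogeneous_imp_hpoly)

lemma R2_outside: "q \<in> R2 X \<Longrightarrow> x \<notin> affine_cone X \<Longrightarrow> q x = 0"
  by (auto simp: R2_def restrict_form_def)

lemma R2_scale:
  assumes "q \<in> R2 X" "x \<in> affine_cone X" shows "q (c *s x) = c\<^sup>2 * q x"
proof -
  obtain f where "hpoly 2 (eval_mpoly f)" "\<And>x. x \<in> affine_cone X \<Longrightarrow> q x = eval_mpoly f x"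
    using R2_hpoly[OF assms(1)] by metis
  then show ?thesis using assms(2) cone_scale[OF assms(2)] by (simp add: hpoly_scale)
qed

lemma R2_real:
  assumes "q \<in> R2 X" "conj_vec x = x" shows "q x \<in> \<real>"
proof (cases "x \<in> affine_cone X")
  case True
  obtain f where f: "real_quadratic_form f" "q x = eval_mpoly f x"
    using R2_hpoly[OF assms(1)] True by metis
  show ?thesis unfolding f(2) eval_mpoly_def
    using f(1) assms(2) by (intro sum_in_Reals Reals_mult prod_in_Reals Reals_power)
      (auto simp: real_quadratic_form_def real_mpoly_def conj_vec_real_iff)
qed (simp add: R2_outside[OF assms(1)])

lemma R2_eq_0_iff: "q \<in> R2 X \<Longrightarrow> q = 0 \<longleftrightarrow> (\<forall>x\<in>affine_cone X. q x = 0)"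
  using R2_outside by (auto simp: fun_eq_iff)

lemma P2_R2: "q \<in> P2 X \<Longrightarrow> q \<in> R2 X"
  by (simp add: P2_def)

lemma P2_nonneg:
  assumes "q \<in> P2 X" "x \<in> affine_cone X" "conj_vec x = x" "x \<noteq> 0"
  shows "0 \<le> Re (q x)"
proof -
  obtain B where B: "B \<in> X" "x \<in> line B" using assms(2) by (auto simp: affine_cone_def)
  then have "B \<in> real_points X" using real_pt_iff[OF B(2)] assms by (simp add: real_points_def)
  then show ?thesis using assms B by (auto simp: P2_def conj_vec_real_iff)
qed

text \<open>Rescaling a real vector by a real factor multiplies a quadratic form by a square, so
  signs can be tested on unit vectors.\<close>

lemma P2_I:
  assumes "q \<in> R2 X"
    and "\<And>x. x \<in> affine_cone X \<Longrightarrow> conj_vec x = x \<Longrightarrow> norm x = 1 \<Longrightarrow> 0 \<le> Re (q x)"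
  shows "q \<in> P2 X"
proof -
  have "0 \<le> Re (q x)" if x: "B \<in> real_points X" "x \<in> line B" "\<forall>i. x $ i \<in> \<real>" for B x
  proof -
    have xc: "x \<in> affine_cone X" using x by (auto simp: real_points_def cone_line)
    have conj: "conj_vec x = x" using x(3) by (simp add: conj_vec_real_iff)
    show ?thesis
    proof (cases "x = 0")
      case True
      then show ?thesis using R2_scale[OF assms(1) xc, of 0] by simp
    next
      case False
      define c where "c = norm x"
      have c: "c > 0" using False by (simp add: c_def)
      let ?y = "complex_of_real (1 / c) *s x"
      have "?y = (1 / c) *\<^sub>R x" by (simp add: vec_eq_iff complex_eq_iff)
      then have "norm ?y = 1" using c by (simp add: c_def)
      moreover have "conj_vec ?y = ?y" by (simp add: conj_vec_scale conj)
      ultimately have "0 \<le> Re (q ?y)" using assms(2) cone_scale[OF xc] by blast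
      also have "q ?y = complex_of_real ((1 / c)\<^sup>2) * q x" using R2_scale[OF assms(1) xc] by simp
      finally have "0 \<le> (1 / c)\<^sup>2 * Re (q x)" by (simp only: Re_of_real_mult)
      then show ?thesis using c by (simp add: zero_le_mult_iff)
    qed
  qed
  then show ?thesis using assms(1) by (auto simp: P2_def)
qed

lemma power_in_ideal_power:
  "t \<in> I \<Longrightarrow> t ^ k * g \<in> ideal_power I k" for t g :: "'b::comm_ring_1"
proof (induction k)
  case (Suc k)
  then have "t ^ Suc k * g = (\<Sum>i<(1::nat). t * (t ^ k * g)) \<and> (\<forall>i<(1::nat). t \<in> I \<and> t ^ k * g \<in> ideal_power I k)"
    by (simp add: mult.assoc)
  then show ?case unfolding ideal_power.simps ideal_mult_def
    by (intro CollectI exI[of _ 1] exI[of _ "\<lambda>_. t"] exI[of _ "\<lambda>_. t ^ k * g"])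
qed simp

lemma eval_mpoly_power: "eval_mpoly (t ^ k) x = eval_mpoly t x ^ k"
proof (induction k)
  case 0
  show ?case using eval_mpoly_single[of 0 1 x] by simp
qed (simp add: eval_mpoly_mult)

lemma of_real_tendsto:
  assumes "continuous_on (ball 0 \<rho>) g" "0 < \<rho>"
  shows "((\<lambda>t. g (complex_of_real t)) \<longlongrightarrow> g 0) (at 0)"
proof -
  have "isCont g 0" using assms by (simp add: continuous_on_eq_continuous_at)
  moreover have "isCont complex_of_real 0" by (intro continuous_intros)
  ultimately have "isCont (\<lambda>t. g (complex_of_real t)) 0"
    using isCont_o2[of 0 complex_of_real g] by simp
  then show ?thesis by (simp add: isCont_def)
qed

section \<open>The order at \<open>A\<close> is the order along the branch\<close>

context curve_branch
begin

lemma eval_mpoly_\<gamma>_holo: "(\<lambda>\<tau>. eval_mpoly w (\<gamma> \<tau>)) holomorphic_on ball 0 r"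
proof -
  obtain N f where f: "\<forall>d. hpoly d (f d)" "\<forall>x. eval_mpoly w x = (\<Sum>d\<le>N. f d x)"
    using eval_mpoly_homogeneous_components by blast
  show ?thesis unfolding f(2)[rule_format] using hpoly_\<gamma> f(1) by (intro holomorphic_on_sum) blast
qed

lemma eval_mpoly_\<gamma>_deriv: "\<exists>D. ((\<lambda>\<tau>. eval_mpoly w (\<gamma> \<tau>)) has_field_derivative D) (at 0)"
  using holomorphic_derivI[OF eval_mpoly_\<gamma>_holo open_ball] r_pos by (meson centre_in_ball)

lemma eval_mpoly_\<gamma>_bounded: "(\<lambda>\<tau>. eval_mpoly w (\<gamma> \<tau>)) \<in> O[at 0](\<lambda>\<tau>. 1)"
proof -
  have "isCont (\<lambda>\<tau>. eval_mpoly w (\<gamma> \<tau>)) 0" using eval_mpoly_\<gamma>_deriv DERIV_isCont by blast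
  then show ?thesis by (intro bigoI_tendsto[where c = "eval_mpoly w (\<gamma> 0)"]) (auto simp: isCont_def)
qed

lemma vanishing_\<gamma>_bigo:
  assumes "w \<in> vanishing_ideal {A}" shows "(\<lambda>\<tau>. eval_mpoly w (\<gamma> \<tau>)) \<in> O[at 0](\<lambda>\<tau>. \<tau>)"
proof -
  obtain D where "((\<lambda>\<tau>. eval_mpoly w (\<gamma> \<tau>)) has_field_derivative D) (at 0)"
    using eval_mpoly_\<gamma>_deriv by blast
  moreover have "eval_mpoly w (\<gamma> 0) = 0"
    using assms a_line by (simp add: \<gamma>_0 vanishing_ideal_def vanishes_at_def)
  ultimately have "((\<lambda>\<tau>. eval_mpoly w (\<gamma> \<tau>) / \<tau>) \<longlongrightarrow> D) (at 0)"
    by (simp add: DERIV_def)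
  then show ?thesis by (rule bigoI_tendsto) (simp add: eventually_at_filter)
qed

text \<open>Each factor from the ideal of \<open>A\<close> is differentiable along the branch and
  zero at its centre, so it contributes one power of the parameter.\<close>

lemma ideal_power_bigo:
  "g \<in> ideal_power (vanishing_ideal {A}) k \<Longrightarrow> (\<lambda>\<tau>. eval_mpoly g (\<gamma> \<tau>)) \<in> O[at 0](\<lambda>\<tau>. \<tau> ^ k)"
proof (induction k arbitrary: g)
  case 0
  then show ?case using eval_mpoly_\<gamma>_bounded by simp
next
  case (Suc k)
  then obtain n f h where g: "g = (\<Sum>i<(n::nat). f i * h i)"
    "\<forall>i<n. f i \<in> vanishing_ideal {A} \<and> h i \<in> ideal_power (vanishing_ideal {A}) k"
    by (auto simp: ideal_mult_def)
  have "(\<lambda>\<tau>. eval_mpoly (f i) (\<gamma> \<tau>) * eval_mpoly (h i) (\<gamma> \<tau>)) \<in> O[at 0](\<lambda>\<tau>. \<tau> * \<tau> ^ k)" if "i < n" for i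
    using g(2) that by (intro landau_o.big.mult vanishing_\<gamma>_bigo Suc.IH) auto
  then have "(\<lambda>\<tau>. \<Sum>i<n. eval_mpoly (f i) (\<gamma> \<tau>) * eval_mpoly (h i) (\<gamma> \<tau>)) \<in> O[at 0](\<lambda>\<tau>. \<tau> * \<tau> ^ k)"
    by (intro big_sum_in_bigo) auto
  then show ?case by (simp add: g(1) eval_mpoly_sum eval_mpoly_mult)
qed

text \<open>From left to right, \<open>s\<close> is invertible near \<open>a\<close> and
  \<open>h\<close> vanishes on the branch. Conversely, \<open>hpoly_divide_power\<close> writes a
  multiple of the form as \<open>cdot b ^ k * G\<close>, and \<open>cdot b\<close> lies in the ideal
  of \<open>A\<close>.\<close>

lemma vanishes_to_order_iff:
  assumes q: "q \<in> R2 X"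
  shows "vanishes_to_order X A k q \<longleftrightarrow> (\<lambda>\<tau>. q (\<gamma> \<tau>)) \<in> O[at 0](\<lambda>\<tau>. \<tau> ^ k)"
proof
  assume "vanishes_to_order X A k q"
  then obtain f s d g h where f: "q = restrict_form X f" and s: "homogeneous d s" "\<not> vanishes_at s A"
    and g: "g \<in> ideal_power (vanishing_ideal {A}) k" and h: "h \<in> vanishing_ideal X" and eq: "s * f = g + h"
    unfolding vanishes_to_order_def by blast
  have hs: "hpoly d (eval_mpoly s)" by (rule homogeneous_imp_hpoly[OF s(1)])
  have sa: "eval_mpoly s a \<noteq> 0"
    using s(2) hpoly_zero_on_line[OF hs a_line a_nz] by (auto simp: vanishes_at_def)
  have "((\<lambda>\<tau>. inverse (eval_mpoly s (\<gamma> \<tau>))) \<longlongrightarrow> inverse (eval_mpoly s a)) (at 0)"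
    by (intro tendsto_inverse tendsto_\<gamma>[OF hs] sa)
  then have "(\<lambda>\<tau>. inverse (eval_mpoly s (\<gamma> \<tau>))) \<in> O[at 0](\<lambda>\<tau>. 1)"
    by (intro bigoI_tendsto) auto
  from landau_o.big.mult[OF this ideal_power_bigo[OF g]]
  have "(\<lambda>\<tau>. inverse (eval_mpoly s (\<gamma> \<tau>)) * eval_mpoly g (\<gamma> \<tau>)) \<in> O[at 0](\<lambda>\<tau>. \<tau> ^ k)" by simp
  moreover have "eventually (\<lambda>\<tau>. eval_mpoly s (\<gamma> \<tau>) \<noteq> 0) (at 0)"
    using tendsto_imp_eventually_ne[OF tendsto_\<gamma>[OF hs] sa] .
  then have "eventually (\<lambda>\<tau>. q (\<gamma> \<tau>) = inverse (eval_mpoly s (\<gamma> \<tau>)) * eval_mpoly g (\<gamma> \<tau>)) (at 0)"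
    using eventually_ball
  proof eventually_elim
    case (elim \<tau>)
    have "eval_mpoly h (\<gamma> \<tau>) = 0" using h \<gamma>_cone[OF elim(2)] by (simp add: vanishing_ideal_iff)
    then have "eval_mpoly s (\<gamma> \<tau>) * eval_mpoly f (\<gamma> \<tau>) = eval_mpoly g (\<gamma> \<tau>)"
      using arg_cong[OF eq, of "\<lambda>w. eval_mpoly w (\<gamma> \<tau>)"] by (simp add: eval_mpoly_mult eval_mpoly_add)
    moreover have "q (\<gamma> \<tau>) = eval_mpoly f (\<gamma> \<tau>)" using f \<gamma>_cone[OF elim(2)] by (simp add: restrict_form_def)
    ultimately show ?case using elim(1) by (simp add: field_simps)
  qed
  ultimately show "(\<lambda>\<tau>. q (\<gamma> \<tau>)) \<in> O[at 0](\<lambda>\<tau>. \<tau> ^ k)"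
    using landau_o.big.in_cong by fastforce
next
  assume big: "(\<lambda>\<tau>. q (\<gamma> \<tau>)) \<in> O[at 0](\<lambda>\<tau>. \<tau> ^ k)"
  obtain f where f: "real_quadratic_form f" "q = restrict_form X f" "hpoly 2 (eval_mpoly f)"
    "\<And>x. x \<in> affine_cone X \<Longrightarrow> q x = eval_mpoly f x" using R2_hpoly[OF q] by metis
  have "eventually (\<lambda>\<tau>. q (\<gamma> \<tau>) = eval_mpoly f (\<gamma> \<tau>)) (at 0)"
    using eventually_ball by eventually_elim (simp add: f(4) \<gamma>_cone)
  with big have "(\<lambda>\<tau>. eval_mpoly f (\<gamma> \<tau>)) \<in> O[at 0](\<lambda>\<tau>. \<tau> ^ k)"
    using landau_o.big.in_cong by fastforce
  from hpoly_divide_power[OF f(3) this] obtain M m S G where SG: "hpoly M S" "S a = 1" "hpoly m G"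
    "\<And>x. x \<in> zeros \<Longrightarrow> S x * eval_mpoly f x = cdot b x ^ k * G x" by blast
  obtain s where s: "homogeneous M s" "eval_mpoly s = S" using SG(1) by (auto simp: hpoly_iff)
  obtain g where g: "eval_mpoly g = G" using SG(3) by (auto simp: hpoly_iff)
  obtain t where t: "eval_mpoly t = cdot b" using hpoly_cdot by (auto simp: hpoly_iff)
  have "t \<in> vanishing_ideal {A}"
    using line_eq[OF a_line a_nz] by (auto simp: vanishing_ideal_def vanishes_at_def t cdot_scale_right ba)
  then have "t ^ k * g \<in> ideal_power (vanishing_ideal {A}) k" by (rule power_in_ideal_power)
  moreover have "s * f - t ^ k * g \<in> vanishing_ideal X"
    using SG(4) cone_zeros
    by (auto simp: vanishing_ideal_iff eval_mpoly_diff eval_mpoly_mult eval_mpoly_power s g t)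
  moreover have "\<not> vanishes_at s A" 
    using SG(2) a_line unfolding s(2)[symmetric] vanishes_at_def by (metis zero_neq_one)
  ultimately show "vanishes_to_order X A k q"
    unfolding vanishes_to_order_def using f(1,2) s(1)
    by (intro exI[of _ f] conjI exI[of _ s] exI[of _ M] bexI[of _ "t ^ k * g"] bexI[of _ "s * f - t ^ k * g"]) auto
qed

text \<open>Shows that the \<open>GREATEST\<close> in \<open>order_at\<close> is attained: a form of
  infinite order along the branch is zero on \<open>X\<close> by
  \<open>identity_theorem\<close>.\<close>

lemma order_expansion:
  assumes q: "q \<in> R2 X" "q \<noteq> 0"
  obtains \<rho> g where "0 < \<rho>" "\<rho> \<le> r" "continuous_on (ball 0 \<rho>) g"
    "\<And>z. z \<in> ball 0 \<rho> \<Longrightarrow> q (\<gamma> z) = z ^ order_at X A q * g z" "\<And>z. z \<in> ball 0 \<rho> \<Longrightarrow> g z \<noteq> 0"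
proof -
  obtain f where f: "hpoly 2 (eval_mpoly f)" "\<And>x. x \<in> affine_cone X \<Longrightarrow> q x = eval_mpoly f x"
    using R2_hpoly[OF q(1)] by metis
  show thesis
  proof (rule holomorphic_zero_or_order[OF hpoly_\<gamma>[OF f(1)] r_pos])
    assume *: "\<And>z. z \<in> ball 0 r \<Longrightarrow> eval_mpoly f (\<gamma> z) = 0"
    have "q x = 0" if "x \<in> affine_cone X" for x
      using identity_theorem[OF f(1) * that] f(2)[OF that] by simp
    then show thesis using q R2_eq_0_iff[OF q(1)] by blast
  next
    fix m g \<rho> assume g: "0 < \<rho>" "\<rho> \<le> r" "g holomorphic_on ball 0 \<rho>"
      "\<And>z. z \<in> ball 0 \<rho> \<Longrightarrow> eval_mpoly f (\<gamma> z) = z ^ m * g z" "\<And>z. z \<in> ball 0 \<rho> \<Longrightarrow> g z \<noteq> 0"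
    have eq: "q (\<gamma> z) = z ^ m * g z" if "z \<in> ball 0 \<rho>" for z
      using g(2,4) that f(2)[OF \<gamma>_cone] by auto
    have cont: "continuous_on (ball 0 \<rho>) g" using g(3) holomorphic_on_imp_continuous_on by blast
    then have glim: "(g \<longlongrightarrow> g 0) (at 0)" using g(1)
      by (simp add: continuous_on_eq_continuous_at isCont_def)
    have "eventually (\<lambda>z. q (\<gamma> z) = z ^ m * g z) (at 0)"
      using at_0_ball[OF g(1)] by eventually_elim (rule eq)
    then have "vanishes_to_order X A k q \<longleftrightarrow> k \<le> m" for k
      unfolding vanishes_to_order_iff[OF q(1)] using g(1,5) by (intro monomial_bigo_iff[OF glim]) auto
    then have "order_at X A q = m"
      unfolding order_at_def by (intro Greatest_equality) auto
    then show thesis using that[OF g(1,2) cont] eq g(5) by blast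
  qed
qed

lemma order_nonzero_imp_zero:
  assumes "q \<in> R2 X" "q \<noteq> 0" "order_at X A q \<noteq> 0" "y \<in> line A"
  shows "q y = 0"
proof -
  obtain \<rho> g where g: "0 < \<rho>" "\<And>z. z \<in> ball 0 \<rho> \<Longrightarrow> q (\<gamma> z) = z ^ order_at X A q * g z"
    using order_expansion[OF assms(1,2)] by metis
  have "q a = 0" using g(2)[of 0] g(1) assms(3) by (simp add: \<gamma>_0)
  then show ?thesis
    using line_eq[OF a_line a_nz] assms(4) R2_scale[OF assms(1) a_cone] by auto
qed

section \<open>Forms on the real branch and near it\<close>

lemma \<gamma>_of_real:
  assumes "\<bar>t\<bar> < r"
  shows "conj_vec (\<gamma> (of_real t)) = \<gamma> (of_real t)" "\<gamma> (of_real t) \<in> affine_cone X" "\<gamma> (of_real t) \<noteq> 0"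
  using assms \<gamma>_real[of "of_real t"] \<gamma>_cone[of "of_real t"] \<gamma>_nz[of "of_real t"] by auto

text \<open>For odd order the power of a real parameter changes sign at 0. Nonnegativity from both
  sides then forces the real leading coefficient \<open>g 0\<close> to be 0.\<close>

lemma even_order:
  assumes q: "q \<in> P2 X" "q \<noteq> 0"
  shows "even (order_at X A q)"
proof (rule ccontr)
  let ?m = "order_at X A q"
  assume odd: "odd ?m"
  obtain \<rho> g where g: "0 < \<rho>" "\<rho> \<le> r" "continuous_on (ball 0 \<rho>) g"
    "\<And>z. z \<in> ball 0 \<rho> \<Longrightarrow> q (\<gamma> z) = z ^ ?m * g z" "\<And>z. z \<in> ball 0 \<rho> \<Longrightarrow> g z \<noteq> 0"
    using order_expansion[OF P2_R2[OF q(1)] q(2)] by metis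
  have val: "g (of_real t) \<in> \<real>" "0 \<le> t ^ ?m * Re (g (of_real t))" if t: "t \<noteq> 0" "\<bar>t\<bar> < \<rho>" for t
  proof -
    note real = \<gamma>_of_real[of t]
    have eq: "q (\<gamma> (of_real t)) = of_real (t ^ ?m) * g (of_real t)" using g(4)[of "of_real t"] t by simp
    have "q (\<gamma> (of_real t)) \<in> \<real>" using R2_real[OF P2_R2[OF q(1)]] real t g(2) by auto
    then have "of_real (t ^ ?m) * g (of_real t) / of_real (t ^ ?m) \<in> \<real>"
      unfolding eq by (intro Reals_divide) auto
    then show "g (of_real t) \<in> \<real>" using t by simp
    have "0 \<le> Re (q (\<gamma> (of_real t)))" using P2_nonneg[OF q(1)] real t g(2) by auto
    then show "0 \<le> t ^ ?m * Re (g (of_real t))" unfolding eq Re_of_real_mult .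
  qed
  have lim: "((\<lambda>t. g (of_real t)) \<longlongrightarrow> g 0) (at (0::real))" by (rule of_real_tendsto[OF g(3,1)])
  have ev: "eventually (\<lambda>t. \<bar>t\<bar> < \<rho> \<and> t \<noteq> 0) (at (0::real))"
    using g(1) unfolding eventually_at by (intro exI[of _ \<rho>]) (auto simp: dist_real_def)
  have "eventually (\<lambda>t. g (of_real t) \<in> \<real>) (at (0::real))"
    using ev by eventually_elim (use val in auto)
  then have "g 0 \<in> \<real>" by (intro Lim_in_closed_set[OF closed_complex_Reals _ _ lim]) auto
  moreover have "Re (g 0) \<ge> 0"
  proof (rule tendsto_lowerbound[OF tendsto_Re[OF tendsto_within_subset[OF lim subset_UNIV[of "{0<..}"]]]])
    show "eventually (\<lambda>t. 0 \<le> Re (g (complex_of_real t))) (at_right 0)"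
      using eventually_at_right_less[of 0] filter_leD[OF at_le[OF subset_UNIV] ev]
    proof eventually_elim
      case (elim t)
      then have "0 < t ^ ?m" "0 \<le> t ^ ?m * Re (g (of_real t))" using val(2)[of t] by auto
      then show ?case by (simp only: zero_le_mult_iff) linarith
    qed
  qed simp
  moreover have "Re (g 0) \<le> 0"
  proof (rule tendsto_upperbound[OF tendsto_Re[OF tendsto_within_subset[OF lim subset_UNIV[of "{..<0}"]]]])
    have "eventually (\<lambda>t::real. t < 0) (at_left 0)" by (simp add: eventually_at_filter)
    then show "eventually (\<lambda>t. Re (g (complex_of_real t)) \<le> 0) (at_left 0)"
      using filter_leD[OF at_le[OF subset_UNIV] ev]
    proof eventually_elim
      case (elim t)
      then have "t ^ ?m < 0" "0 \<le> t ^ ?m * Re (g (of_real t))"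
        using val(2)[of t] odd by (auto simp: odd_power_less_zero)
      then show ?case by (simp only: zero_le_mult_iff) linarith
    qed
  qed simp
  ultimately have "g 0 = 0" by (auto simp: Reals_def)
  then show False using g(1,5) by simp
qed

text \<open>If \<open>w\<close> had the smaller order, cancelling that power in
  \<open>c * norm w \<le> norm q\<close> would leave a positive power of the parameter on the right,
  and the leading coefficient of \<open>w\<close> would be 0.\<close>

lemma order_le_of_dominated:
  assumes w: "w \<in> P2 X" "w \<noteq> 0" and q: "q \<in> P2 X" "q \<noteq> 0" and c: "0 < c" "q - c *\<^sub>R w \<in> P2 X"
  shows "order_at X A q \<le> order_at X A w"
proof (rule ccontr)
  let ?m = "order_at X A q" and ?k = "order_at X A w"
  assume "\<not> ?m \<le> ?k"
  then obtain n where n: "?m = Suc n + ?k" by (metis add.commute add_Suc_right less_natE not_le)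
  obtain \<rho> g where g: "0 < \<rho>" "\<rho> \<le> r" "continuous_on (ball 0 \<rho>) g"
    "\<And>z. z \<in> ball 0 \<rho> \<Longrightarrow> q (\<gamma> z) = z ^ ?m * g z"
    using order_expansion[OF P2_R2[OF q(1)] q(2)] by metis
  obtain \<sigma> h where h: "0 < \<sigma>" "\<sigma> \<le> r" "continuous_on (ball 0 \<sigma>) h"
    "\<And>z. z \<in> ball 0 \<sigma> \<Longrightarrow> w (\<gamma> z) = z ^ ?k * h z" "\<And>z. z \<in> ball 0 \<sigma> \<Longrightarrow> h z \<noteq> 0"
    using order_expansion[OF P2_R2[OF w(1)] w(2)] by metis
  have bound: "norm (h (of_real t)) \<le> norm (of_real t ^ Suc n * g (of_real t)) / c"
    if t: "t \<noteq> 0" "\<bar>t\<bar> < \<rho>" "\<bar>t\<bar> < \<sigma>" for t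
  proof -
    note real = \<gamma>_of_real[of t]
    let ?x = "\<gamma> (of_real t)"
    have "0 \<le> Re ((q - c *\<^sub>R w) ?x)" by (rule P2_nonneg[OF c(2)]) (use real t g(2) in auto)
    moreover have "w ?x \<in> \<real>" "q ?x \<in> \<real>" "0 \<le> Re (w ?x)" "0 \<le> Re (q ?x)"
      using R2_real[OF P2_R2] P2_nonneg w(1) q(1) real t g(2) by auto
    ultimately have "c * norm (w ?x) \<le> norm (q ?x)"
      by (auto simp: scaleR_fun_def in_Reals_norm)
    then have "norm (of_real t ^ ?k * h (of_real t)) \<le> norm (of_real t ^ ?m * g (of_real t)) / c"
      using c(1) g(4)[of "of_real t"] h(4)[of "of_real t"] t by (simp add: field_simps)
    then have "norm (complex_of_real t ^ ?k) * norm (h (of_real t))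
        \<le> norm (complex_of_real t ^ ?k) * (norm (of_real t ^ Suc n * g (of_real t)) / c)"
      unfolding n power_add by (simp add: norm_mult algebra_simps)
    then show ?thesis by (rule mult_left_le_imp_le) (use t(1) in simp)
  qed
  have ev: "eventually (\<lambda>t. t \<noteq> 0 \<and> \<bar>t\<bar> < \<rho> \<and> \<bar>t\<bar> < \<sigma>) (at (0::real))"
    using g(1) h(1) unfolding eventually_at by (intro exI[of _ "min \<rho> \<sigma>"]) (auto simp: dist_real_def)
  have evb: "eventually (\<lambda>t. norm (h (of_real t)) \<le> norm (of_real t ^ Suc n * g (of_real t)) / c) (at (0::real))"
    using ev by eventually_elim (use bound in auto)
  have "((\<lambda>t. norm (of_real t ^ Suc n * g (of_real t)) / c) \<longlongrightarrow> norm (of_real 0 ^ Suc n * g 0) / c) (at (0::real))"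
    using c(1) of_real_tendsto[OF g(3,1)] by (intro tendsto_intros) auto
  then have "((\<lambda>t. norm (of_real t ^ Suc n * g (of_real t)) / c) \<longlongrightarrow> 0) (at (0::real))" by simp
  from Lim_null_comparison[OF evb this] have "h 0 = 0"
    using of_real_tendsto[OF h(3,1)] LIM_unique by blast
  then show False using h(1,5) by simp
qed

text \<open>Near any nonzero \<open>y\<close> on the line of \<open>A\<close>, cone points are
  multiples of branch points with small parameter. Allowing every \<open>y\<close> lets the result
  be used at unit vectors, where compactness is available.\<close>

lemma local_chart:
  assumes y: "y \<in> line A" "y \<noteq> 0" and \<sigma>: "0 < \<sigma>"
  obtains \<epsilon> where "0 < \<epsilon>"
    "\<And>x. x \<in> affine_cone X \<Longrightarrow> dist x y < \<epsilon> \<Longrightarrow> \<exists>\<tau>. \<tau> \<in> ball 0 r \<and> \<tau> \<in> ball 0 \<sigma> \<and> x = cdot a x *s \<gamma> \<tau>"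
proof -
  obtain c where c: "y = c *s a" using line_eq[OF a_line a_nz] y(1) by blast
  have c0: "c \<noteq> 0" using c y(2) by auto
  have ay: "cdot a y = c" by (simp add: c cdot_scale_right aa)
  have nb: "((\<lambda>x. x) \<longlongrightarrow> y) (nhds y)" by (simp add: filterlim_ident)
  have lim: "(cdot u \<longlongrightarrow> cdot u y) (nhds y)" for u
    using hpoly_continuous[OF hpoly_cdot, of UNIV u]
    by (simp add: continuous_on_eq_continuous_at isCont_def tendsto_at_iff_tendsto_nhds)
  \<comment> \<open>Rescaling to \<open>cdot a = 1\<close> sends \<open>y\<close>, a multiple of
    \<open>a\<close>, to \<open>a\<close> itself; so nearby points land in the neighbourhood where
    the branch is all of \<open>zeros\<close>.\<close>
  have "((\<lambda>x. \<chi> i. (1 / cdot a x) * x $ i) \<longlongrightarrow> (\<chi> i. (1 / cdot a y) * y $ i)) (nhds y)"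
    using c0 ay by (intro tendsto_vec_lambda tendsto_mult tendsto_divide tendsto_const lim tendsto_vec_nth nb) auto
  moreover have "(\<chi> i. (1 / cdot a y) * y $ i) = a" unfolding ay using c0 by (simp add: c vec_eq_iff)
  ultimately have near: "((\<lambda>x. \<chi> i. (1 / cdot a x) * x $ i) \<longlongrightarrow> a) (nhds y)" by simp
  note tendstoD[OF near \<delta>_pos]
  moreover have "((\<lambda>x. cdot b x / cdot a x) \<longlongrightarrow> cdot b y / cdot a y) (nhds y)"
    using c0 ay by (intro tendsto_divide lim) auto
  then have "((\<lambda>x. cdot b x / cdot a x) \<longlongrightarrow> 0) (nhds y)"
    by (simp add: c cdot_scale_right ba)
  from tendstoD[OF this \<sigma>] have "eventually (\<lambda>x. dist (cdot b x / cdot a x) 0 < \<sigma>) (nhds y)" .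
  moreover have "eventually (\<lambda>x. cdot a x \<noteq> 0) (nhds y)"
    using tendsto_imp_eventually_ne[OF lim] c0 ay by metis
  ultimately have "eventually (\<lambda>x. dist (\<chi> i. (1 / cdot a x) * x $ i) a < \<delta> \<and>
      dist (cdot b x / cdot a x) 0 < \<sigma> \<and> cdot a x \<noteq> 0) (nhds y)"
    by eventually_elim auto
  then obtain \<epsilon> where \<epsilon>: "\<epsilon> > 0" "\<And>x. dist x y < \<epsilon> \<Longrightarrow> dist (\<chi> i. (1 / cdot a x) * x $ i) a < \<delta> \<and>
      dist (cdot b x / cdot a x) 0 < \<sigma> \<and> cdot a x \<noteq> 0"
    unfolding eventually_nhds_metric by blast
  show thesis
  proof (rule that[OF \<epsilon>(1)])
    fix x assume x: "x \<in> affine_cone X" "dist x y < \<epsilon>"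
    note e = \<epsilon>(2)[OF x(2)]
    let ?l = "cdot a x"
    let ?z = "(1 / ?l) *s x"
    have z: "?z = (\<chi> i. (1 / cdot a x) * x $ i)" by (simp add: vec_eq_iff)
    have "?z \<in> zeros" using cone_scale[OF x(1)] cone_zeros by blast
    moreover have "cdot a ?z = 1" using e by (simp add: cdot_scale_right)
    moreover have "dist ?z a < \<delta>" using e z by simp
    ultimately have "cdot b ?z \<in> ball 0 r" "?z = \<gamma> (cdot b ?z)" using \<gamma>_local by blast+
    moreover have "cdot b ?z \<in> ball 0 \<sigma>" using e by (simp add: cdot_scale_right)
    moreover have "x = ?l *s ?z" using e by simp
    ultimately show "\<exists>\<tau>. \<tau> \<in> ball 0 r \<and> \<tau> \<in> ball 0 \<sigma> \<and> x = ?l *s \<gamma> \<tau>" by metis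
  qed
qed

text \<open>Along the branch the quotient of \<open>w\<close> by \<open>q\<close> extends
  continuously by the order assumption. It is a quotient of forms of equal degree, so the bound is
  independent of the scale of \<open>x\<close>.\<close>

lemma local_bound:
  assumes w: "w \<in> R2 X" and q: "q \<in> R2 X" "q \<noteq> 0"
    and ord: "w \<noteq> 0 \<Longrightarrow> order_at X A q \<le> order_at X A w"
    and y: "y \<in> line A" "y \<noteq> 0"
  shows "\<exists>C \<epsilon>. 0 < \<epsilon> \<and> (\<forall>x\<in>affine_cone X. dist x y < \<epsilon> \<longrightarrow> norm (w x) \<le> C * norm (q x))"
proof (cases "w = 0")
  case True
  then show ?thesis by (intro exI[of _ 0] exI[of _ 1]) auto
next
  case False
  let ?m = "order_at X A q" and ?k = "order_at X A w"
  obtain \<rho> g where g: "0 < \<rho>" "\<rho> \<le> r" "continuous_on (ball 0 \<rho>) g"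
    "\<And>z. z \<in> ball 0 \<rho> \<Longrightarrow> q (\<gamma> z) = z ^ ?m * g z" "\<And>z. z \<in> ball 0 \<rho> \<Longrightarrow> g z \<noteq> 0"
    using order_expansion[OF q] by metis
  obtain \<sigma> h where h: "0 < \<sigma>" "\<sigma> \<le> r" "continuous_on (ball 0 \<sigma>) h"
    "\<And>z. z \<in> ball 0 \<sigma> \<Longrightarrow> w (\<gamma> z) = z ^ ?k * h z"
    using order_expansion[OF w False] by metis
  \<comment> \<open>Halving gives a closed ball inside both domains, on which the quotient is
    bounded by compactness.\<close>
  define s where "s = min \<rho> \<sigma> / 2"
  have s: "0 < s" "s < \<rho>" "s < \<sigma>" using g(1) h(1) by (auto simp: s_def)
  let ?u = "\<lambda>z. z ^ (?k - ?m) * h z / g z"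
  have "continuous_on (cball 0 s) ?u"
    using g(5) s by (intro continuous_on_divide continuous_on_mult continuous_on_power continuous_on_id
      continuous_on_subset[OF g(3)] continuous_on_subset[OF h(3)]) auto
  then have "bounded (?u ` cball 0 s)" by (intro compact_imp_bounded compact_continuous_image compact_cball)
  then obtain C where "\<forall>z\<in>cball 0 s. norm (?u z) \<le> C" by (auto simp: bounded_iff)
  then have C: "\<And>z. z \<in> cball 0 s \<Longrightarrow> norm (?u z) \<le> C" by blast
  obtain \<epsilon> where \<epsilon>: "0 < \<epsilon>" "\<And>x. x \<in> affine_cone X \<Longrightarrow> dist x y < \<epsilon> \<Longrightarrow>
      \<exists>\<tau>. \<tau> \<in> ball 0 r \<and> \<tau> \<in> ball 0 s \<and> x = cdot a x *s \<gamma> \<tau>"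
    using local_chart[OF y s(1)] by metis
  have "norm (w x) \<le> C * norm (q x)" if x: "x \<in> affine_cone X" "dist x y < \<epsilon>" for x
  proof -
    obtain \<tau> where \<tau>: "\<tau> \<in> ball 0 r" "\<tau> \<in> ball 0 s" "x = cdot a x *s \<gamma> \<tau>" using \<epsilon>(2)[OF x] by blast
    have in_balls: "\<tau> \<in> ball 0 \<rho>" "\<tau> \<in> ball 0 \<sigma>" "\<tau> \<in> cball 0 s" using \<tau>(2) s by auto
    have "w (\<gamma> \<tau>) = ?u \<tau> * q (\<gamma> \<tau>)"
      using g(4,5)[OF in_balls(1)] h(4)[OF in_balls(2)] ord[OF False]
      by (simp add: field_simps power_add[symmetric])
    moreover have "q x = (cdot a x)\<^sup>2 * q (\<gamma> \<tau>)" "w x = (cdot a x)\<^sup>2 * w (\<gamma> \<tau>)"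
      using \<tau>(3) R2_scale[OF q(1) \<gamma>_cone[OF \<tau>(1)]] R2_scale[OF w \<gamma>_cone[OF \<tau>(1)]] by metis+
    ultimately have "w x = ?u \<tau> * q x" by simp
    then have "norm (w x) = norm (?u \<tau>) * norm (q x)" by (simp only: norm_mult)
    then show ?thesis using mult_right_mono[OF C[OF in_balls(3)], of "norm (q x)"] by simp
  qed
  then show ?thesis using \<epsilon>(1) by blast
qed

text \<open>The unit factor \<open>g\<close> has no zeros, so only the parameter 0, that is the
  point \<open>A\<close>, remains.\<close>

lemma local_zeros:
  assumes q: "q \<in> R2 X" "q \<noteq> 0" and y: "y \<in> line A" "y \<noteq> 0"
  shows "\<exists>\<epsilon>>0. \<forall>x\<in>affine_cone X. dist x y < \<epsilon> \<and> q x = 0 \<longrightarrow> x \<in> line A"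
proof -
  let ?m = "order_at X A q"
  obtain \<rho> g where g: "0 < \<rho>" "\<rho> \<le> r" "continuous_on (ball 0 \<rho>) g"
    "\<And>z. z \<in> ball 0 \<rho> \<Longrightarrow> q (\<gamma> z) = z ^ ?m * g z" "\<And>z. z \<in> ball 0 \<rho> \<Longrightarrow> g z \<noteq> 0"
    using order_expansion[OF q] by metis
  obtain \<epsilon> where \<epsilon>: "0 < \<epsilon>" "\<And>x. x \<in> affine_cone X \<Longrightarrow> dist x y < \<epsilon> \<Longrightarrow>
      \<exists>\<tau>. \<tau> \<in> ball 0 r \<and> \<tau> \<in> ball 0 \<rho> \<and> x = cdot a x *s \<gamma> \<tau>"
    using local_chart[OF y g(1)] by metis
  have "x \<in> line A" if x: "x \<in> affine_cone X" "dist x y < \<epsilon>" "q x = 0" for x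
  proof -
    obtain \<tau> where \<tau>: "\<tau> \<in> ball 0 r" "\<tau> \<in> ball 0 \<rho>" "x = cdot a x *s \<gamma> \<tau>" using \<epsilon>(2)[OF x(1,2)] by blast
    have "q x = (cdot a x)\<^sup>2 * q (\<gamma> \<tau>)"
      using \<tau>(3) R2_scale[OF q(1) \<gamma>_cone[OF \<tau>(1)]] by metis
    then have "cdot a x = 0 \<or> \<tau> = 0" using x(3) g(4,5)[OF \<tau>(2)] by auto
    then show ?thesis using \<tau>(3) \<gamma>_0 line_eq[OF a_line a_nz] by auto
  qed
  then show ?thesis using \<epsilon>(1) by blast
qed

end

context curve_branch
begin

lemma nonzero_at_real_vector:
  assumes q: "q \<in> R2 X" "q \<noteq> 0"
  shows "\<exists>x\<in>affine_cone X. conj_vec x = x \<and> x \<noteq> 0 \<and> q x \<noteq> 0"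
proof -
  obtain \<rho> g where g: "0 < \<rho>" "\<rho> \<le> r" "continuous_on (ball 0 \<rho>) g"
    "\<And>z. z \<in> ball 0 \<rho> \<Longrightarrow> q (\<gamma> z) = z ^ order_at X A q * g z" "\<And>z. z \<in> ball 0 \<rho> \<Longrightarrow> g z \<noteq> 0"
    using order_expansion[OF q] by metis
  have t: "\<bar>\<rho> / 2\<bar> < r" "complex_of_real (\<rho> / 2) \<in> ball 0 \<rho>" "complex_of_real (\<rho> / 2) \<noteq> 0"
    using g(1,2) by auto
  have "q (\<gamma> (complex_of_real (\<rho> / 2))) \<noteq> 0"
    unfolding g(4)[OF t(2)] using t(3) g(5)[OF t(2)] by simp
  then show ?thesis using \<gamma>_of_real[OF t(1)] by blast
qed

end

section \<open>Globalisation over the compact set of real points\<close>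

locale totally_real_smooth_curve =
  fixes X :: "'n::finite proj set"
  assumes real_curve: "real_projective_curve X" and smooth: "smooth_curve X"
    and irreducible: "zariski_irreducible X" and totally_real: "totally_real_curve X"
begin

lemma closed: "zariski_closed X" and dim: "zariski_dim X = 1" and conj_X: "conj_pt ` X = X"
  using real_curve by (auto simp: real_projective_curve_def projective_curve_def)

lemma obtain_branch:
  assumes "A \<in> real_points X"
  obtains a b e p \<gamma> r \<delta> where "curve_branch X A a b e p \<gamma> r \<delta>"
proof -
  have A: "A \<in> X" "conj_pt A = A" using assms by (auto simp: real_points_def)
  obtain a b where ab: "a \<in> line A" "conj_vec a = a" "conj_vec b = b"
    "cdot a a = 1" "cdot b b = 1" "cdot a b = 0"
    "\<And>v. v \<in> cone_tangent_space X a \<Longrightarrow> \<exists>c d. v = c *s a + d *s b"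
    using obtain_tangent_frame[OF conj_X A smooth] by metis
  interpret curve_frame X A a b
    by unfold_locales (use closed dim irreducible conj_X A ab in auto)
  obtain e p where ep: "local_equations e p" using local_equations_exist by blast
  interpret curve_germ X A a b e p by unfold_locales (rule ep)
  obtain \<gamma> r \<delta> where "branch \<gamma> r \<delta>" using branch_exists by blast
  then have "curve_branch X A a b e p \<gamma> r \<delta>" by unfold_locales
  then show thesis by (rule that)
qed

text \<open>The empty set is Zariski closed, so density rules it out. One real point already carries
  a real branch, on which forms can be tested.\<close>

lemma real_points_nonempty: "real_points X \<noteq> {}"
proof
  assume "real_points X = {}"
  have "zariski_closed ({} :: 'n proj set)"
    unfolding zariski_closed_iff
    by (rule exI[of _ "{\<lambda>x. 1}"]) (auto intro: hpoly_const zero_in_line)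
  then have "zariski_closure (real_points X) = {}"
    using \<open>real_points X = {}\<close> by (auto simp: zariski_closure_def)
  then have "X = {}" using totally_real by (simp add: totally_real_curve_def)
  then show False using irreducible by (simp add: zariski_irreducible_def)
qed

text \<open>A compact model of the real points, each represented by its real unit vectors.\<close>

definition "real_sphere = {x \<in> affine_cone X. conj_vec x = x \<and> norm x = 1}"

lemma compact_real_sphere: "compact real_sphere"
proof -
  have "X \<noteq> {}" using irreducible by (simp add: zariski_irreducible_def)
  have "continuous_on UNIV (conj_vec :: complex ^ 'n \<Rightarrow> _)"
    unfolding conj_vec_def[abs_def] by (intro continuous_intros)
  then have "closed {x :: complex ^ 'n. conj_vec x = x}"
    by (rule closed_Collect_eq[OF _ continuous_on_id])
  then have "compact (sphere 0 1 \<inter> (affine_cone X \<inter> {x. conj_vec x = x}))"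
    by (intro compact_Int_closed compact_sphere closed_Int closed_affine_cone closed \<open>X \<noteq> {}\<close>)
  moreover have "sphere 0 1 \<inter> (affine_cone X \<inter> {x. conj_vec x = x}) = real_sphere"
    by (auto simp: real_sphere_def)
  ultimately show ?thesis by simp
qed

lemma real_sphere_point:
  assumes "x \<in> real_sphere"
  obtains A where "A \<in> real_points X" "x \<in> line A" "x \<noteq> 0"
proof -
  have x: "x \<in> affine_cone X" "conj_vec x = x" "x \<noteq> 0" using assms by (auto simp: real_sphere_def)
  then obtain A where A: "A \<in> X" "x \<in> line A" by (auto simp: affine_cone_def)
  then show thesis using that real_pt_iff[OF A(2) x(3,2)] x(3) by (auto simp: real_points_def)
qed

lemma real_point_sphere:
  assumes "A \<in> real_points X"
  obtains x where "x \<in> real_sphere" "x \<in> line A"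
proof -
  have A: "A \<in> X" "conj_pt A = A" using assms by (auto simp: real_points_def)
  obtain a where a: "a \<in> line A" "a \<noteq> 0" "conj_vec a = a" by (rule obtain_real_vec[OF A(2)])
  let ?y = "complex_of_real (1 / norm a) *s a"
  have "?y = (1 / norm a) *\<^sub>R a" by (simp add: vec_eq_iff complex_eq_iff)
  then have "norm ?y = 1" using a(2) by simp
  moreover have "conj_vec ?y = ?y" by (simp add: conj_vec_scale a(3))
  moreover have "?y \<in> line A" using line_eq[OF a(1,2)] by blast
  ultimately show thesis using that cone_line[OF _ A(1)] by (auto simp: real_sphere_def)
qed

text \<open>A nonzero form has finite order along a real branch, so it is nonzero at small nonzero
  real parameters.\<close>

lemma R2_nonzero_at_real_vector:
  assumes "q \<in> R2 X" "q \<noteq> 0"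
  shows "\<exists>x\<in>affine_cone X. conj_vec x = x \<and> x \<noteq> 0 \<and> q x \<noteq> 0"
proof -
  obtain A where A: "A \<in> real_points X" using real_points_nonempty by blast
  obtain a b e p \<gamma> r \<delta> where "curve_branch X A a b e p \<gamma> r \<delta>" by (rule obtain_branch[OF A])
  then interpret curve_branch X A a b e p \<gamma> r \<delta> .
  show ?thesis by (rule nonzero_at_real_vector[OF assms])
qed

lemma P2_even_order:
  assumes "q \<in> P2 X" "q \<noteq> 0" "A \<in> real_points X"
  shows "even (order_at X A q)"
proof -
  obtain a b e p \<gamma> r \<delta> where "curve_branch X A a b e p \<gamma> r \<delta>" by (rule obtain_branch[OF assms(3)])
  then interpret curve_branch X A a b e p \<gamma> r \<delta> .
  show ?thesis by (rule even_order[OF assms(1,2)])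
qed

lemma P2_order_le:
  assumes "w \<in> P2 X" "w \<noteq> 0" "q \<in> P2 X" "q \<noteq> 0" "0 < c" "q - c *\<^sub>R w \<in> P2 X" "A \<in> real_points X"
  shows "order_at X A q \<le> order_at X A w"
proof -
  obtain a b e p \<gamma> r \<delta> where "curve_branch X A a b e p \<gamma> r \<delta>" by (rule obtain_branch[OF assms(7)])
  then interpret curve_branch X A a b e p \<gamma> r \<delta> .
  show ?thesis by (rule order_le_of_dominated[OF assms(1-6)])
qed

text \<open>Infinitely many zeros would accumulate on the compact sphere, but near a limit vector
  \<open>y\<close> the only possible zero is the point of \<open>y\<close>.\<close>

lemma finite_real_zeros:
  assumes q: "q \<in> R2 X" "q \<noteq> 0"
  shows "finite {A \<in> real_points X. order_at X A q \<noteq> 0}" (is "finite ?Z")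
proof (rule ccontr)
  assume inf: "infinite ?Z"
  \<comment> \<open>One unit vector per zero; distinct points give distinct vectors, so the set of
    chosen vectors is infinite.\<close>
  have "\<forall>A\<in>?Z. \<exists>x. x \<in> real_sphere \<and> x \<in> line A" using real_point_sphere by blast
  from bchoice[OF this] obtain \<phi> where "\<forall>A\<in>?Z. \<phi> A \<in> real_sphere \<and> \<phi> A \<in> line A" by blast
  then have \<phi>: "\<And>A. A \<in> ?Z \<Longrightarrow> \<phi> A \<in> real_sphere" "\<And>A. A \<in> ?Z \<Longrightarrow> \<phi> A \<in> line A" by blast+
  have \<phi>nz: "\<phi> A \<noteq> 0" if "A \<in> ?Z" for A using \<phi>(1)[OF that] by (auto simp: real_sphere_def)
  have "inj_on \<phi> ?Z"
    by (rule inj_on_inverseI[of _ proj_pt]) (rule proj_pt_eq[OF \<phi>(2) \<phi>nz])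
  then have "infinite (\<phi> ` ?Z)" using inf finite_imageD by blast
  moreover have "\<phi> ` ?Z \<subseteq> real_sphere" using \<phi>(1) by blast
  ultimately obtain y where y: "y \<in> real_sphere" "y islimpt \<phi> ` ?Z"
    using compact_real_sphere[unfolded compact_eq_Bolzano_Weierstrass, rule_format, of "\<phi> ` ?Z"] by blast
  obtain A where A: "A \<in> real_points X" "y \<in> line A" "y \<noteq> 0" by (rule real_sphere_point[OF y(1)])
  obtain \<epsilon> where \<epsilon>: "\<epsilon> > 0" "\<And>x. x \<in> affine_cone X \<Longrightarrow> dist x y < \<epsilon> \<Longrightarrow> q x = 0 \<Longrightarrow> x \<in> line A"
  proof -
    obtain a b e p \<gamma> r \<delta> where "curve_branch X A a b e p \<gamma> r \<delta>" by (rule obtain_branch[OF A(1)])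
    then interpret curve_branch X A a b e p \<gamma> r \<delta> .
    show thesis using local_zeros[OF q A(2,3)] that by blast
  qed
  have "\<phi> ` ?Z \<inter> ball y \<epsilon> \<subseteq> {\<phi> A}"
  proof
    fix x assume "x \<in> \<phi> ` ?Z \<inter> ball y \<epsilon>"
    then obtain B where B: "B \<in> ?Z" "x = \<phi> B" "dist x y < \<epsilon>" by (auto simp: dist_commute)
    have "q x = 0"
    proof -
      from B(1) have "B \<in> real_points X" by simp
      then obtain a b e p \<gamma> r \<delta> where "curve_branch X B a b e p \<gamma> r \<delta>" by (rule obtain_branch)
      then interpret curve_branch X B a b e p \<gamma> r \<delta> .
      show ?thesis using order_nonzero_imp_zero[OF q _ \<phi>(2)[OF B(1)]] B by simp
    qed
    moreover have "x \<in> affine_cone X" using \<phi>(1)[OF B(1)] B(2) by (simp add: real_sphere_def)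
    ultimately have "x \<in> line A" using \<epsilon>(2) B(3) by blast
    then have "B = A"
      using proj_pt_eq[OF \<phi>(2)[OF B(1)] \<phi>nz[OF B(1)]] proj_pt_eq[of x A] \<phi>nz[OF B(1)] B(2) by simp
    then show "x \<in> {\<phi> A}" using B(2) by simp
  qed
  then have "finite (\<phi> ` ?Z \<inter> ball y \<epsilon>)" using finite_subset by blast
  then show False using y(2) \<epsilon>(1) islimpt_eq_infinite_ball by blast
qed

text \<open>Converse to \<open>P2_order_le\<close>: comparison of orders gives a bound near each
  real point, and compactness makes the constant uniform.\<close>

lemma P2_dominated:
  assumes w: "w \<in> P2 X" and q: "q \<in> P2 X" "q \<noteq> 0"
    and ord: "\<And>A. A \<in> real_points X \<Longrightarrow> w \<noteq> 0 \<Longrightarrow> order_at X A q \<le> order_at X A w"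
  shows "\<exists>C>0. C *\<^sub>R q - w \<in> P2 X"
proof -
  have local: "\<exists>C \<epsilon>. 0 < \<epsilon> \<and> (\<forall>x\<in>affine_cone X. dist x y < \<epsilon> \<longrightarrow> norm (w x) \<le> C * norm (q x))"
    if y: "y \<in> real_sphere" for y
  proof -
    obtain A where A: "A \<in> real_points X" "y \<in> line A" "y \<noteq> 0" by (rule real_sphere_point[OF y])
    obtain a b e p \<gamma> r \<delta> where "curve_branch X A a b e p \<gamma> r \<delta>" by (rule obtain_branch[OF A(1)])
    then interpret curve_branch X A a b e p \<gamma> r \<delta> .
    show ?thesis by (rule local_bound[OF P2_R2[OF w] P2_R2[OF q(1)] q(2) ord[OF A(1)] A(2,3)])
  qed
  have "\<exists>n::nat. \<forall>x\<in>real_sphere. norm (w x) \<le> real (Suc n) * norm (q x)"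
  proof (rule ccontr)
    assume "\<not> ?thesis"
    \<comment> \<open>Counterexamples to the constants \<open>Suc n\<close> have a subsequence
      converging to some \<open>y\<close>, where the fixed local constant \<open>C\<close> is
      eventually exceeded by \<open>Suc (s n)\<close>.\<close>
    then have "\<forall>n::nat. \<exists>x. x \<in> real_sphere \<and> norm (w x) > real (Suc n) * norm (q x)"
      by (metis not_le)
    then obtain x where x: "\<And>n::nat. x n \<in> real_sphere" "\<And>n. norm (w (x n)) > real (Suc n) * norm (q (x n))"
      by metis
    obtain y s where y: "y \<in> real_sphere" "strict_mono s" "(x \<circ> s) \<longlonglongrightarrow> y"
      using compact_real_sphere[THEN compact_imp_seq_compact] x(1) unfolding seq_compact_def by blast
    obtain C \<epsilon> where C: "0 < \<epsilon>" "\<And>x. x \<in> affine_cone X \<Longrightarrow> dist x y < \<epsilon> \<Longrightarrow> norm (w x) \<le> C * norm (q x)"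
      using local[OF y(1)] by blast
    have "eventually (\<lambda>n. dist ((x \<circ> s) n) y < \<epsilon>) sequentially" by (rule tendstoD[OF y(3) C(1)])
    moreover have "eventually (\<lambda>n. n \<ge> nat \<lceil>C\<rceil>) sequentially" by (rule eventually_ge_at_top)
    ultimately have "eventually (\<lambda>n. dist ((x \<circ> s) n) y < \<epsilon> \<and> n \<ge> nat \<lceil>C\<rceil>) sequentially"
      by eventually_elim auto
    then obtain n where n: "dist (x (s n)) y < \<epsilon>" "n \<ge> nat \<lceil>C\<rceil>"
      by (auto simp: eventually_sequentially)
    have "norm (w (x (s n))) \<le> C * norm (q (x (s n)))"
      using C(2)[OF _ n(1)] x(1)[of "s n"] by (simp add: real_sphere_def)
    moreover have "C \<le> real (Suc (s n))"
      using n(2) seq_suble[OF y(2), of n] by linarith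
    then have "C * norm (q (x (s n))) \<le> real (Suc (s n)) * norm (q (x (s n)))"
      by (rule mult_right_mono) simp
    ultimately show False using x(2)[of "s n"] by simp
  qed
  then obtain n :: nat where n: "\<And>x. x \<in> real_sphere \<Longrightarrow> norm (w x) \<le> real (Suc n) * norm (q x)" by blast
  have "real (Suc n) *\<^sub>R q - w \<in> P2 X"
  proof (rule P2_I)
    show "real (Suc n) *\<^sub>R q - w \<in> R2 X"
      using subspace_R2 P2_R2 w q by (intro subspace_diff subspace_scale)
  next
    fix x assume x: "x \<in> affine_cone X" "conj_vec x = x" "norm x = 1"
    then have "x \<in> real_sphere" "x \<noteq> 0" by (auto simp: real_sphere_def)
    have "norm (q x) = Re (q x)"
      using P2_nonneg[OF q(1) x(1,2) \<open>x \<noteq> 0\<close>] R2_real[OF P2_R2[OF q(1)] x(2)] by (simp add: in_Reals_norm)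
    moreover have "Re (w x) \<le> norm (w x)" by (rule complex_Re_le_cmod)
    ultimately have "Re (w x) \<le> real (Suc n) * Re (q x)"
      using n[OF \<open>x \<in> real_sphere\<close>] by simp
    then show "0 \<le> Re ((real (Suc n) *\<^sub>R q - w) x)" by (simp add: scaleR_fun_def)
  qed
  then show ?thesis by (intro exI[of _ "real (Suc n)"]) simp
qed

end

section \<open>Relative interiors of cones of quadratic forms\<close>

text \<open>Coordinates with respect to a finite independent set of functions are combinations of point
  evaluations, hence continuous for pointwise convergence.\<close>

lemma continuous_dual_basis:
  fixes B :: "('a \<Rightarrow> complex) set"
  assumes "finite B" "independent B"
  shows "\<exists>\<phi>. \<forall>b\<in>B. linear (\<phi> b) \<and> continuous_on UNIV (\<phi> b :: _ \<Rightarrow> real) \<and>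
           (\<forall>c\<in>B. \<phi> b c = (if b = c then 1 else 0))"
  using assms
proof (induction B rule: finite_induct)
  case empty
  then show ?case by simp
next
  case (insert b0 B)
  have ind: "independent B" "b0 \<notin> span B" using insert.prems insert.hyps by (auto simp: independent_insert)
  obtain \<phi> where \<phi>: "\<And>b. b \<in> B \<Longrightarrow> linear (\<phi> b)" "\<And>b. b \<in> B \<Longrightarrow> continuous_on UNIV (\<phi> b :: _ \<Rightarrow> real)"
    "\<And>b c. b \<in> B \<Longrightarrow> c \<in> B \<Longrightarrow> \<phi> b c = (if b = c then 1 else 0)"
    using insert.IH[OF ind(1)] by blast
  \<comment> \<open>The part of \<open>b0\<close> not accounted for by \<open>B\<close>. It is a
    nonzero function, so the real or imaginary part of some point evaluation detects it.\<close>
  define d where "d = b0 - (\<Sum>b\<in>B. \<phi> b b0 *\<^sub>R b)"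
  have "d \<noteq> 0"
  proof
    assume "d = 0"
    then have "b0 = (\<Sum>b\<in>B. \<phi> b b0 *\<^sub>R b)" by (simp add: d_def)
    moreover have "(\<Sum>b\<in>B. \<phi> b b0 *\<^sub>R b) \<in> span B" by (intro span_sum span_scale span_base)
    ultimately show False using ind(2) by simp
  qed
  obtain \<psi> where \<psi>: "linear (\<psi> :: _ \<Rightarrow> real)" "continuous_on UNIV \<psi>" "\<psi> d \<noteq> 0"
  proof -
    from \<open>d \<noteq> 0\<close> obtain x where x: "d x \<noteq> 0" by (auto simp: fun_eq_iff)
    have ev: "continuous_on UNIV (\<lambda>f::'a \<Rightarrow> complex. f x)" by (rule continuous_on_product_coordinates)
    show thesis
    proof (cases "Re (d x) = 0")
      case False
      show thesis
        by (rule that[of "\<lambda>f. Re (f x)"])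
           (use False ev in \<open>auto intro!: linearI continuous_on_Re simp: scaleR_fun_def\<close>)
    next
      case True
      then have "Im (d x) \<noteq> 0" using x by (simp add: complex_eq_iff)
      then show thesis
        by (intro that[of "\<lambda>f. Im (f x)"])
           (use ev in \<open>auto intro!: linearI continuous_on_Im simp: scaleR_fun_def\<close>)
    qed
  qed
  \<comment> \<open>The detecting evaluation, corrected to vanish on \<open>B\<close> and scaled to
    be 1 on \<open>b0\<close>.\<close>
  define \<omega> where "\<omega> f = (\<psi> f - (\<Sum>b\<in>B. \<psi> b * \<phi> b f)) / \<psi> d" for f
  have \<omega>lin: "linear \<omega>"
  proof (rule linearI)
    fix f g :: "'a \<Rightarrow> complex" and r :: real
    have "(\<Sum>b\<in>B. \<psi> b * \<phi> b (f + g)) = (\<Sum>b\<in>B. \<psi> b * \<phi> b f) + (\<Sum>b\<in>B. \<psi> b * \<phi> b g)"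
      using \<phi>(1) by (simp add: linear_add distrib_left sum.distrib)
    then show "\<omega> (f + g) = \<omega> f + \<omega> g"
      using \<psi>(1) by (simp add: \<omega>_def linear_add diff_divide_distrib add_divide_distrib)
    have "(\<Sum>b\<in>B. \<psi> b * \<phi> b (r *\<^sub>R f)) = r * (\<Sum>b\<in>B. \<psi> b * \<phi> b f)"
      using \<phi>(1) by (simp add: linear_scale sum_distrib_left mult.left_commute)
    then show "\<omega> (r *\<^sub>R f) = r *\<^sub>R \<omega> f"
      using \<psi>(1) by (simp add: \<omega>_def linear_scale right_diff_distrib)
  qed
  have \<omega>cont: "continuous_on UNIV \<omega>"
    unfolding \<omega>_def using \<psi>(2,3) \<phi>(2)
    by (intro continuous_on_divide continuous_on_diff continuous_on_sum continuous_on_mult continuous_on_const) auto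
  have \<omega>B: "\<omega> c = 0" if "c \<in> B" for c
  proof -
    have "(\<Sum>b\<in>B. \<psi> b * \<phi> b c) = (\<Sum>b\<in>B. if b = c then \<psi> b else 0)"
      using \<phi>(3)[OF _ that] by (intro sum.cong) auto
    then show ?thesis using that insert.hyps(1) by (simp add: \<omega>_def)
  qed
  have \<omega>b0: "\<omega> b0 = 1"
  proof -
    have "\<psi> d = \<psi> b0 - (\<Sum>b\<in>B. \<psi> b * \<phi> b b0)"
      using \<psi>(1) by (simp add: d_def linear_diff linear_sum linear_scale mult.commute)
    then show ?thesis using \<psi>(3) by (simp add: \<omega>_def)
  qed
  \<comment> \<open>The old coordinates only lack vanishing at \<open>b0\<close>; subtracting a
    multiple of \<omega> repairs this without disturbing their values on \<open>B\<close>.\<close>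
  define \<phi>' where "\<phi>' b = (if b = b0 then \<omega> else (\<lambda>f. \<phi> b f - \<phi> b b0 * \<omega> f))" for b
  show ?case
  proof (intro exI[of _ \<phi>'] ballI conjI)
    fix b assume b: "b \<in> insert b0 B"
    show "linear (\<phi>' b)"
      using b \<phi>(1)[of b] \<omega>lin
      by (auto simp: \<phi>'_def linear_add linear_scale algebra_simps intro!: linearI)
    show "continuous_on UNIV (\<phi>' b)"
      using b \<phi>(2)[of b] \<omega>cont by (auto simp: \<phi>'_def intro!: continuous_on_diff continuous_on_mult continuous_on_const)
    fix c assume "c \<in> insert b0 B"
    then show "\<phi>' b c = (if b = c then 1 else 0)"
      using b \<phi>(3) \<omega>B \<omega>b0 insert.hyps(2) by (auto simp: \<phi>'_def)
  qed
qed

lemma cone_rel_interior_subset: "cone_rel_interior F \<subseteq> F"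
  unfolding cone_rel_interior_def by (rule interior_of_subset)

text \<open>A basis of the span can be taken inside \<open>F\<close>. The vectors with positive
  coordinates form an open set contained in the cone, and the sum of the basis is one of
  them.\<close>

lemma cone_rel_interior_nonempty:
  fixes F :: "('a \<Rightarrow> complex) set"
  assumes F: "convex_cone F" and S: "finite S" "F \<subseteq> span S"
  shows "cone_rel_interior F \<noteq> {}"
proof -
  obtain B where B: "B \<subseteq> F" "independent B" "F \<subseteq> span B"
    using maximal_independent_subset by blast
  have finB: "finite B" using independent_span_bound[OF S(1) B(2)] B(1) S(2) by blast
  have span: "span F = span B" using B by (metis span_mono span_span subset_antisym)
  obtain \<phi> where \<phi>: "\<And>b. b \<in> B \<Longrightarrow> linear (\<phi> b)" "\<And>b. b \<in> B \<Longrightarrow> continuous_on UNIV (\<phi> b :: _ \<Rightarrow> real)"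
    "\<And>b c. b \<in> B \<Longrightarrow> c \<in> B \<Longrightarrow> \<phi> b c = (if b = c then 1 else 0)"
    using continuous_dual_basis[OF finB B(2)] by blast
  define U where "U = (\<Inter>b\<in>B. {f. 0 < \<phi> b f})"
  have "open {f. 0 < \<phi> b f}" if "b \<in> B" for b
    by (rule open_Collect_less[OF continuous_on_const \<phi>(2)[OF that]])
  then have "open U" unfolding U_def using finB by blast
  have coord: "\<phi> b (\<Sum>c\<in>B. k c *\<^sub>R c) = k b" if "b \<in> B" for b k
  proof -
    have "\<phi> b (\<Sum>c\<in>B. k c *\<^sub>R c) = (\<Sum>c\<in>B. k c * \<phi> b c)"
      using \<phi>(1)[OF that] by (simp add: linear_sum linear_scale)
    also have "\<dots> = (\<Sum>c\<in>B. if b = c then k c else 0)" using \<phi>(3)[OF that] by (intro sum.cong) auto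
    finally show ?thesis using that finB by simp
  qed
  have sumF: "(\<Sum>c\<in>C. k c *\<^sub>R c) \<in> F" if "C \<subseteq> B" "\<And>c. c \<in> B \<Longrightarrow> 0 \<le> k c" for k C
    using finite_subset[OF that(1) finB] that(1)
    by (induction C rule: finite_induct)
       (use F B(1) that(2) in \<open>auto simp: convex_cone_iff\<close>)
  have "span F \<inter> U \<subseteq> F"
  proof
    fix f assume f: "f \<in> span F \<inter> U"
    then obtain k where k: "f = (\<Sum>c\<in>B. k c *\<^sub>R c)" using span finB by (auto simp: span_finite)
    then have "0 \<le> k c" if "c \<in> B" for c using f coord[OF that, of k] that by (fastforce simp: U_def)
    then show "f \<in> F" unfolding k by (intro sumF) auto
  qed
  moreover have "(\<Sum>c\<in>B. 1 *\<^sub>R c) \<in> span F \<inter> U"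
    using coord[of _ "\<lambda>_. 1"] sumF[OF subset_refl, of "\<lambda>_. 1"] by (auto simp: U_def intro: span_base)
  moreover have "openin (top_of_set (span F)) (span F \<inter> U)" using \<open>open U\<close> by (auto simp: openin_open)
  ultimately show ?thesis
    unfolding cone_rel_interior_def interior_of_def by blast
qed

text \<open>From an interior point there is room to move backwards along any \<open>p\<close> in
  \<open>F\<close>; this is how face arguments use the relative interior.\<close>

lemma cone_rel_interior_diff:
  fixes F :: "('a \<Rightarrow> complex) set"
  assumes "q \<in> cone_rel_interior F" "p \<in> F"
  shows "\<exists>\<epsilon>>0. q - \<epsilon> *\<^sub>R p \<in> F"
proof -
  obtain U where U: "open U" "q \<in> U" "q \<in> span F" "span F \<inter> U \<subseteq> F"
    using assms(1) by (auto simp: cone_rel_interior_def interior_of_def openin_open)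
  have "continuous_on UNIV (\<lambda>\<epsilon>::real. q - \<epsilon> *\<^sub>R p)"
    by (rule continuous_on_coordinatewise_then_product)
       (auto simp: scaleR_fun_def intro!: continuous_intros)
  then have "open ((\<lambda>\<epsilon>::real. q - \<epsilon> *\<^sub>R p) -` U)" using U(1) open_vimage by blast
  moreover have "0 \<in> (\<lambda>\<epsilon>::real. q - \<epsilon> *\<^sub>R p) -` U" using U(2) by simp
  ultimately obtain e where e: "e > 0" "ball 0 e \<subseteq> (\<lambda>\<epsilon>::real. q - \<epsilon> *\<^sub>R p) -` U"
    using open_contains_ball by blast
  then have "q - (e / 2) *\<^sub>R p \<in> U" by (auto dest!: subsetD[of _ _ "e / 2"])
  moreover have "q - (e / 2) *\<^sub>R p \<in> span F"
    by (intro span_diff[OF U(3)] span_scale span_base assms(2))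
  ultimately show ?thesis using U(4) e(1) by (intro exI[of _ "e / 2"]) auto
qed

text \<open>The monomials of degree 2 span over the reals since the coefficients are real; their
  exponents are at most 2, so there are finitely many.\<close>

lemma R2_finite_span:
  fixes X :: "'n::finite proj set"
  shows "\<exists>S. finite S \<and> R2 X \<subseteq> span S"
proof -
  let ?M = "{m :: 'n \<Rightarrow>\<^sub>0 nat. (\<Sum>i\<in>UNIV. Poly_Mapping.lookup m i) = 2}"
  have "finite (Poly_Mapping.lookup ` ?M)"
  proof -
    have "Poly_Mapping.lookup ` ?M \<subseteq> {f. \<forall>i. f i \<in> {..2}}"
    proof (intro subsetI CollectI allI)
      fix f i assume "f \<in> Poly_Mapping.lookup ` ?M"
      then obtain m where "(\<Sum>i\<in>UNIV. Poly_Mapping.lookup m i) = 2" "f = Poly_Mapping.lookup m" by blast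
      then show "f i \<in> {..2}"
        using member_le_sum[of i UNIV "Poly_Mapping.lookup m"] by simp
    qed
    moreover have "finite {f :: 'n \<Rightarrow> nat. \<forall>i. f i \<in> {..2}}"
      using finite_set_of_finite_funs[of "UNIV :: 'n set" "{..2::nat}" 0] by simp
    ultimately show ?thesis by (rule finite_subset)
  qed
  then have "finite ?M"
    by (rule finite_imageD) (simp add: inj_on_def Poly_Mapping.lookup_inject)
  define mon :: "('n \<Rightarrow>\<^sub>0 nat) \<Rightarrow> complex ^ 'n \<Rightarrow> complex" where
    "mon m = restrict_form X (Poly_Mapping.single m 1)" for m
  have "R2 X \<subseteq> span (mon ` ?M)"
  proof
    fix q assume "q \<in> R2 X"
    then obtain f where f: "real_quadratic_form f" "q = restrict_form X f" by (auto simp: R2_def)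
    have keys: "Poly_Mapping.keys f \<subseteq> ?M" and real: "\<And>m. of_real (Re (Poly_Mapping.lookup f m)) = Poly_Mapping.lookup f m"
      using f(1) by (auto simp: real_quadratic_form_def homogeneous_def real_mpoly_def)
    have "q = (\<Sum>m\<in>Poly_Mapping.keys f. Re (Poly_Mapping.lookup f m) *\<^sub>R mon m)"
    proof
      fix x
      have sum_apply: "(\<Sum>m\<in>K. c m *\<^sub>R mon m) x = (\<Sum>m\<in>K. of_real (c m) * mon m x)"
        for K :: "('n \<Rightarrow>\<^sub>0 nat) set" and c :: "_ \<Rightarrow> real"
        by (induction K rule: infinite_finite_induct) (auto simp: scaleR_fun_def scaleR_conv_of_real)
      show "q x = (\<Sum>m\<in>Poly_Mapping.keys f. Re (Poly_Mapping.lookup f m) *\<^sub>R mon m) x"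
        unfolding sum_apply real
        by (cases "x \<in> affine_cone X") (simp_all add: f(2) restrict_form_def mon_def eval_mpoly_single, simp add: eval_mpoly_def)
    qed
    also have "\<dots> \<in> span (mon ` ?M)"
      using keys by (intro span_sum span_scale span_base imageI) blast
    finally show "q \<in> span (mon ` ?M)" .
  qed
  then show ?thesis using \<open>finite ?M\<close> by blast
qed

section \<open>Faces and their divisors\<close>

context totally_real_smooth_curve
begin

lemma faceD:
  assumes "F \<in> nonzero_faces X"
  shows "convex_cone F" "F \<subseteq> P2 X" "F \<noteq> {0}"
    "\<And>a b. a \<in> P2 X \<Longrightarrow> b \<in> P2 X \<Longrightarrow> a + b \<in> F \<Longrightarrow> a \<in> F"
  using assms by (auto simp: nonzero_faces_def cone_face_def)

lemma obtain_rel_interior: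
  assumes "F \<in> nonzero_faces X" obtains q where "q \<in> cone_rel_interior F"
proof -
  obtain S where "finite S" "R2 X \<subseteq> span S" using R2_finite_span by blast
  moreover have "F \<subseteq> R2 X" using faceD(2)[OF assms] P2_R2 by blast
  ultimately have "cone_rel_interior F \<noteq> {}"
    using cone_rel_interior_nonempty[OF faceD(1)[OF assms]] by blast
  then show thesis using that by blast
qed

text \<open>The cone is pointed. If 0 were interior, both \<open>w\<close> and a negative multiple
  of \<open>w\<close> would be nonnegative, so \<open>w\<close> would vanish at every real vector of
  the cone.\<close>

lemma rel_interior_nonzero:
  assumes F: "F \<in> nonzero_faces X" and q: "q \<in> cone_rel_interior F"
  shows "q \<noteq> 0"
proof
  assume "q = 0"
  have "0 \<in> F" using faceD(1)[OF F] by (simp add: convex_cone_iff)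
  then obtain w where w: "w \<in> F" "w \<noteq> 0" using faceD(3)[OF F] by blast
  obtain \<epsilon> where \<epsilon>: "\<epsilon> > 0" "q - \<epsilon> *\<^sub>R w \<in> F" using cone_rel_interior_diff[OF q w(1)] by blast
  then have neg: "- \<epsilon> *\<^sub>R w \<in> P2 X" using faceD(2)[OF F] \<open>q = 0\<close> by auto
  have wP: "w \<in> P2 X" using w(1) faceD(2)[OF F] by blast
  obtain x where x: "x \<in> affine_cone X" "conj_vec x = x" "x \<noteq> 0" "w x \<noteq> 0"
    using R2_nonzero_at_real_vector[OF P2_R2[OF wP] w(2)] by blast
  have "0 \<le> Re (w x)" "0 \<le> Re ((- \<epsilon> *\<^sub>R w) x)"
    using P2_nonneg[OF wP x(1-3)] P2_nonneg[OF neg x(1-3)] by auto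
  then have "Re (w x) = 0" using \<epsilon>(1) by (simp add: scaleR_fun_def mult_le_0_iff)
  moreover have "w x \<in> \<real>" using R2_real[OF P2_R2[OF wP] x(2)] .
  ultimately show False using x(4) by (auto simp: Reals_def)
qed

lemma rel_interior_order_le:
  assumes F: "F \<in> nonzero_faces X" and q: "q \<in> cone_rel_interior F" and w: "w \<in> F" "w \<noteq> 0"
    and A: "A \<in> real_points X"
  shows "order_at X A q \<le> order_at X A w"
proof -
  obtain \<epsilon> where "\<epsilon> > 0" "q - \<epsilon> *\<^sub>R w \<in> F" using cone_rel_interior_diff[OF q w(1)] by blast
  moreover have "q \<in> F" using q cone_rel_interior_subset by blast
  ultimately show ?thesis
    using P2_order_le[OF _ w(2) _ rel_interior_nonzero[OF F q] _ _ A] faceD(2)[OF F] w(1) by blast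
qed

text \<open>Two relative interior forms dominate each other up to constants, hence have the same
  order at every real point. This makes the \<open>THE\<close> well defined, and a single
  \<open>q\<close> computes it.\<close>

lemma face_divisor_eq:
  assumes F: "F \<in> nonzero_faces X" and q: "q \<in> cone_rel_interior F"
  shows "2 * face_divisor X F A = (if A \<in> real_points X then int (order_at X A q) else 0)"
proof -
  have qP: "q \<in> P2 X" and qF: "q \<in> F" using q cone_rel_interior_subset faceD(2)[OF F] by blast+
  have q0: "q \<noteq> 0" by (rule rel_interior_nonzero[OF F q])
  \<comment> \<open>The integer division is exact by \<open>P2_even_order\<close>.\<close>
  define D where "D A = (if A \<in> real_points X then int (order_at X A q div 2) else 0)" for A
  have twoD: "2 * D A = (if A \<in> real_points X then int (order_at X A q) else 0)" for A
  proof -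
    have "2 * int (n div 2) = int n" if "even n" for n :: nat using that by (auto elim!: evenE)
    then show ?thesis using P2_even_order[OF qP q0] by (simp add: D_def)
  qed
  have real_div: "divisor_real_part X (divisor_of X w) A = (if A \<in> real_points X then int (order_at X A w) else 0)" for w A
    by (auto simp: divisor_real_part_def divisor_of_def real_points_def)
  have "{A. D A \<noteq> 0} \<subseteq> {A \<in> real_points X. order_at X A q \<noteq> 0}"
    by (auto simp: D_def split: if_splits)
  then have "finite {A. D A \<noteq> 0}" using finite_real_zeros[OF P2_R2[OF qP] q0] finite_subset by blast
  then have "totally_real_effective X D"
    by (auto simp: totally_real_effective_def is_divisor_def D_def real_points_def split: if_splits)
  moreover have "divisor_real_part X (divisor_of X w) = (\<lambda>A. 2 * D A)" if w: "w \<in> cone_rel_interior F" for w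
  proof -
    have wF: "w \<in> F" using w cone_rel_interior_subset by blast
    have "order_at X A w = order_at X A q" if "A \<in> real_points X" for A
      using rel_interior_order_le[OF F q wF rel_interior_nonzero[OF F w] that]
        rel_interior_order_le[OF F w qF q0 that] by simp
    then show ?thesis by (auto simp: fun_eq_iff real_div twoD)
  qed
  ultimately have "face_divisor X F = D"
    unfolding face_divisor_def
  proof (intro the_equality conjI ballI)
    fix E assume "totally_real_effective X E \<and>
      (\<forall>q\<in>cone_rel_interior F. divisor_real_part X (divisor_of X q) = (\<lambda>A. 2 * E A))"
    then have "(\<lambda>A. 2 * E A) = divisor_real_part X (divisor_of X q)" using q by simp
    then have "2 * E A = 2 * D A" for A unfolding fun_eq_iff real_div twoD by simp
    then show "E = D" by (simp add: fun_eq_iff)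
  qed blast+
  then show ?thesis using twoD by simp
qed

text \<open>Only real points impose a condition: elsewhere the face divisor is 0 and
  \<open>divisor_of\<close> is nonnegative.\<close>

lemma div_ge_face_divisor_iff:
  assumes F: "F \<in> nonzero_faces X" and q: "q \<in> cone_rel_interior F"
  shows "div_ge X w (\<lambda>A. 2 * face_divisor X F A) \<longleftrightarrow>
    w = 0 \<or> (\<forall>A\<in>real_points X. order_at X A q \<le> order_at X A w)"
  unfolding div_ge_def le_fun_def face_divisor_eq[OF F q]
  by (auto simp: divisor_of_def real_points_def)

text \<open>A form \<open>w\<close> whose orders are at least those of an interior \<open>q\<close>
  satisfies \<open>w + (C q - w) = C q\<close> with both summands nonnegative, so the face property
  puts \<open>w\<close> into \<open>F\<close>.\<close>

lemma divisor_face_face_divisor: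
  assumes F: "F \<in> nonzero_faces X"
  shows "divisor_face X (face_divisor X F) = F"
proof -
  obtain q where q: "q \<in> cone_rel_interior F" by (rule obtain_rel_interior[OF F])
  have qF: "q \<in> F" using q cone_rel_interior_subset by blast
  have qP: "q \<in> P2 X" using qF faceD(2)[OF F] by blast
  note cone = faceD(1)[OF F, unfolded convex_cone_iff]
  show ?thesis
  proof (intro subset_antisym subsetI)
    fix w assume "w \<in> divisor_face X (face_divisor X F)"
    then have w: "w \<in> P2 X" "w = 0 \<or> (\<forall>A\<in>real_points X. order_at X A q \<le> order_at X A w)"
      by (auto simp: divisor_face_def div_ge_face_divisor_iff[OF F q])
    then obtain C where C: "C > 0" "C *\<^sub>R q - w \<in> P2 X"
      using P2_dominated[OF w(1) qP rel_interior_nonzero[OF F q]] by blast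
    have "w + (C *\<^sub>R q - w) \<in> F" using cone qF C(1) by simp
    then show "w \<in> F" using faceD(4)[OF F w(1) C(2)] by blast
  next
    fix w assume w: "w \<in> F"
    then show "w \<in> divisor_face X (face_divisor X F)"
      using rel_interior_order_le[OF F q w] faceD(2)[OF F]
      by (auto simp: divisor_face_def div_ge_face_divisor_iff[OF F q])
  qed
qed

text \<open>Writing the divisor as that of a face \<open>G\<close> turns the right side into
  \<open>G \<subseteq> F\<close>. An interior form of \<open>G\<close> then lies in
  \<open>F\<close>, where its orders are at least those of an interior form of
  \<open>F\<close>.\<close>

lemma galois_connection:
  assumes F: "F \<in> nonzero_faces X" and G: "G \<in> nonzero_faces X"
  shows "face_divisor X F \<le> face_divisor X G \<longleftrightarrow> divisor_face X (face_divisor X G) \<subseteq> F"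
proof
  assume le: "face_divisor X F \<le> face_divisor X G"
  then have "(\<lambda>A. 2 * face_divisor X F A) \<le> (\<lambda>A. 2 * face_divisor X G A)" by (simp add: le_fun_def)
  then have "divisor_face X (face_divisor X G) \<subseteq> divisor_face X (face_divisor X F)"
    unfolding divisor_face_def div_ge_def by (blast intro: order_trans)
  then show "divisor_face X (face_divisor X G) \<subseteq> F" by (simp only: divisor_face_face_divisor[OF F])
next
  assume "divisor_face X (face_divisor X G) \<subseteq> F"
  then have GF: "G \<subseteq> F" by (simp only: divisor_face_face_divisor[OF G])
  obtain q where q: "q \<in> cone_rel_interior F" by (rule obtain_rel_interior[OF F])
  obtain w where w: "w \<in> cone_rel_interior G" by (rule obtain_rel_interior[OF G])
  then have "w \<in> F" using GF cone_rel_interior_subset by blast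
  then have "2 * face_divisor X F A \<le> 2 * face_divisor X G A" for A
    unfolding face_divisor_eq[OF F q] face_divisor_eq[OF G w]
    using rel_interior_order_le[OF F q _ rel_interior_nonzero[OF G w]] by simp
  then show "face_divisor X F \<le> face_divisor X G" by (simp add: le_fun_def)
qed

end

theorem theorem1:
  fixes X :: "'n::finite proj set"
  assumes "real_projective_curve X"
    and "smooth_curve X"
    and "zariski_irreducible X"
    and "totally_real_curve X"
  shows "(\<forall>F\<in>nonzero_faces X. \<forall>D\<in>face_divisor X ` nonzero_faces X.
            face_divisor X F \<le> D \<longleftrightarrow> F \<supseteq> divisor_face X D) \<and>
         (\<forall>F\<in>nonzero_faces X. divisor_face X (face_divisor X F) = F)"
proof -
  interpret totally_real_smooth_curve X by unfold_locales fact+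
  show ?thesis using galois_connection divisor_face_face_divisor by blast
qed

end
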